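(* Let $p \in \mathbb{R}\setminus[0,1]$ and let $f:\mathbb{R}^n\to[0,\infty)$ be a smooth bounded function with $\int_{\mathbb{R}^n} f^p\,d\gamma_n<\infty$. Then $$\int_{\mathbb{R}^n} f^{p}\, F_{\frac{1}{p-1}}\!\left(\frac{|\nabla f|}{f}\right) d\gamma_n \;\le\; \left(\int_{\mathbb{R}^n} f\, d\gamma_n\right)^{p}.$$ If instead $p\in(0,1)$, the reverse inequality holds.
   Context: $d\gamma_n(x)=(2\pi)^{-n/2}e^{-|x|^2/2}\,dx$ is the standard Gaussian measure on $\mathbb{R}^n$. For real $k$, the Hermite function $H_k:\mathbb{R}\to\mathbb{R}$ is the (unique) solution of $H_k''(x)-xH_k'(x)+kH_k(x)=0$ with $H_k(x)=x^k+o(x^k)$ as $x\to+\infty$; for nonnegative integers $k$ it is the monic probabilists' Hermite polynomial, and in general $H_k(x)=e^{x^2/4}D_k(x)$ with $D_k$ the parabolic cylinder function. It satisfies $H_k'=kH_{k-1}$ and $H_{k+1}(x)=xH_k(x)-H_k'(x)$. For $k\le 0$, $H_k>0$ on $\mathbb{R}$; for $k>0$ let $R_k$ denote the rightmost real zero of $H_k$, and set $R_k=-\infty$ if $k\le 0$. For $k\in\mathbb{R}\setminus\{0,-1\}$ the map $q\mapsto |H_k'(q)/H_k(q)|$ is a decreasing bijection of $(R_k,\infty)$ onto $(0,\infty)$, and $F_k:[0,\infty)\to\mathbb{R}$ is defined by $$F_k\!\left(\left|\frac{H_k'(q)}{H_k(q)}\right|\right)=\frac{H_{k+1}(q)}{H_k(q)^{1+\frac1k}},\qquad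 q\in(R_k,\infty),$$ together with $F_k(0)=1$. (For $p\in\mathbb{R}\setminus[0,1]$ one has $k=\frac1{p-1}\in(-1,0)\cup(0,\infty)$, and for $p\in(0,1)$ one has $k<-1$.) *)

theory Defs
  imports "HOL-Analysis.Analysis" "HOL-Library.Landau_Symbols"
begin

definition hermite_ode :: "real \<Rightarrow> (real \<Rightarrow> real) \<Rightarrow> bool" where
  "hermite_ode k H \<longleftrightarrow>
     (\<forall>x. H differentiable at x \<and> deriv H differentiable at x \<and>
          deriv (deriv H) x - x * deriv H x + k * H x = 0) \<and>
     (\<lambda>x. H x - x powr k) \<in> o[at_top](\<lambda>x. x powr k)"

definition hermite :: "real \<Rightarrow> real \<Rightarrow> real" where
  "hermite k = (THE H. hermite_ode k H)"

definition hermite_R :: "real \<Rightarrow> ereal" where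
  "hermite_R k = (if k \<le> 0 then -\<infinity> else ereal (Sup {x. hermite k x = 0}))"

definition hermite_F :: "real \<Rightarrow> real \<Rightarrow> real" where
  "hermite_F k t =
     (if t = 0 then 1
      else (let q = (THE q. hermite_R k < ereal q \<and>
                             \<bar>deriv (hermite k) q / hermite k q\<bar> = t)
            in hermite (k + 1) q / (hermite k q) powr (1 + 1 / k)))"

definition gaussian :: "'a::euclidean_space measure" where
  "gaussian = density lborel
     (\<lambda>x. ennreal ((2 * pi) powr (- real DIM('a) / 2) * exp (- (norm x)\<^sup>2 / 2)))"

fun Cm :: "nat \<Rightarrow> ('a::euclidean_space \<Rightarrow> real) \<Rightarrow> bool" where
  "Cm 0 f = continuous_on UNIV f"
| "Cm (Suc m) f = ((\<forall>x. f differentiable at x) \<and>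
     (\<forall>b\<in>Basis. Cm m (\<lambda>x. frechet_derivative f (at x) b)))"

definition smooth :: "('a::euclidean_space \<Rightarrow> real) \<Rightarrow> bool" where
  "smooth f \<longleftrightarrow> (\<forall>m. Cm m f)"

definition grad :: "('a::euclidean_space \<Rightarrow> real) \<Rightarrow> 'a \<Rightarrow> 'a" where
  "grad f x = (\<Sum>b\<in>Basis. frechet_derivative f (at x) b *\<^sub>R b)"

definition epow :: "real \<Rightarrow> real \<Rightarrow> ennreal" where
  "epow t p = (if t = 0 \<and> p < 0 then \<infinity> else ennreal (t powr p))"

end

theory Submission
  imports Defs "HOL-Probability.Probability" "HOL-Real_Asymp.Real_Asymp"
begin

text \<open>
  Let \<open>k = 1 / (p - 1)\<close> and \<open>M x y = x powr p * F (y / x)\<close>, up to sign. In the coordinates \<open>x = c\<^sup>k H\<^sub>k(q)\<close>,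
  \<open>y = \<bar>k\<bar> c\<^sup>k H\<^sub>k\<^sub>-\<^sub>1(q)\<close> one has \<open>M = c\<^sup>k\<^sup>+\<^sup>1 H\<^sub>k\<^sub>+\<^sub>1(q)\<close>, and \<open>M\<close> is concave in \<open>y\<close>: for every slope \<open>s\<close> it lies below
  a function \<open>U\<^sub>s(x) - \<bar>p\<bar> s y\<close> that touches it where \<open>c = s\<close>, and there \<open>U\<^sub>s''(x) y = \<bar>p\<bar> s\<close>.

  For the heat flow \<open>f\<^sub>r\<close> of \<open>f\<close>, run from time \<open>r\<^sup>2\<close> to time \<open>1\<close>, this majorant has no drift at the touching point
  when it is evaluated at \<open>(f\<^sub>r, r \<bar>\<nabla>f\<^sub>r\<bar>)\<close>. Hence the Gaussian average of \<open>M(f\<^sub>r, r \<bar>\<nabla>f\<^sub>r\<bar>)\<close> increases in each step from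
  \<open>r + d\<close> to \<open>r\<close> up to an error \<open>O(d powr (3/2))\<close>, and between \<open>r = 1\<close> and \<open>r = 0\<close> one reads off the inequality
  for functions that are bounded, bounded below and have bounded Lipschitz gradient. The general case follows by
  flattening small values, dilating by a factor \<open>s < 1\<close> and cutting off at infinity.
\<close>

subsection \<open>Hermite functions\<close>

text \<open>Only one-sided information about \<open>F\<close> enters: up to the sign it is
  nonincreasing and lies below its tangents, so no second derivative of \<open>M\<close> in
  \<open>y\<close> occurs. The term linear in \<open>y\<close> is handled by Cauchy-Schwarz, which
  bounds the norm of a gradient from below by its component along the averaged gradient; the average
  of that component is exact. What remains is the balance \<open>r\<^sup>2 - r * (r + d) + ((r +
  d)\<^sup>2 - r\<^sup>2) / 2 = d\<^sup>2 / 2\<close>, in which all terms of first order in the step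
  cancel. The obstacle is uniformity: as \<open>y\<close> tends to 0 the touching parameter
  \<open>q\<close> runs off to infinity, and a third-order expansion of \<open>U\<^sub>s\<close>
  with constants independent of the touching point is possible only because the powers of
  \<open>s\<close> and \<open>x\<close> combine into quotients of Hermite functions with finite
  limits. A discrete flow asks for no time derivative and for no regularity of \<open>F\<close>
  beyond its tangents; over \<open>1 / d\<close> steps the errors add up to order
  \<open>sqrt d\<close>.\<close>

definition hermite_kernel :: "real \<Rightarrow> real \<Rightarrow> real \<Rightarrow> real" where
  "hermite_kernel a x t = t powr (a - 1) * exp (- (x * t) - t\<^sup>2 / 2)"

text \<open>For \<open>a > 0\<close> this is \<open>Gamma a\<close> times the Hermite function of
  index \<open>- a\<close>. Negative indices are reached in this way, all others by the
  recurrence.\<close>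

definition hermite_integral :: "real \<Rightarrow> real \<Rightarrow> real" where
  "hermite_integral a x = (LBINT t:{0<..}. hermite_kernel a x t)"

lemma has_bochner_integral_Gamma_scaled:
  assumes "a > 0" "c > (0::real)"
  shows "has_bochner_integral lborel (\<lambda>t. indicator {0<..} t *\<^sub>R (t powr (a - 1) * exp (- (c * t)))) (Gamma a / c powr a)"
proof -
  let ?f = "\<lambda>t::real. indicator {0<..} t *\<^sub>R (t powr (a - 1) * exp (- t))"
  have "((\<lambda>t. t powr (a - 1) / exp t) has_integral Gamma a) {0..}"
    by (rule Gamma_integral_real) fact
  then have "((\<lambda>t. t powr (a - 1) / exp t) has_integral Gamma a) {0<..}"
    by (subst has_integral_spike_set_eq[of _ "{0..}"]) (auto intro: negligible_subset[of "{0}"])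
  then have "(\<integral>\<^sup>+ x. ennreal (indicator {0<..} x * (x powr (a - 1) / exp x)) \<partial>lborel) = ennreal (Gamma a)"
    using Gamma_real_pos[OF assms(1)]
    by (intro nn_integral_has_integral_lebesgue) (auto simp: )
  then have "(\<integral>\<^sup>+ x. ennreal (?f x) \<partial>lborel) = ennreal (Gamma a)"
    by (simp add: exp_minus divide_inverse)
  then have B: "has_bochner_integral lborel ?f (Gamma a)"
    using Gamma_real_pos[OF assms(1)]
    by (intro has_bochner_integral_nn_integral) auto
  have "has_bochner_integral lborel (\<lambda>t. ?f (0 + c * t)) (Gamma a /\<^sub>R \<bar>c\<bar>)"
    using lborel_has_bochner_integral_real_affine_iff[of c ?f "Gamma a" 0] B assms by simp
  then have "has_bochner_integral lborel (\<lambda>t. c powr (1 - a) * ?f (0 + c * t)) (c powr (1 - a) * (Gamma a /\<^sub>R \<bar>c\<bar>))"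
    by (rule has_bochner_integral_mult_right)
  moreover have "c powr (1 - a) * (Gamma a /\<^sub>R \<bar>c\<bar>) = Gamma a / c powr a"
    using assms by (simp add: powr_diff divide_simps)
  moreover have "c powr (1 - a) * ?f (0 + c * t) = indicator {0<..} t *\<^sub>R (t powr (a - 1) * exp (- (c * t)))" for t
    using assms by (auto simp: indicator_def powr_mult zero_less_mult_iff powr_diff divide_simps)
  ultimately show ?thesis by (simp only:)
qed

lemma integrable_hermite_kernel:
  assumes "a > 0"
  shows "integrable lborel (\<lambda>t. indicator {0<..} t *\<^sub>R hermite_kernel a x t)"
proof (rule Bochner_Integration.integrable_bound)
  show "integrable lborel (\<lambda>t. exp ((1 - x)\<^sup>2 / 2) * (indicator {0<..} t *\<^sub>R (t powr (a - 1) * exp (- (1 * t)))))"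
    using has_bochner_integral_Gamma_scaled[OF assms, of 1]
    by (intro integrable_mult_right) (auto simp: has_bochner_integral_iff)
  show "(\<lambda>t. indicator {0<..} t *\<^sub>R hermite_kernel a x t) \<in> borel_measurable lborel"
    unfolding hermite_kernel_def by measurable
  \<comment> \<open>Completing the square at \<open>t = 1 - x\<close> trades the Gaussian factor for
    \<open>exp (- t)\<close>, so the Gamma integral at scale 1 dominates for every real
    \<open>x\<close>.\<close>
  have "exp (- (x * t) - t\<^sup>2 / 2) \<le> exp ((1 - x)\<^sup>2 / 2) * exp (- t)" for t
  proof -
    have "0 \<le> (t - (1 - x))\<^sup>2" by simp
    then have "- (x * t) - t\<^sup>2 / 2 \<le> (1 - x)\<^sup>2 / 2 + (- t)"
      by (simp add: power2_eq_square algebra_simps)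
    then show ?thesis by (simp add: exp_add[symmetric])
  qed
  then have "t powr (a - 1) * exp (- (x * t) - t\<^sup>2 / 2) \<le> t powr (a - 1) * (exp ((1 - x)\<^sup>2 / 2) * exp (- t))" for t
    by (intro mult_left_mono) auto
  then show "AE t in lborel. norm (indicator {0<..} t *\<^sub>R hermite_kernel a x t)
      \<le> norm (exp ((1 - x)\<^sup>2 / 2) * (indicator {0<..} t *\<^sub>R (t powr (a - 1) * exp (- (1 * t)))))"
    by (intro AE_I2) (auto simp: hermite_kernel_def indicator_def abs_mult mult_ac)
qed

lemma hermite_kernel_shift: "t > 0 \<Longrightarrow> t ^ n * hermite_kernel a x t = hermite_kernel (a + n) x t"
proof -
  assume t: "t > 0"
  have "t ^ n * t powr (a - 1) = t powr (a + n - 1)"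
    unfolding powr_realpow[OF t, symmetric] powr_add[symmetric] by (simp add: algebra_simps)
  then show ?thesis by (simp add: hermite_kernel_def flip: mult.assoc)
qed

lemma exp_quadratic_bound: "\<bar>exp u - 1 - u\<bar> \<le> u\<^sup>2 * exp \<bar>u\<bar>" for u :: real
proof (cases "u = 0")
  case False
  obtain t where t: "\<bar>t\<bar> \<le> \<bar>u\<bar>" "exp u = (\<Sum>m<2. u ^ m / fact m) + exp t / fact 2 * u ^ 2"
    using Maclaurin_exp_le[of u 2] by auto
  have "exp u - 1 - u = exp t / 2 * u\<^sup>2"
    using t(2) by (simp add: numeral_2_eq_2)
  then have "\<bar>exp u - 1 - u\<bar> = exp t / 2 * u\<^sup>2"
    by (simp only: abs_of_nonneg zero_le_power2 mult_nonneg_nonneg divide_nonneg_nonneg exp_ge_zero zero_le_numeral)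
  also have "\<dots> \<le> exp \<bar>u\<bar> * u\<^sup>2"
  proof (rule mult_right_mono)
    have "exp t \<le> exp \<bar>u\<bar>" using t(1) by simp
    then show "exp t / 2 \<le> exp \<bar>u\<bar>" using exp_ge_zero[of t] by linarith
  qed simp
  finally show ?thesis by (simp add: mult.commute)
qed simp

text \<open>Differentiation under the integral is replaced by an explicit second-order remainder.
  The kernel at \<open>x + h\<close> is the kernel at \<open>x\<close> times
  \<open>exp (- h * t)\<close>, and for \<open>\<bar>h\<bar> \<le> 1\<close> the remainder carries
  the factor \<open>h\<^sup>2 * t\<^sup>2 * exp t\<close>. Here \<open>t\<^sup>2\<close> raises
  \<open>a\<close> by 2 and \<open>exp t\<close> lowers \<open>x\<close> by 1, which gives an
  integral of the same family.\<close>

lemma hermite_integral_deriv: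
  assumes a: "a > 0"
  shows "(hermite_integral a has_real_derivative - hermite_integral (a + 1) x) (at x)"
proof -
  let ?E = "\<lambda>a x t. indicator {0<..} t *\<^sub>R hermite_kernel a x t"
  have I: "integrable lborel (?E b y)" if "b > 0" for b y
    using integrable_hermite_kernel[OF that] .
  have bound: "\<bar>hermite_integral a (x + h) - hermite_integral a x + h * hermite_integral (a + 1) x\<bar>
      \<le> h\<^sup>2 * hermite_integral (a + 2) (x - 1)" if h: "\<bar>h\<bar> \<le> 1" for h
  proof -
    have eq: "hermite_integral a (x + h) - hermite_integral a x + h * hermite_integral (a + 1) x
        = (LINT t|lborel. ?E a (x + h) t - ?E a x t + h * ?E (a + 1) x t)"
      unfolding hermite_integral_def set_lebesgue_integral_def
      using I[of a x] I[of a "x + h"] I[of "a + 1" x] a by simp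
    have "\<bar>LINT t|lborel. ?E a (x + h) t - ?E a x t + h * ?E (a + 1) x t\<bar> \<le> (LINT t|lborel. h\<^sup>2 * ?E (a + 2) (x - 1) t)"
    proof (rule order_trans[OF integral_abs_bound integral_mono])
      show "integrable lborel (\<lambda>t. \<bar>?E a (x + h) t - ?E a x t + h * ?E (a + 1) x t\<bar>)"
        using I[of a x] I[of a "x + h"] I[of "a + 1" x] a by simp
      show "integrable lborel (\<lambda>t. h\<^sup>2 * ?E (a + 2) (x - 1) t)"
        using I[of "a + 2" "x - 1"] a by simp
      fix t :: real
      show "\<bar>?E a (x + h) t - ?E a x t + h * ?E (a + 1) x t\<bar> \<le> h\<^sup>2 * ?E (a + 2) (x - 1) t"
      proof (cases "t > 0")
        case True
        have "hermite_kernel a (x + h) t - hermite_kernel a x t + h * hermite_kernel (a + 1) x t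
            = hermite_kernel a x t * (exp (- h * t) - 1 - (- h * t))"
          using hermite_kernel_shift[OF True, of 1 a x]
          by (simp add: hermite_kernel_def algebra_simps flip: exp_add)
        then have "\<bar>hermite_kernel a (x + h) t - hermite_kernel a x t + h * hermite_kernel (a + 1) x t\<bar>
            = hermite_kernel a x t * \<bar>exp (- h * t) - 1 - (- h * t)\<bar>"
          by (simp add: abs_mult hermite_kernel_def)
        also have "\<dots> \<le> hermite_kernel a x t * ((- h * t)\<^sup>2 * exp \<bar>- h * t\<bar>)"
          by (intro mult_left_mono exp_quadratic_bound) (simp add: hermite_kernel_def)
        also have "\<dots> \<le> hermite_kernel a x t * ((- h * t)\<^sup>2 * exp t)"
          using True h by (intro mult_left_mono) (auto simp: abs_mult hermite_kernel_def mult_left_le_one_le)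
        also have "\<dots> = h\<^sup>2 * (t ^ 2 * hermite_kernel a (x - 1) t)"
        proof -
          have "exp (- (x * t) - t\<^sup>2 / 2) * exp t = exp (- ((x - 1) * t) - t\<^sup>2 / 2)"
            unfolding exp_add[symmetric] by (simp add: algebra_simps)
          then show ?thesis
            unfolding hermite_kernel_def by (simp add: power_mult_distrib mult_ac)
        qed
        also have "\<dots> = h\<^sup>2 * hermite_kernel (a + 2) (x - 1) t"
          using hermite_kernel_shift[OF True, of 2 a "x - 1"] by simp
        finally show ?thesis using True by simp
      qed simp
    qed
    also have "\<dots> = h\<^sup>2 * hermite_integral (a + 2) (x - 1)"
      unfolding hermite_integral_def set_lebesgue_integral_def by (rule integral_mult_right_zero)
    finally show ?thesis unfolding eq .
  qed
  have "(\<lambda>h. (hermite_integral a (x + h) - hermite_integral a x) / h - - hermite_integral (a + 1) x) \<midarrow>0\<rightarrow> 0"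
  proof (rule Lim_transform_bound)
    show "\<forall>\<^sub>F h in at 0. norm ((hermite_integral a (x + h) - hermite_integral a x) / h - - hermite_integral (a + 1) x)
        \<le> norm (\<bar>h\<bar> * hermite_integral (a + 2) (x - 1))"
    proof (rule eventually_at[THEN iffD2], intro exI[of _ 1] conjI ballI impI)
      fix h :: real assume h: "h \<noteq> 0 \<and> dist h 0 < 1"
      have "(hermite_integral a (x + h) - hermite_integral a x) / h - - hermite_integral (a + 1) x
          = (hermite_integral a (x + h) - hermite_integral a x + h * hermite_integral (a + 1) x) / h"
        using h by (simp add: field_simps)
      then have "norm ((hermite_integral a (x + h) - hermite_integral a x) / h - - hermite_integral (a + 1) x)
          = \<bar>hermite_integral a (x + h) - hermite_integral a x + h * hermite_integral (a + 1) x\<bar> / \<bar>h\<bar>"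
        by simp
      also have "\<dots> \<le> h\<^sup>2 * hermite_integral (a + 2) (x - 1) / \<bar>h\<bar>"
        using bound[of h] h by (intro divide_right_mono) auto
      also have "\<dots> = \<bar>h\<bar> * hermite_integral (a + 2) (x - 1)"
        using h by (simp add: power2_eq_square field_simps)
      also have "\<dots> \<le> norm (\<bar>h\<bar> * hermite_integral (a + 2) (x - 1))" by simp
      finally show "norm ((hermite_integral a (x + h) - hermite_integral a x) / h - - hermite_integral (a + 1) x)
        \<le> norm (\<bar>h\<bar> * hermite_integral (a + 2) (x - 1))" .
    qed simp
    show "(\<lambda>h. \<bar>h\<bar> * hermite_integral (a + 2) (x - 1)) \<midarrow>0\<rightarrow> 0"
      by (auto intro!: tendsto_eq_intros)
  qed
  then show ?thesis
    unfolding DERIV_def by (rule LIM_zero_cancel)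
qed

text \<open>Integration by parts: the difference of the two sides is the integral of the derivative
  of \<open>hermite_kernel (a + 1) x\<close>, which vanishes at both ends of the half-line, at 0
  because \<open>a > 0\<close>.\<close>

lemma hermite_integral_rec:
  assumes a: "a > 0"
  shows "a * hermite_integral a x = x * hermite_integral (a + 1) x + hermite_integral (a + 2) x"
proof -
  let ?E = "\<lambda>a x t. indicator {0<..} t *\<^sub>R hermite_kernel a x t"
  let ?f = "\<lambda>t. a * hermite_kernel a x t - x * hermite_kernel (a + 1) x t - hermite_kernel (a + 2) x t"
  have I: "integrable lborel (?E b y)" if "b > 0" for b y
    using integrable_hermite_kernel[OF that] .
  have ein: "einterval 0 \<infinity> = {0<..}"
    by (auto simp: einterval_def)
  have "(LBINT t=0..\<infinity>. ?f t) = 0 - 0"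
  proof (rule interval_integral_FTC_integrable)
    fix t :: real assume "0 < ereal t"
    then have t: "t > 0" by simp
    have "((\<lambda>t. t powr a * exp (- (x * t) - t\<^sup>2 / 2)) has_real_derivative
        (a * t powr (a - 1)) * exp (- (x * t) - t\<^sup>2 / 2) + t powr a * (exp (- (x * t) - t\<^sup>2 / 2) * (- x - t))) (at t)"
      using t by (auto intro!: derivative_eq_intros)
    moreover have "(a * t powr (a - 1)) * exp (- (x * t) - t\<^sup>2 / 2) + t powr a * (exp (- (x * t) - t\<^sup>2 / 2) * (- x - t)) = ?f t"
      using hermite_kernel_shift[OF t, of 1 a x] hermite_kernel_shift[OF t, of 2 a x] t
      by (simp add: hermite_kernel_def powr_diff field_simps power2_eq_square)
    ultimately show "((\<lambda>t. hermite_kernel (a + 1) x t) has_vector_derivative ?f t) (at t)"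
      by (simp add: hermite_kernel_def has_real_derivative_iff_has_vector_derivative)
    show "isCont ?f t"
      unfolding hermite_kernel_def using t by (auto intro!: continuous_intros)
  next
    show "set_integrable lborel (einterval 0 \<infinity>) ?f"
      unfolding ein using I[folded set_integrable_def] a
      by (intro set_integral_diff(1) set_integrable_mult_right) simp_all
    have "((\<lambda>t. hermite_kernel (a + 1) x t) \<longlongrightarrow> 0) (at_right 0)"
      unfolding hermite_kernel_def using a 
      by (auto intro!: tendsto_eq_intros simp: eventually_at_filter)
    then show "((hermite_kernel (a + 1) x \<circ> real_of_ereal) \<longlongrightarrow> 0) (at_right 0)"
      unfolding zero_ereal_def ereal_tendsto_simps .
    have "((\<lambda>t. t powr a * exp (- (x * t) - t\<^sup>2 / 2)) \<longlongrightarrow> 0) at_top"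
      by real_asymp
    then show "((hermite_kernel (a + 1) x \<circ> real_of_ereal) \<longlongrightarrow> 0) (at_left \<infinity>)"
      unfolding ereal_tendsto_simps by (simp add: hermite_kernel_def[abs_def])
  qed simp
  then have "0 = (LINT t|lborel. indicator {0<..} t *\<^sub>R ?f t)"
    by (simp add: interval_lebesgue_integral_def set_lebesgue_integral_def ein)
  also have "\<dots> = (LINT t|lborel. a * ?E a x t - x * ?E (a + 1) x t - ?E (a + 2) x t)"
    by (rule Bochner_Integration.integral_cong) (auto simp: indicator_def)
  also have "\<dots> = a * hermite_integral a x - x * hermite_integral (a + 1) x - hermite_integral (a + 2) x"
    unfolding hermite_integral_def set_lebesgue_integral_def
    using I[of a x] I[of "a + 1" x] I[of "a + 2" x] a by simp
  finally show ?thesis by simp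
qed

lemma hermite_integral_pos:
  assumes a: "a > 0"
  shows "hermite_integral a x > 0"
proof -
  let ?E = "\<lambda>t. indicator {0<..} t *\<^sub>R hermite_kernel a x t"
  have I: "integrable lborel ?E" using integrable_hermite_kernel[OF a] .
  have "hermite_integral a x \<ge> 0"
    unfolding hermite_integral_def set_lebesgue_integral_def
    by (intro integral_nonneg_AE AE_I2) (auto simp: hermite_kernel_def)
  moreover have "hermite_integral a x \<noteq> 0"
  proof
    assume "hermite_integral a x = 0"
    then have "AE t in lborel. ?E t = 0"
      unfolding hermite_integral_def set_lebesgue_integral_def
      by (subst (asm) integral_nonneg_eq_0_iff_AE[OF I]) (auto simp: hermite_kernel_def)
    then have "AE t in lborel. t \<notin> {0<..<(1::real)}"
      by eventually_elim (auto simp: hermite_kernel_def indicator_def)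
    then have "emeasure lborel {0<..<(1::real)} = 0"
      by (subst (asm) AE_iff_measurable[of "{0<..<1}"]) auto
    then show False by simp
  qed
  ultimately show ?thesis by simp
qed

text \<open>The bounds \<open>1 - t\<^sup>2 / 2 \<le> exp (- t\<^sup>2 / 2) \<le> 1\<close> enclose
  the integral between Gamma integrals; the two bounds differ by order \<open>1 / x\<^sup>2\<close>
  after scaling.\<close>

lemma hermite_integral_asymp:
  assumes a: "a > 0"
  shows "((\<lambda>x. hermite_integral a x * x powr a) \<longlongrightarrow> Gamma a) at_top"
proof (rule tendsto_sandwich)
  let ?G = "\<lambda>(b::real) (x::real) (t::real). indicator {0<..} t *\<^sub>R (t powr (b - 1) * exp (- (x * t)))"
  have G: "integrable lborel (?G b x)" "(LINT t|lborel. ?G b x t) = Gamma b / x powr b" if "b > 0" "x > 0" for b x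
    using has_bochner_integral_Gamma_scaled[OF that] by (simp_all add: has_bochner_integral_iff)
  have I: "integrable lborel (\<lambda>t. indicator {0<..} t *\<^sub>R hermite_kernel a x t)" for x
    using integrable_hermite_kernel[OF a] .
  have up: "hermite_integral a x * x powr a \<le> Gamma a" and
       lo: "Gamma a - Gamma (a + 2) / 2 / x\<^sup>2 \<le> hermite_integral a x * x powr a" if x: "x > 0" for x
  proof -
    have "hermite_integral a x \<le> (LINT t|lborel. ?G a x t)"
      unfolding hermite_integral_def set_lebesgue_integral_def
      using G(1)[OF a x] I
      by (intro integral_mono) (auto simp: hermite_kernel_def indicator_def intro!: mult_left_mono)
    then have "hermite_integral a x \<le> Gamma a / x powr a" using G(2)[OF a x] by simp
    then show "hermite_integral a x * x powr a \<le> Gamma a" using x by (simp add: field_simps)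
    have "(LINT t|lborel. ?G a x t - ?G (a + 2) x t / 2) \<le> hermite_integral a x"
      unfolding hermite_integral_def set_lebesgue_integral_def
    proof (rule integral_mono)
      show "integrable lborel (\<lambda>t. ?G a x t - ?G (a + 2) x t / 2)"
        using G(1)[OF a x] G(1)[of "a + 2", OF _ x] a by simp
      fix t :: real
      show "?G a x t - ?G (a + 2) x t / 2 \<le> indicator {0<..} t *\<^sub>R hermite_kernel a x t"
      proof (cases "t > 0")
        case True
        have "t powr (a - 1 + 2) = t powr (a - 1) * t\<^sup>2"
          using True unfolding powr_add by simp
        then have "t powr (a + 1) = t powr (a - 1) * t\<^sup>2" by (simp add: add.commute)
        then have "t powr (a - 1) * exp (- (x * t)) - t powr (a + 1) * exp (- (x * t)) / 2
           = t powr (a - 1) * exp (- (x * t)) * (1 + (- t\<^sup>2 / 2))"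
          by (simp add: algebra_simps)
        also have "\<dots> \<le> t powr (a - 1) * exp (- (x * t)) * exp (- t\<^sup>2 / 2)"
          by (intro mult_left_mono exp_ge_add_one_self) auto
        also have "\<dots> = hermite_kernel a x t"
        proof -
          have "exp (- (x * t)) * exp (- t\<^sup>2 / 2) = exp (- (x * t) - t\<^sup>2 / 2)"
            unfolding exp_add[symmetric] by simp
          then show ?thesis
            unfolding hermite_kernel_def by (simp only: mult.assoc)
        qed
        finally show ?thesis using True by (simp add: add.commute)
      qed simp
    qed (rule I)
    moreover have "(LINT t|lborel. ?G a x t - ?G (a + 2) x t / 2)
        = Gamma a / x powr a - Gamma (a + 2) / x powr (a + 2) / 2"
      using a x by (intro has_bochner_integral_integral_eq has_bochner_integral_diff has_bochner_integral_divide_zero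
          has_bochner_integral_Gamma_scaled) auto
    ultimately have "Gamma a / x powr a - Gamma (a + 2) / x powr (a + 2) / 2 \<le> hermite_integral a x"
      by linarith
    then have "(Gamma a / x powr a - Gamma (a + 2) / x powr (a + 2) / 2) * x powr a \<le> hermite_integral a x * x powr a"
      by (rule mult_right_mono) simp
    moreover have "x powr (a + 2) = x powr a * x\<^sup>2"
      using x unfolding powr_add by simp
    then have "(Gamma a / x powr a - Gamma (a + 2) / x powr (a + 2) / 2) * x powr a
        = Gamma a - Gamma (a + 2) / 2 / x\<^sup>2"
      using x by (simp add: left_diff_distrib)
    ultimately show "Gamma a - Gamma (a + 2) / 2 / x\<^sup>2 \<le> hermite_integral a x * x powr a"
      by linarith
  qed
  show "\<forall>\<^sub>F x in at_top. hermite_integral a x * x powr a \<le> Gamma a"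
    using eventually_gt_at_top[of 0] by eventually_elim (rule up)
  show "\<forall>\<^sub>F x in at_top. Gamma a - Gamma (a + 2) / 2 / x\<^sup>2 \<le> hermite_integral a x * x powr a"
    using eventually_gt_at_top[of 0] by eventually_elim (rule lo)
  show "((\<lambda>x. Gamma a - Gamma (a + 2) / 2 / x\<^sup>2) \<longlongrightarrow> Gamma a) at_top"
    by real_asymp
qed simp

text \<open>Level \<open>n\<close> is the Hermite function only for index \<open>k < n\<close>; the integral at level \<open>0\<close> needs \<open>k < 0\<close>.\<close>
fun hermite_lvl :: "nat \<Rightarrow> real \<Rightarrow> real \<Rightarrow> real" where
  "hermite_lvl 0 k x = hermite_integral (- k) x / Gamma (- k)"
| "hermite_lvl (Suc n) k x = x * hermite_lvl n (k - 1) x - (k - 1) * hermite_lvl n (k - 2) x"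

lemma hermite_lvl_0_deriv:
  assumes "k < 0"
  shows "(hermite_lvl 0 k has_real_derivative k * hermite_lvl 0 (k - 1) x) (at x)"
proof -
  have "((\<lambda>x. hermite_integral (- k) x / Gamma (- k)) has_real_derivative
      - hermite_integral (- k + 1) x / Gamma (- k)) (at x)"
    using assms by (intro DERIV_cdivide hermite_integral_deriv) simp
  moreover have "Gamma (- k + 1) = - k * Gamma (- k)"
    using assms Gamma_plus1[of "- k"] nonpos_Ints_nonpos[of "- k"] by force
  ultimately show ?thesis
    using assms Gamma_real_pos[of "- k"] by (simp add: algebra_simps fun_eq_iff[symmetric] hermite_lvl.simps(1)[abs_def] field_simps)
qed

lemma hermite_lvl_0_rec:
  assumes "k < - 1"
  shows "hermite_lvl 0 (k + 1) x = x * hermite_lvl 0 k x - k * hermite_lvl 0 (k - 1) x"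
proof -
  define a where "a = - k - 1"
  have a: "a > 0" using assms by (simp add: a_def)
  have G1: "Gamma (a + 1) = a * Gamma a" and G2: "Gamma (a + 2) = (a + 1) * (a * Gamma a)"
    using a Gamma_plus1[of a] Gamma_plus1[of "a + 1"] nonpos_Ints_nonpos[of a] nonpos_Ints_nonpos[of "a + 1"]
    by (force simp: add.assoc)+
  have k: "k = - a - 1" "- k = a + 1" "- (k + 1) = a" "- (k - 1) = a + 2" by (simp_all add: a_def)
  have "hermite_integral a x = (x * hermite_integral (a + 1) x + hermite_integral (a + 2) x) / a"
    using hermite_integral_rec[OF a, of x] a by (simp add: field_simps)
  then have "hermite_integral a x / Gamma a
      = x * (hermite_integral (a + 1) x / (a * Gamma a)) + hermite_integral (a + 2) x / (a * Gamma a)"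
    by (simp add: add_divide_distrib mult.commute)
  moreover have "k * (hermite_integral (a + 2) x / ((a + 1) * (a * Gamma a))) = - (hermite_integral (a + 2) x / (a * Gamma a))"
  proof -
    have "k = - (a + 1)" by (simp add: k(1))
    then show ?thesis using a by (simp del: k(1) minus_add_distrib)
  qed
  ultimately show ?thesis
    unfolding hermite_lvl.simps k(2-4) G1 G2 by linarith
qed

lemma hermite_lvl_0_asymp:
  assumes "k < 0"
  shows "((\<lambda>x. hermite_lvl 0 k x * x powr (- k)) \<longlongrightarrow> 1) at_top"
proof -
  have G: "Gamma (- k) > 0" using assms by (intro Gamma_real_pos) simp
  have "((\<lambda>x. hermite_integral (- k) x * x powr (- k) / Gamma (- k)) \<longlongrightarrow> Gamma (- k) / Gamma (- k)) at_top"
    by (intro tendsto_divide tendsto_const hermite_integral_asymp) (use assms G in linarith)+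
  then show ?thesis using G by (simp add: mult_ac)
qed

text \<open>The facts go up one level together: the derivative rule at the new level uses the
  recurrence at the old one, and in the asymptotics the second term of the recursion is smaller by
  the factor \<open>1 / x\<^sup>2\<close>.\<close>

lemma hermite_lvl_props:
  "k < real n \<Longrightarrow> (hermite_lvl n k has_real_derivative k * hermite_lvl n (k - 1) x) (at x)"
  "k + 1 < real n \<Longrightarrow> hermite_lvl n (k + 1) x = x * hermite_lvl n k x - k * hermite_lvl n (k - 1) x"
  "k < real n \<Longrightarrow> ((\<lambda>x. hermite_lvl n k x * x powr (- k)) \<longlongrightarrow> 1) at_top"
proof (induction n arbitrary: k x)
  case 0
  {
    case 1
    then show ?case using hermite_lvl_0_deriv by (simp del: hermite_lvl.simps)
  next
    case 2
    then show ?case using hermite_lvl_0_rec[of k x] by (simp del: hermite_lvl.simps)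
  next
    case 3
    then show ?case using hermite_lvl_0_asymp by (simp del: hermite_lvl.simps)
  }
next
  case (Suc n)
  \<comment> \<open>Where both levels are valid they agree, because the recursive clause is then the
    recurrence already known at level \<open>n\<close>.\<close>
  have same: "hermite_lvl (Suc n) j y = hermite_lvl n j y" if "j < real n" for j y
    using Suc.IH(2)[of "j - 1" y] that by simp
  {
    case 1
    then have k: "k - 1 < real n" "k - 2 < real n" by simp_all
    have d: "((\<lambda>x. x * hermite_lvl n (k - 1) x - (k - 1) * hermite_lvl n (k - 2) x) has_real_derivative
       1 * hermite_lvl n (k - 1) x + ((k - 1) * hermite_lvl n (k - 1 - 1) x) * x
       - (k - 1) * ((k - 2) * hermite_lvl n (k - 2 - 1) x)) (at x)"
      by (intro DERIV_diff DERIV_mult DERIV_ident DERIV_cmult Suc.IH(1) k)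
    have r: "hermite_lvl n (k - 1) x = x * hermite_lvl n (k - 2) x - (k - 2) * hermite_lvl n (k - 3) x"
      using Suc.IH(2)[of "k - 2" x] k by (simp add: algebra_simps)
    have "1 * hermite_lvl n (k - 1) x + ((k - 1) * hermite_lvl n (k - 1 - 1) x) * x
       - (k - 1) * ((k - 2) * hermite_lvl n (k - 2 - 1) x)
       = hermite_lvl n (k - 1) x + (k - 1) * (x * hermite_lvl n (k - 2) x - (k - 2) * hermite_lvl n (k - 3) x)"
      by (simp add: algebra_simps)
    then have "1 * hermite_lvl n (k - 1) x + ((k - 1) * hermite_lvl n (k - 1 - 1) x) * x
       - (k - 1) * ((k - 2) * hermite_lvl n (k - 2 - 1) x) = k * hermite_lvl n (k - 1) x"
      unfolding r[symmetric] by (simp add: left_diff_distrib)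
    with d have "((\<lambda>x. x * hermite_lvl n (k - 1) x - (k - 1) * hermite_lvl n (k - 2) x) has_real_derivative
       k * hermite_lvl n (k - 1) x) (at x)"
      by (rule DERIV_cong)
    then show ?case
      using same[OF k(1)] by (simp add: hermite_lvl.simps(2)[abs_def])
  next
    case 2
    have "hermite_lvl (Suc n) (k + 1) x = x * hermite_lvl n k x - k * hermite_lvl n (k - 1) x"
      by (simp add: algebra_simps)
    then show ?case using same[of k x] same[of "k - 1" x] 2 by simp
  next
    case 3
    then have k: "k - 1 < real n" "k - 2 < real n" by simp_all
    have "((\<lambda>x. hermite_lvl n (k - 1) x * x powr (- (k - 1)) - (k - 1) * (hermite_lvl n (k - 2) x * x powr (- (k - 2))) * (1 / x\<^sup>2))
       \<longlongrightarrow> 1 - (k - 1) * 1 * 0) at_top"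
      by (intro tendsto_intros Suc.IH(3) k) real_asymp
    moreover have "\<forall>\<^sub>F x in at_top. hermite_lvl n (k - 1) x * x powr (- (k - 1)) - (k - 1) * (hermite_lvl n (k - 2) x * x powr (- (k - 2))) * (1 / x\<^sup>2)
        = hermite_lvl (Suc n) k x * x powr (- k)"
      using eventually_gt_at_top[of 0]
    proof eventually_elim
      case (elim x)
      have "x powr (- (k - 1)) = x powr (- k) * x" "x powr (- (k - 2)) = x powr (- k) * x\<^sup>2"
        using elim powr_add[of x "- k" 1] powr_add[of x "- k" 2] by simp_all
      then show ?case using elim by (simp add: field_simps)
    qed
    ultimately show ?case using filterlim_cong[OF refl refl] by fastforce
  }
qed

section \<open>Uniqueness of the solution\<close>

lemma asymp_smallo:
  fixes H :: "real \<Rightarrow> real"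
  shows "(\<lambda>x. H x - x powr k) \<in> o[at_top](\<lambda>x. x powr k) \<longleftrightarrow> ((\<lambda>x. H x * x powr (- k)) \<longlongrightarrow> 1) at_top"
proof -
  have "(\<lambda>x. H x - x powr k) \<in> o[at_top](\<lambda>x. x powr k) \<longleftrightarrow> ((\<lambda>x. (H x - x powr k) / x powr k) \<longlongrightarrow> 0) at_top"
  proof -
    have "\<forall>\<^sub>F x in at_top. x powr k \<noteq> (0::real)"
      using eventually_gt_at_top[of "0::real"] by eventually_elim simp
    then show ?thesis
      by (auto intro: smalloI_tendsto dest: smalloD_tendsto)
  qed
  also have "\<dots> \<longleftrightarrow> ((\<lambda>x. H x * x powr (- k) - 1) \<longlongrightarrow> 0) at_top"
    by (rule filterlim_cong[OF refl refl])
       (use eventually_gt_at_top[of "0::real"] in eventually_elim, simp add: powr_minus divide_inverse algebra_simps)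
  also have "\<dots> \<longleftrightarrow> ((\<lambda>x. H x * x powr (- k)) \<longlongrightarrow> 1) at_top"
    by (simp add: LIM_zero_iff)
  finally show ?thesis .
qed

text \<open>Energy method: \<open>y\<^sup>2 + y'\<^sup>2\<close>, weighted by
  \<open>exp (M * x)\<close>, is nondecreasing up to \<open>X\<close>, hence at most its value 0
  there. The summand \<open>2 * (\<bar>x\<bar> + \<bar>X\<bar>)\<close> of \<open>M\<close> absorbs
  the unbounded coefficient of the equation on the segment from \<open>x\<close> to
  \<open>X\<close>.\<close>

lemma linear_ode_zero:
  fixes y y' :: "real \<Rightarrow> real"
  assumes d1: "\<And>x. (y has_real_derivative y' x) (at x)"
    and d2: "\<And>x. (y' has_real_derivative x * y' x - k * y x) (at x)"
    and z: "y X = 0" "y' X = 0" and x: "x \<le> X"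
  shows "y x = 0"
proof -
  define M where "M = 1 + \<bar>k\<bar> + 2 * (\<bar>x\<bar> + \<bar>X\<bar>)"
  let ?E = "\<lambda>x. ((y x)\<^sup>2 + (y' x)\<^sup>2) * exp (M * x)"
  have "?E x \<le> ?E X"
  proof (rule DERIV_nonneg_imp_nondecreasing[OF x], goal_cases)
    case (1 t)
    let ?d = "(2 * y t * y' t + 2 * y' t * (t * y' t - k * y t) + M * ((y t)\<^sup>2 + (y' t)\<^sup>2)) * exp (M * t)"
    have "(?E has_real_derivative ?d) (at t)"
      by (auto intro!: derivative_eq_intros d1 d2 simp: algebra_simps)
    moreover have "?d \<ge> 0"
    proof (rule mult_nonneg_nonneg)
      have p: "\<bar>2 * y t * y' t\<bar> \<le> (y t)\<^sup>2 + (y' t)\<^sup>2"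
        using sum_squares_bound[of "y t" "y' t"] sum_squares_bound[of "- y t" "y' t"] by (simp add: abs_if)
      have "\<bar>(1 - k) * (2 * y t * y' t)\<bar> \<le> (1 + \<bar>k\<bar>) * ((y t)\<^sup>2 + (y' t)\<^sup>2)"
        unfolding abs_mult[of "1 - k"] by (intro mult_mono p) auto
      have "\<bar>t * (2 * (y' t)\<^sup>2)\<bar> \<le> (\<bar>x\<bar> + \<bar>X\<bar>) * (2 * ((y t)\<^sup>2 + (y' t)\<^sup>2))"
        unfolding abs_mult[of t] using 1 by (intro mult_mono) auto
      have "(1 - k) * (2 * y t * y' t) + t * (2 * (y' t)\<^sup>2) + M * ((y t)\<^sup>2 + (y' t)\<^sup>2) \<ge> 0"
      proof -
        have "M * ((y t)\<^sup>2 + (y' t)\<^sup>2) = (1 + \<bar>k\<bar>) * ((y t)\<^sup>2 + (y' t)\<^sup>2)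
            + (\<bar>x\<bar> + \<bar>X\<bar>) * (2 * ((y t)\<^sup>2 + (y' t)\<^sup>2))"
          unfolding M_def by (simp add: algebra_simps)
        then show ?thesis
          using \<open>\<bar>(1 - k) * (2 * y t * y' t)\<bar> \<le> _\<close> \<open>\<bar>t * (2 * (y' t)\<^sup>2)\<bar> \<le> _\<close> by linarith
      qed
      then show "0 \<le> 2 * y t * y' t + 2 * y' t * (t * y' t - k * y t) + M * ((y t)\<^sup>2 + (y' t)\<^sup>2)"
        by (simp add: algebra_simps power2_eq_square)
    qed simp
    ultimately show ?case by blast
  qed
  then have "((y x)\<^sup>2 + (y' x)\<^sup>2) * exp (M * x) \<le> 0" using z by simp
  then have "(y x)\<^sup>2 + (y' x)\<^sup>2 \<le> 0" by (simp add: mult_le_0_iff)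
  then show "y x = 0" by (simp add: sum_power2_le_zero_iff)
qed

lemma hermite_ode_hermite_lvl:
  assumes k: "k < real n"
  shows "hermite_ode k (hermite_lvl n k)"
proof -
  note D = hermite_lvl_props(1)
  have d1: "deriv (hermite_lvl n k) = (\<lambda>x. k * hermite_lvl n (k - 1) x)"
    using DERIV_imp_deriv[OF D[OF k]] by auto
  have d2: "((\<lambda>x. k * hermite_lvl n (k - 1) x) has_real_derivative k * ((k - 1) * hermite_lvl n (k - 1 - 1) x)) (at x)" for x
    using k by (intro DERIV_cmult D) simp
  have "hermite_lvl n k x = x * hermite_lvl n (k - 1) x - (k - 1) * hermite_lvl n (k - 1 - 1) x" for x
    using hermite_lvl_props(2)[of "k - 1" n x] k by simp
  then have "k * ((k - 1) * hermite_lvl n (k - 1 - 1) x) - x * (k * hermite_lvl n (k - 1) x) + k * hermite_lvl n k x = 0" for x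
  proof -
    have "k * ((k - 1) * hermite_lvl n (k - 1 - 1) x) - x * (k * hermite_lvl n (k - 1) x) + k * hermite_lvl n k x
        = k * ((k - 1) * hermite_lvl n (k - 1 - 1) x - x * hermite_lvl n (k - 1) x + hermite_lvl n k x)"
      by (simp add: algebra_simps)
    also have "\<dots> = 0" unfolding \<open>\<And>x. hermite_lvl n k x = _\<close>[of x] by (simp add: algebra_simps)
    finally show ?thesis .
  qed
  then show ?thesis
    unfolding hermite_ode_def d1 asymp_smallo
    using D[OF k] d2 DERIV_imp_deriv[OF d2] hermite_lvl_props(3)[OF k]
    by (auto simp: real_differentiable_def)
qed

text \<open>The Wronskian of two solutions is a multiple of \<open>exp (x\<^sup>2 / 2)\<close>, which outgrows every power.\<close>
lemma hermite_ode_unique: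
  assumes A: "hermite_ode k H" and B: "hermite_ode k G"
  shows "G = H"
proof -
  have dH: "(H has_real_derivative deriv H x) (at x)" and dH': "(deriv H has_real_derivative x * deriv H x - k * H x) (at x)"
    and dG: "(G has_real_derivative deriv G x) (at x)" and dG': "(deriv G has_real_derivative x * deriv G x - k * G x) (at x)" for x
  proof -
    show "(H has_real_derivative deriv H x) (at x)" "(G has_real_derivative deriv G x) (at x)"
      using A B unfolding hermite_ode_def DERIV_deriv_iff_real_differentiable[symmetric] by auto
    have "deriv (deriv H) x = x * deriv H x - k * H x" "deriv (deriv G) x = x * deriv G x - k * G x"
      using A B unfolding hermite_ode_def by (auto simp: algebra_simps dest: spec[of _ x])
    then show "(deriv H has_real_derivative x * deriv H x - k * H x) (at x)"
       "(deriv G has_real_derivative x * deriv G x - k * G x) (at x)"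
      using A B DERIV_deriv_iff_real_differentiable[of "deriv H" x] DERIV_deriv_iff_real_differentiable[of "deriv G" x]
      unfolding hermite_ode_def by auto
  qed
  have aH: "((\<lambda>x. H x * x powr (- k)) \<longlongrightarrow> 1) at_top" and aG: "((\<lambda>x. G x * x powr (- k)) \<longlongrightarrow> 1) at_top"
    using A B unfolding hermite_ode_def asymp_smallo by auto
  define d where "d x = G x - H x" for x
  define d' where "d' x = deriv G x - deriv H x" for x
  have dd: "(d has_real_derivative d' x) (at x)" for x
    unfolding d_def[abs_def] d'_def by (intro DERIV_diff dG dH)
  have dd': "(d' has_real_derivative x * d' x - k * d x) (at x)" for x
    using DERIV_diff[OF dG'[of x] dH'[of x]] unfolding d_def d'_def[abs_def] by (simp add: algebra_simps)
  define W where "W x = (d x * deriv H x - d' x * H x) * exp (- (x\<^sup>2 / 2))" for x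
  have "(W has_real_derivative 0) (at x)" for x
    unfolding W_def[abs_def]
    by (auto intro!: derivative_eq_intros dd dd' dH dH' simp: algebra_simps power2_eq_square)
  then have "\<exists>C. \<forall>x. W x = C"
    using DERIV_const_ratio_const by (intro exI[of _ "W 0"]) (metis DERIV_isconst_all)
  then obtain C where C: "\<And>x. W x = C" by blast
  have WC: "d' x * H x - d x * deriv H x = - C * exp (x\<^sup>2 / 2)" for x
    using C[of x] by (simp add: W_def exp_minus field_simps)
  have posH: "\<forall>\<^sub>F x in at_top. H x > 0"
  proof -
    have "\<forall>\<^sub>F x in at_top. H x * x powr (- k) > 0"
      using order_tendstoD(1)[OF aH, of 0] by simp
    then show ?thesis
      using eventually_gt_at_top[of 0] by eventually_elim (auto simp: zero_less_mult_iff)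
  qed
  have e0: "((\<lambda>x. d x / H x) \<longlongrightarrow> 0) at_top"
  proof -
    have "((\<lambda>x. (G x * x powr (- k)) / (H x * x powr (- k)) - 1) \<longlongrightarrow> 1 / 1 - 1) at_top"
      by (intro tendsto_intros aG aH) simp
    moreover have "\<forall>\<^sub>F x in at_top. (G x * x powr (- k)) / (H x * x powr (- k)) - 1 = d x / H x"
      using posH eventually_gt_at_top[of 0] by eventually_elim (simp add: d_def field_simps)
    ultimately show ?thesis using filterlim_cong[OF refl refl] by fastforce
  qed
  have big: "\<forall>\<^sub>F x in at_top. exp (x\<^sup>2 / 2) / (H x)\<^sup>2 \<ge> 1"
  proof -
    have "((\<lambda>x. (H x * x powr (- k))\<^sup>2 * (x powr (2 * k) * exp (- (x\<^sup>2 / 2)))) \<longlongrightarrow> 1\<^sup>2 * 0) at_top"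
      by (intro tendsto_intros aH) real_asymp
    then have "\<forall>\<^sub>F x in at_top. (H x * x powr (- k))\<^sup>2 * (x powr (2 * k) * exp (- (x\<^sup>2 / 2))) < 1"
      by (rule order_tendstoD(2)) simp
    then show ?thesis using posH eventually_gt_at_top[of 0]
    proof eventually_elim
      case (elim x)
      have "(x powr (- k))\<^sup>2 * x powr (2 * k) = 1"
        using elim by (simp add: power2_eq_square powr_add[symmetric])
      then have "(H x * x powr (- k))\<^sup>2 * (x powr (2 * k) * exp (- (x\<^sup>2 / 2))) = (H x)\<^sup>2 * exp (- (x\<^sup>2 / 2))"
        by (simp add: power_mult_distrib)
      then show ?case using elim by (simp add: exp_minus field_simps)
    qed
  qed
  have small: "\<forall>\<^sub>F x in at_top. \<bar>d x / H x\<bar> < 1"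
    using tendstoD[OF e0, of 1] by (simp add: dist_real_def)
  obtain X where X: "\<And>x. x \<ge> X \<Longrightarrow> H x > 0 \<and> exp (x\<^sup>2 / 2) / (H x)\<^sup>2 \<ge> 1 \<and> \<bar>d x / H x\<bar> < 1"
    using eventually_conj[OF posH eventually_conj[OF big small]] unfolding eventually_at_top_linorder by auto
  have de: "((\<lambda>x. d x / H x) has_real_derivative - C * (exp (x\<^sup>2 / 2) / (H x)\<^sup>2)) (at x)" if "x \<ge> X" for x
  proof -
    have "((\<lambda>x. d x / H x) has_real_derivative (d' x * H x - d x * deriv H x) / (H x * H x)) (at x)"
      using X[OF that] by (intro DERIV_divide dd dH) auto
    then show ?thesis unfolding WC by (simp add: power2_eq_square)
  qed
  have "C = 0"
  proof (rule ccontr)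
    assume C0: "C \<noteq> 0"
    \<comment> \<open>Over a step of length \<open>3 / \<bar>C\<bar>\<close> the quotient
      \<open>d / H\<close> would change by at least 3, although both of its values have modulus
      below 1.\<close>
    define m where "m = 3 / \<bar>C\<bar>"
    have m: "m > 0" using C0 by (simp add: m_def)
    obtain z where z: "z > X" "z < X + m" and
      eq: "d (X + m) / H (X + m) - d X / H X = (X + m - X) * (- C * (exp (z\<^sup>2 / 2) / (H z)\<^sup>2))"
      using MVT2[of X "X + m" "\<lambda>x. d x / H x" "\<lambda>x. - C * (exp (x\<^sup>2 / 2) / (H x)\<^sup>2)"] de m by auto
    have "\<bar>(X + m - X) * (- C * (exp (z\<^sup>2 / 2) / (H z)\<^sup>2))\<bar> = (m * \<bar>C\<bar>) * (exp (z\<^sup>2 / 2) / (H z)\<^sup>2)"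
      using m by (simp add: abs_mult)
    also have "\<dots> \<ge> 3 * 1"
      using X[of z] z C0 unfolding m_def by (intro mult_mono) auto
    finally have "\<bar>d (X + m) / H (X + m) - d X / H X\<bar> \<ge> 3" unfolding eq by simp
    then show False using X[of X] X[of "X + m"] m by linarith
  qed
  have const: "d x / H x = d X / H X" if "x \<ge> X" for x
  proof (cases "x = X")
    case False
    have "continuous_on {X..x} (\<lambda>x. d x / H x)"
      by (rule continuous_at_imp_continuous_on) (auto intro: DERIV_isCont[OF de])
    with that False show ?thesis
      using DERIV_isconst_end[of X x "\<lambda>x. d x / H x"] de \<open>C = 0\<close> by auto
  qed simp
  have "d X / H X = 0"
  proof (rule tendsto_unique[OF _ _ e0])
    show "((\<lambda>x. d x / H x) \<longlongrightarrow> d X / H X) at_top"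
      by (rule tendsto_eventually, rule eventually_mono[OF eventually_ge_at_top[of X] const])
  qed simp
  then have dz: "d x = 0" if "x \<ge> X" for x using const[OF that, unfolded \<open>d X / H X = 0\<close>] X[OF that] by auto
  have d'z: "d' x = 0" if "x > X" for x
  proof (rule DERIV_unique[OF dd])
    show "(d has_real_derivative 0) (at x)"
      by (rule has_field_derivative_transform_within_open[of "\<lambda>_. 0" 0 x "{X<..}"]) (use that dz in auto)
  qed
  have "d x = 0" for x
  \<comment> \<open>The derivative \<open>d'\<close> is known to vanish only strictly beyond
    \<open>X\<close>, so backward uniqueness starts at \<open>X + 1\<close>.\<close>
  proof (cases "x \<le> X + 1")
    case True
    then show ?thesis using linear_ode_zero[OF dd dd', of "X + 1" x] dz d'z by simp
  qed (simp add: dz)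
  then show ?thesis by (auto simp: d_def)
qed

lemma hermite_eq_hermite_lvl: "k < real n \<Longrightarrow> hermite k = hermite_lvl n k"
  unfolding hermite_def
  by (rule the_equality) (use hermite_ode_unique hermite_ode_hermite_lvl in blast)+

section \<open>Calculus of Hermite functions of arbitrary real index\<close>

lemma hermite_deriv: "(hermite k has_real_derivative k * hermite (k - 1) x) (at x)"
proof -
  obtain n where "k < real n" using reals_Archimedean2 by blast
  then show ?thesis using hermite_lvl_props(1)[of k n x] by (simp add: hermite_eq_hermite_lvl[of _ n])
qed

lemma hermite_rec: "hermite (k + 1) x = x * hermite k x - k * hermite (k - 1) x"
proof -
  obtain n where "k + 1 < real n" using reals_Archimedean2 by blast
  then show ?thesis using hermite_lvl_props(2)[of k n x] by (simp add: hermite_eq_hermite_lvl[of _ n])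
qed

lemma hermite_asymp: "((\<lambda>x. hermite k x * x powr (- k)) \<longlongrightarrow> 1) at_top"
proof -
  obtain n where "k < real n" using reals_Archimedean2 by blast
  then show ?thesis using hermite_lvl_props(3)[of k n] by (simp add: hermite_eq_hermite_lvl)
qed

lemma hermite_neg_index_pos: "k < 0 \<Longrightarrow> hermite k x > 0"
  using hermite_eq_hermite_lvl[of k 0] hermite_integral_pos[of "- k" x] Gamma_real_pos[of "- k"] by simp

lemma hermite_asymp_mult_gaussian:
  "((\<lambda>x. hermite k x * hermite j x * exp (- (x\<^sup>2 / 2))) \<longlongrightarrow> 0) at_top"
proof -
  have "((\<lambda>x. (hermite k x * x powr (- k)) * (hermite j x * x powr (- j)) * (x powr (k + j) * exp (- (x\<^sup>2 / 2)))) \<longlongrightarrow> 1 * 1 * 0) at_top"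
    by (intro tendsto_mult hermite_asymp) real_asymp
  moreover have "\<forall>\<^sub>F x in at_top. (hermite k x * x powr (- k)) * (hermite j x * x powr (- j)) * (x powr (k + j) * exp (- (x\<^sup>2 / 2)))
     = hermite k x * hermite j x * exp (- (x\<^sup>2 / 2))"
    using eventually_gt_at_top[of 0]
  proof eventually_elim
    case (elim x)
    have p1: "x powr (- k) * x powr (- j) * x powr (k + j) = 1"
      using elim by (simp flip: powr_add)
    have p2: "(hermite k x * x powr (- k)) * (hermite j x * x powr (- j)) * (x powr (k + j) * exp (- (x\<^sup>2 / 2)))
        = hermite k x * hermite j x * exp (- (x\<^sup>2 / 2)) * (x powr (- k) * x powr (- j) * x powr (k + j))"
      by (simp only: mult_ac)
    show ?case unfolding p2 p1 by simp
  qed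
  ultimately show ?thesis by (subst (asm) filterlim_cong[OF refl refl]) auto
qed

lemma hermite_0: "hermite 0 = (\<lambda>_. 1)"
proof -
  have "((\<lambda>x::real. 1 * x powr (- 0)) \<longlongrightarrow> 1) at_top"
    by (rule tendsto_eventually) (use eventually_gt_at_top[of 0] in eventually_elim, simp)
  moreover have "deriv (\<lambda>_::real. 1::real) = (\<lambda>_. 0)" by (simp add: fun_eq_iff)
  ultimately have "hermite_ode 0 (\<lambda>_. 1)"
    unfolding hermite_ode_def asymp_smallo by simp
  moreover have "hermite_ode 0 (hermite_lvl 1 0)" by (rule hermite_ode_hermite_lvl) simp
  ultimately have "hermite_lvl 1 0 = (\<lambda>_. 1)" by (rule hermite_ode_unique)
  then show ?thesis using hermite_eq_hermite_lvl[of 0 1] by simp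
qed

lemma hermite_asymp_gaussian: "((\<lambda>x. hermite k x * exp (- (x\<^sup>2 / 2))) \<longlongrightarrow> 0) at_top"
  using hermite_asymp_mult_gaussian[of k 0] by (simp add: hermite_0)

lemma hermite_eventually_pos: "\<forall>\<^sub>F x in at_top. hermite k x > 0"
proof -
  have "\<forall>\<^sub>F x in at_top. hermite k x * x powr (- k) > 0"
    by (rule order_tendstoD(1)[OF hermite_asymp]) simp
  then show ?thesis
    using eventually_gt_at_top[of 0] by eventually_elim (auto simp: zero_less_mult_iff)
qed

lemma isCont_hermite: "isCont (hermite k) x"
  using hermite_deriv DERIV_isCont by blast

lemma deriv_hermite: "deriv (hermite k) x = k * hermite (k - 1) x"
  by (rule DERIV_imp_deriv[OF hermite_deriv])

lemma pos_if_decreasing_to_0: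
  fixes f f' :: "real \<Rightarrow> real"
  assumes d: "\<And>x. x > a \<Longrightarrow> (f has_real_derivative f' x) (at x)" and neg: "\<And>x. x > a \<Longrightarrow> f' x < 0"
    and lim: "(f \<longlongrightarrow> 0) at_top" and x: "x > a"
  shows "f x > 0"
proof -
  have dec: "f z < f y" if "y < z" "y > a" for y z
    using that by (intro DERIV_neg_imp_decreasing[of y z f]) (meson d neg less_le_trans)+
  have "0 \<le> f (x + 1)"
    by (rule tendsto_upperbound[OF lim])
       (auto intro!: eventually_mono[OF eventually_gt_at_top[of "x + 1"]] less_imp_le[OF dec] simp: x less_imp_le less_trans[OF x])
  also have "\<dots> < f x" using x by (intro dec) auto
  finally show ?thesis .
qed

text \<open>The Hermite equation in divergence form. Where \<open>hermite k\<close> has a sign, it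
  makes the weighted derivative monotone, and this is the source of all sign information
  below.\<close>

lemma hermite_deriv_gaussian:
  "((\<lambda>x. k * hermite (k - 1) x * exp (- (x\<^sup>2 / 2))) has_real_derivative - k * hermite k x * exp (- (x\<^sup>2 / 2))) (at x)"
proof -
  have r: "hermite k x = x * hermite (k - 1) x - (k - 1) * hermite (k - 1 - 1) x"
    using hermite_rec[of "k - 1" x] by simp
  have "((\<lambda>x. k * hermite (k - 1) x * exp (- (x\<^sup>2 / 2))) has_real_derivative
    k * ((k - 1) * hermite (k - 1 - 1) x) * exp (- (x\<^sup>2 / 2)) + exp (- (x\<^sup>2 / 2)) * (- x) * (k * hermite (k - 1) x)) (at x)"
    by (auto intro!: derivative_eq_intros hermite_deriv)
  then show ?thesis
    by (rule DERIV_cong) (unfold r, simp add: algebra_simps)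
qed

text \<open>Without a zero, \<open>hermite k\<close> is positive everywhere, since it is so near
  infinity. Then the weighted derivative decreases to 0 at infinity, hence is positive and, on the
  negative axis, at least its value \<open>c\<close> at 0. As the weight is at most 1, the slope of
  \<open>hermite k\<close> is at least \<open>c\<close> there, and the function is nonpositive at
  distance \<open>hermite k 0 / c\<close> to the left of 0.\<close>

lemma hermite_has_zero:
  assumes k: "k > 0"
  shows "\<exists>x. hermite k x = 0"
proof (rule ccontr)
  assume no: "\<not> ?thesis"
  obtain X where X: "hermite k X > 0"
    using hermite_eventually_pos[of k] eventually_at_top_linorder by fastforce
  have pos: "hermite k x > 0" for x
  proof (rule ccontr)
    assume "\<not> hermite k x > 0"
    then have "hermite k x < 0" using no by (meson linorder_neqE_linordered_idom)
    moreover have "isCont (hermite k) y" for y by (rule isCont_hermite)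
    ultimately show False
      using IVT[of "hermite k" x 0 X] IVT2[of "hermite k" x 0 X] X no
      by (cases "x \<le> X") (auto simp: less_imp_le)
  qed
  let ?v = "\<lambda>x. k * hermite (k - 1) x * exp (- (x\<^sup>2 / 2))"
  have lim: "(?v \<longlongrightarrow> 0) at_top"
    using tendsto_mult[OF tendsto_const[of k] hermite_asymp_gaussian[of "k - 1"]] by (simp add: mult.assoc)
  have vpos: "?v x > 0" for x
    by (rule pos_if_decreasing_to_0[of "x - 1" ?v "\<lambda>x. - k * hermite k x * exp (- (x\<^sup>2 / 2))"])
       (use hermite_deriv_gaussian lim pos k in \<open>auto\<close>)
  define c where "c = ?v 0"
  have c: "c > 0" using vpos[of 0] by (simp add: c_def)
  have ge: "k * hermite (k - 1) x \<ge> c" if "x \<le> 0" for x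
  proof -
    have "?v 0 \<le> ?v x"
      by (rule DERIV_nonpos_imp_nonincreasing[OF that]) (use hermite_deriv_gaussian[of k] pos k in \<open>auto intro!: exI mult_nonneg_nonneg simp: less_imp_le\<close>)
    also have "\<dots> \<le> k * hermite (k - 1) x * 1"
      using vpos[of x] k by (intro mult_left_mono) (auto simp: zero_less_mult_iff)
    finally show ?thesis by (simp add: c_def)
  qed
  define y where "y = - (hermite k 0 / c)"
  have y: "y < 0" using pos[of 0] c by (simp add: y_def)
  obtain z where z: "y < z" "z < 0" "hermite k 0 - hermite k y = (0 - y) * (k * hermite (k - 1) z)"
    using MVT2[of y 0 "hermite k" "\<lambda>x. k * hermite (k - 1) x"] hermite_deriv y by auto
  have "(0 - y) * c \<le> (0 - y) * (k * hermite (k - 1) z)"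
    using ge[of z] z y by (intro mult_left_mono) auto
  then have "hermite k y \<le> 0" using z(3) c by (simp add: y_def)
  then show False using pos[of y] by simp
qed

section \<open>The ray beyond the rightmost zero\<close>

definition hermite_dom :: "real \<Rightarrow> real set" where
  "hermite_dom k = {q. hermite_R k < ereal q}"

lemma hermite_dom_neg: "k \<le> 0 \<Longrightarrow> hermite_dom k = UNIV"
  by (auto simp: hermite_dom_def hermite_R_def)

text \<open>Positivity of \<open>hermite k\<close> beyond its largest zero follows from continuity
  and the behaviour at infinity, that of \<open>hermite (k - 1)\<close> from the weighted derivative
  decreasing to 0. The last clause includes the endpoint \<open>R\<close>: this makes the quotient
  of the two functions blow up there.\<close>

lemma hermite_dom_pos:
  assumes k: "k > 0"
  obtains R where "hermite_dom k = {R<..}" "hermite k R = 0" "\<And>x. x > R \<Longrightarrow> hermite k x > 0"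
    "\<And>x. x \<ge> R \<Longrightarrow> hermite (k - 1) x > 0"
proof -
  let ?Z = "{x. hermite k x = 0}"
  define R where "R = Sup ?Z"
  obtain B where B: "\<And>x. x \<ge> B \<Longrightarrow> hermite k x > 0"
    using hermite_eventually_pos[of k] unfolding eventually_at_top_linorder by auto
  have ne: "?Z \<noteq> {}" using hermite_has_zero[OF k] by auto
  have bdd: "bdd_above ?Z" using B by (intro bdd_aboveI[of _ B]) (metis linorder_linear mem_Collect_eq order_less_irrefl)
  have cont: "continuous_on UNIV (hermite k)"
    using isCont_hermite continuous_at_imp_continuous_on by blast
  have closed: "closed ?Z" using closed_Collect_eq[OF cont continuous_on_const] by simp
  have R0: "hermite k R = 0" using closed_contains_Sup[OF ne bdd closed] by (simp add: R_def)
  have nz: "hermite k x \<noteq> 0" if "x > R" for x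
    using that cSup_upper[of x ?Z, OF _ bdd] by (auto simp: R_def)
  have pos: "hermite k x > 0" if x: "x > R" for x
  proof (rule ccontr)
    assume "\<not> hermite k x > 0"
    then have "hermite k x \<le> 0" by simp
    then have "\<exists>y\<ge>x. y \<le> max x B \<and> hermite k y = 0"
      using B[of "max x B"] by (intro IVT) (auto intro!: isCont_hermite simp del: max.absorb1 max.absorb2)
    then obtain y where "x \<le> y" "hermite k y = 0" by blast
    then show False using nz[of y] x by simp
  qed
  let ?v = "\<lambda>x. k * hermite (k - 1) x * exp (- (x\<^sup>2 / 2))"
  have lim: "(?v \<longlongrightarrow> 0) at_top"
    using tendsto_mult[OF tendsto_const[of k] hermite_asymp_gaussian[of "k - 1"]] by (simp add: mult.assoc)
  have vpos: "?v x > 0" if "x > R" for x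
    by (rule pos_if_decreasing_to_0[of R ?v "\<lambda>x. - k * hermite k x * exp (- (x\<^sup>2 / 2))"])
       (use hermite_deriv_gaussian lim pos k that in auto)
  \<comment> \<open>The decrease argument covers only the open ray; strict decrease on the closed
    interval from \<open>R\<close> to \<open>R + 1\<close> carries positivity to the
    endpoint.\<close>
  have "?v (R + 1) < ?v R" 
  proof (rule DERIV_neg_imp_decreasing_open[of R "R + 1" ?v])
    show "continuous_on {R..R + 1} ?v"
      by (intro continuous_intros continuous_at_imp_continuous_on ballI isCont_hermite) simp
    fix x assume "R < x" "x < R + 1"
    then show "\<exists>y. (?v has_real_derivative y) (at x) \<and> y < 0"
      using hermite_deriv_gaussian[of k x] pos[of x] k by (intro exI conjI) auto
  qed simp
  then have "?v R > 0" using vpos[of "R + 1"] by simp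
  then have pos': "hermite (k - 1) x > 0" if "x \<ge> R" for x
    using vpos[of x] that k by (cases "x = R") (auto simp: zero_less_mult_iff)
  show ?thesis
    by (rule that[of R]) (use k R0 pos pos' in \<open>auto simp: hermite_dom_def hermite_R_def R_def\<close>)
qed

lemma hermite_dom_upclosed: "x \<in> hermite_dom k \<Longrightarrow> x \<le> y \<Longrightarrow> y \<in> hermite_dom k"
  by (auto simp: hermite_dom_def elim: less_le_trans)

lemma open_hermite_dom: "open (hermite_dom k)"
proof (cases "k > 0")
  case True
  then obtain R where "hermite_dom k = {R<..}" using hermite_dom_pos by metis
  then show ?thesis by simp
qed (simp add: hermite_dom_neg)

lemma hermite_dom_nonempty: "hermite_dom k \<noteq> {}"
proof (cases "k > 0")
  case True
  then obtain R where "hermite_dom k = {R<..}" using hermite_dom_pos by metis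
  then show ?thesis using gt_ex by auto
qed (simp add: hermite_dom_neg)

lemma hermite_pos_dom:
  assumes "k \<noteq> 0" "q \<in> hermite_dom k"
  shows "hermite k q > 0" "hermite (k - 1) q > 0"
proof -
  have "hermite k q > 0 \<and> hermite (k - 1) q > 0"
  proof (cases "k > 0")
    case True
    then show ?thesis using hermite_dom_pos[OF True] assms(2) by (metis greaterThan_iff less_imp_le)
  next
    case False
    then show ?thesis using assms(1) hermite_neg_index_pos[of k q] hermite_neg_index_pos[of "k - 1" q] by auto
  qed
  then show "hermite k q > 0" "hermite (k - 1) q > 0" by auto
qed

text \<open>Turan-type determinant; its positivity makes the logarithmic derivative strictly monotone.\<close>
definition hermite_turan :: "real \<Rightarrow> real \<Rightarrow> real" where
  "hermite_turan k x = (hermite k x)\<^sup>2 - hermite (k - 1) x * hermite (k + 1) x"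

text \<open>With Gaussian weight the determinant has the derivative \<open>- (hermite k x * hermite
  (k - 1) x) * exp (- (x\<^sup>2 / 2))\<close>, which is negative on the domain, and it tends to 0
  at infinity.\<close>

lemma hermite_turan_pos:
  assumes k: "k \<noteq> 0" and q: "q \<in> hermite_dom k"
  shows "hermite_turan k q > 0"
proof -
  let ?g = "\<lambda>x. hermite_turan k x * exp (- (x\<^sup>2 / 2))"
  let ?g' = "\<lambda>x. - (hermite k x * hermite (k - 1) x) * exp (- (x\<^sup>2 / 2))"
  have d: "(?g has_real_derivative ?g' x) (at x)" for x
  proof -
    have r1: "hermite (k + 1) x = x * hermite k x - k * hermite (k - 1) x"
      by (rule hermite_rec)
    have r2: "(k - 1) * hermite (k - 1 - 1) x = x * hermite (k - 1) x - hermite k x"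
      using hermite_rec[of "k - 1" x] by simp
    have "(?g has_real_derivative
       (2 * hermite k x * (k * hermite (k - 1) x) - (((k - 1) * hermite (k - 1 - 1) x) * hermite (k + 1) x
         + ((k + 1) * hermite (k + 1 - 1) x) * hermite (k - 1) x)) * exp (- (x\<^sup>2 / 2))
       + (exp (- (x\<^sup>2 / 2)) * (- x)) * hermite_turan k x) (at x)"
      unfolding hermite_turan_def[abs_def]
      by (auto intro!: derivative_eq_intros hermite_deriv simp: algebra_simps)
    then show ?thesis
      by (rule DERIV_cong) (unfold r2 hermite_turan_def r1, simp add: algebra_simps power2_eq_square)
  qed
  have "((\<lambda>x. hermite k x * hermite k x * exp (- (x\<^sup>2 / 2)) - hermite (k - 1) x * hermite (k + 1) x * exp (- (x\<^sup>2 / 2))) \<longlongrightarrow> 0 - 0) at_top"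
    by (intro tendsto_diff hermite_asymp_mult_gaussian)
  then have lim: "(?g \<longlongrightarrow> 0) at_top"
    by (simp add: hermite_turan_def power2_eq_square left_diff_distrib)
  \<comment> \<open>The decrease has to hold on an open ray containing \<open>q\<close>; the domain
    is open, so there is room to the left.\<close>
  obtain a where a: "a < q" "a \<in> hermite_dom k"
  proof -
    obtain e where "e > 0" "ball q e \<subseteq> hermite_dom k"
      using open_hermite_dom[of k] q openE by blast
    then show ?thesis by (intro that[of "q - e / 2"]) (auto simp: dist_real_def)
  qed
  have "?g q > 0"
  proof (rule pos_if_decreasing_to_0[OF d _ lim a(1)])
    fix x assume "a < x"
    then have "x \<in> hermite_dom k" using a(2) hermite_dom_upclosed less_imp_le by blast
    then show "?g' x < 0"
      using hermite_pos_dom[OF k] hermite_pos_dom(2)[OF k] by simp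
  qed
  then show ?thesis by (simp add: zero_less_mult_iff)
qed

section \<open>The logarithmic derivative as a bijection onto the positive reals\<close>

definition hermite_T :: "real \<Rightarrow> real \<Rightarrow> real" where
  "hermite_T k q = \<bar>k\<bar> * hermite (k - 1) q / hermite k q"

lemma hermite_T_eq:
  assumes "k \<noteq> 0" "q \<in> hermite_dom k"
  shows "\<bar>deriv (hermite k) q / hermite k q\<bar> = hermite_T k q"
  using hermite_pos_dom[OF assms] hermite_pos_dom(2)[OF assms]
  by (simp add: deriv_hermite hermite_T_def abs_mult)

lemma hermite_T_pos:
  assumes "k \<noteq> 0" "q \<in> hermite_dom k"
  shows "hermite_T k q > 0"
  using hermite_pos_dom[OF assms] hermite_pos_dom(2)[OF assms] assms(1) by (simp add: hermite_T_def)

lemma hermite_T_deriv: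
  assumes k: "k \<noteq> 0" and q: "q \<in> hermite_dom k"
  shows "(hermite_T k has_real_derivative - \<bar>k\<bar> * hermite_turan k q / (hermite k q)\<^sup>2) (at q)"
proof -
  have r1: "hermite (k + 1) q = q * hermite k q - k * hermite (k - 1) q"
    by (rule hermite_rec)
  have r2: "(k - 1) * hermite (k - 1 - 1) q = q * hermite (k - 1) q - hermite k q"
    using hermite_rec[of "k - 1" q] by simp
  have "(hermite_T k has_real_derivative
    ((\<bar>k\<bar> * ((k - 1) * hermite (k - 1 - 1) q)) * hermite k q - (\<bar>k\<bar> * hermite (k - 1) q) * (k * hermite (k - 1) q)) / (hermite k q * hermite k q)) (at q)"
    unfolding hermite_T_def[abs_def]
    using hermite_pos_dom[OF k q] by (intro DERIV_divide DERIV_cmult hermite_deriv) auto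
  moreover have "(\<bar>k\<bar> * ((k - 1) * hermite (k - 1 - 1) q)) * hermite k q - (\<bar>k\<bar> * hermite (k - 1) q) * (k * hermite (k - 1) q)
     = - \<bar>k\<bar> * hermite_turan k q"
    unfolding r2 hermite_turan_def r1 by (simp add: algebra_simps power2_eq_square)
  ultimately show ?thesis by (simp add: power2_eq_square)
qed

lemma hermite_T_strict_antimono:
  assumes k: "k \<noteq> 0" and q: "q \<in> hermite_dom k" "q < r"
  shows "hermite_T k r < hermite_T k q"
proof (rule DERIV_neg_imp_decreasing[OF q(2)])
  fix x assume "q \<le> x" "x \<le> r"
  then have x: "x \<in> hermite_dom k" using q(1) hermite_dom_upclosed by blast
  show "\<exists>y. (hermite_T k has_real_derivative y) (at x) \<and> y < 0"
  proof (intro exI conjI)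
    show "- \<bar>k\<bar> * hermite_turan k x / (hermite k x)\<^sup>2 < 0"
      using hermite_turan_pos[OF k x] hermite_pos_dom[OF k x] k by (intro divide_neg_pos) auto
  qed (rule hermite_T_deriv[OF k x])
qed

lemma hermite_T_at_top:
  assumes k: "k \<noteq> 0"
  shows "(hermite_T k \<longlongrightarrow> 0) at_top"
proof -
  have "((\<lambda>x. \<bar>k\<bar> * (hermite (k - 1) x * x powr (- (k - 1))) / (hermite k x * x powr (- k)) * (1 / x)) \<longlongrightarrow> \<bar>k\<bar> * 1 / 1 * 0) at_top"
    by (intro tendsto_mult tendsto_divide tendsto_const hermite_asymp) (simp, real_asymp)
  moreover have "\<forall>\<^sub>F x in at_top. \<bar>k\<bar> * (hermite (k - 1) x * x powr (- (k - 1))) / (hermite k x * x powr (- k)) * (1 / x) = hermite_T k x"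
    using eventually_gt_at_top[of 0]
  proof eventually_elim
    case (elim x)
    have "x powr (- (k - 1)) = x powr (- k) * x"
      using elim powr_add[of x "- k" 1] by simp
    then show ?case using elim by (simp add: hermite_T_def field_simps)
  qed
  ultimately show ?thesis using filterlim_cong[OF refl refl] by fastforce
qed

text \<open>For \<open>k > 0\<close> the denominator vanishes at the left end of the domain. For
  \<open>k < 0\<close> the domain is the whole line and the Riccati equation
  \<open>T' = T\<^sup>2 + q * T + k\<close> decides: if \<open>T\<close> were bounded above, then,
  being at least \<open>T 0 > 0\<close> on the negative axis, it would have slope at most -1 far to
  the left.\<close>

lemma hermite_T_unbounded:
  assumes k: "k \<noteq> 0"
  shows "\<exists>q\<in>hermite_dom k. hermite_T k q > t"
proof (cases "k > 0")
  case True
  obtain R where R: "hermite_dom k = {R<..}" "hermite k R = 0" "\<And>x. x > R \<Longrightarrow> hermite k x > 0"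
    "\<And>x. x \<ge> R \<Longrightarrow> hermite (k - 1) x > 0"
    using hermite_dom_pos[OF True] by blast
  have lim: "(hermite j \<longlongrightarrow> hermite j R) (at_right R)" for j
    using isCont_hermite[of R j] unfolding isCont_def by (rule tendsto_within_subset) simp
  have l1: "((\<lambda>x. \<bar>k\<bar> * hermite (k - 1) x) \<longlongrightarrow> \<bar>k\<bar> * hermite (k - 1) R) (at_right R)"
    by (intro tendsto_mult tendsto_const lim)
  have l2: "(hermite k \<longlongrightarrow> 0) (at_right R)"
    using lim[of k] R(2) by simp
  have "\<forall>\<^sub>F x in at_right R. hermite k x > 0"
    using eventually_at_right_less[of R] by eventually_elim (rule R(3))
  then have "filterlim (\<lambda>x. inverse (hermite k x)) at_top (at_right R)"
    by (intro filterlim_inverse_at_top l2)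
  then have "filterlim (\<lambda>x. (\<bar>k\<bar> * hermite (k - 1) x) * inverse (hermite k x)) at_top (at_right R)"
    using True R(4)[of R] by (intro filterlim_tendsto_pos_mult_at_top[OF l1]) auto
  then have "filterlim (hermite_T k) at_top (at_right R)"
    by (simp add: hermite_T_def[abs_def] divide_inverse)
  then have "\<forall>\<^sub>F x in at_right R. hermite_T k x > t"
    by (simp add: filterlim_at_top_dense)
  then have "\<forall>\<^sub>F x in at_right R. hermite_T k x > t \<and> x > R"
    using eventually_at_right_less[of R] by eventually_elim simp
  then have "\<exists>x. hermite_T k x > t \<and> x > R"
    by (rule eventually_happens'[rotated]) simp
  then show ?thesis using R(1) by auto
next
  case False
  then have k0: "k < 0" using k by simp
  have U: "hermite_dom k = UNIV" using k0 by (simp add: hermite_dom_neg)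
  show ?thesis
  proof (rule ccontr)
    assume "\<not> ?thesis"
    then have le: "hermite_T k q \<le> t" for q using U by (auto simp: not_less)
    define m where "m = hermite_T k 0"
    have m: "m > 0" unfolding m_def using U by (intro hermite_T_pos[OF k]) auto
    have ric: "(hermite_T k has_real_derivative (hermite_T k q)\<^sup>2 + q * hermite_T k q + k) (at q)" for q
    proof -
      have p: "hermite k q > 0" using U by (intro hermite_pos_dom[OF k]) auto
      have r1: "hermite (k + 1) q = q * hermite k q - k * hermite (k - 1) q" by (rule hermite_rec)
      show ?thesis
      proof (rule DERIV_cong[OF hermite_T_deriv[OF k]])
        show "- \<bar>k\<bar> * hermite_turan k q / (hermite k q)\<^sup>2 = (hermite_T k q)\<^sup>2 + q * hermite_T k q + k"
          using p k0 unfolding hermite_turan_def hermite_T_def r1 by (simp add: field_simps power2_eq_square)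
      qed (simp add: U)
    qed
    \<comment> \<open>Left of \<open>x1\<close> the term \<open>z * hermite_T k z\<close> is at most
      \<open>- (t\<^sup>2 + \<bar>k\<bar> + 1)\<close>, which outweighs the other two terms of the
      Riccati equation; the length \<open>d\<close> then lifts the value above
      \<open>t\<close>.\<close>
    define x1 where "x1 = - ((t\<^sup>2 + \<bar>k\<bar> + 1) / m)"
    have x1: "x1 < 0" using m by (simp add: x1_def add_nonneg_pos)
    define d where "d = t + 1 + \<bar>t\<bar>"
    have "d > 0" by (simp add: d_def)
    obtain z where z: "x1 - d < z" "z < x1" and
      e: "hermite_T k x1 - hermite_T k (x1 - d) = (x1 - (x1 - d)) * ((hermite_T k z)\<^sup>2 + z * hermite_T k z + k)"
      using MVT2[of "x1 - d" x1 "hermite_T k" "\<lambda>q. (hermite_T k q)\<^sup>2 + q * hermite_T k q + k"] ric \<open>d > 0\<close> by auto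
    have Tz: "hermite_T k z \<ge> m" 
      unfolding m_def using hermite_T_strict_antimono[OF k, of z 0] U z x1 by simp
    have "(hermite_T k z)\<^sup>2 \<le> t\<^sup>2" using le[of z] Tz m by (intro power_mono) auto
    moreover have "z * hermite_T k z \<le> x1 * m"
      using mult_mono[of "- x1" "- z" m "hermite_T k z"] z x1 Tz m by simp
    moreover have "x1 * m = - (t\<^sup>2 + \<bar>k\<bar> + 1)" using m by (simp add: x1_def)
    ultimately have "(hermite_T k z)\<^sup>2 + z * hermite_T k z + k \<le> - 1" by linarith
    then have "d * ((hermite_T k z)\<^sup>2 + z * hermite_T k z + k) \<le> d * (- 1)"
      using \<open>d > 0\<close> by (intro mult_left_mono) auto
    then have "hermite_T k (x1 - d) \<ge> hermite_T k x1 + d" using e by simp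
    moreover have "hermite_T k x1 > 0" using U by (intro hermite_T_pos[OF k]) auto
    ultimately show False using le[of "x1 - d"] by (simp add: d_def)
  qed
qed

lemma hermite_T_surj:
  assumes k: "k \<noteq> 0" and t: "t > 0"
  shows "\<exists>q\<in>hermite_dom k. hermite_T k q = t"
proof -
  obtain a where a: "a \<in> hermite_dom k" "hermite_T k a > t" using hermite_T_unbounded[OF k] by blast
  have "\<forall>\<^sub>F x in at_top. hermite_T k x < t" using order_tendstoD(2)[OF hermite_T_at_top[OF k] t] .
  then obtain b where b: "b \<ge> a" "hermite_T k b < t"
    unfolding eventually_at_top_linorder by (metis linorder_linear)
  have "\<exists>x\<ge>a. x \<le> b \<and> hermite_T k x = t"
    using a b by (intro IVT2) (auto intro!: DERIV_isCont[OF hermite_T_deriv[OF k]] hermite_dom_upclosed[OF a(1)])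
  then show ?thesis using hermite_dom_upclosed[OF a(1)] by blast
qed

lemma hermite_F_T:
  assumes k: "k \<noteq> 0" and q: "q \<in> hermite_dom k"
  shows "hermite_F k (hermite_T k q) = hermite (k + 1) q / hermite k q powr (1 + 1 / k)"
proof -
  have "(THE q'. hermite_R k < ereal q' \<and> \<bar>deriv (hermite k) q' / hermite k q'\<bar> = hermite_T k q) = q"
  proof (rule the_equality)
    show "hermite_R k < ereal q \<and> \<bar>deriv (hermite k) q / hermite k q\<bar> = hermite_T k q"
      using q hermite_T_eq[OF k q] by (simp add: hermite_dom_def)
    fix r assume "hermite_R k < ereal r \<and> \<bar>deriv (hermite k) r / hermite k r\<bar> = hermite_T k q"
    then have "r \<in> hermite_dom k" "hermite_T k r = hermite_T k q"
      using hermite_T_eq[OF k, of r] by (auto simp: hermite_dom_def)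
    then show "r = q"
      using hermite_T_strict_antimono[OF k, of r q] hermite_T_strict_antimono[OF k, of q r] q
      by (metis less_irrefl linorder_neqE_linordered_idom)
  qed
  then show ?thesis
    using hermite_T_pos[OF k q] by (simp add: hermite_F_def Let_def)
qed

lemma hermite_F_0: "hermite_F k 0 = 1"
  by (simp add: hermite_F_def)

subsection \<open>The function F and its concave dual\<close>

locale hermite_index =
  fixes k :: real
  assumes k0: "k \<noteq> 0" and k1: "k \<noteq> - 1"
begin

definition p :: real where "p = 1 + 1 / k"
text \<open>\<open>kap\<close> is \<open>1\<close> for \<open>p \<notin> [0,1]\<close> and \<open>-1\<close> for \<open>0 < p < 1\<close>; after multiplication with it both inequalities
  have the same direction.\<close>
definition kap :: real where "kap = sgn k * sgn p"
definition Theta :: "real \<Rightarrow> real" where "Theta t = kap * hermite_F k t"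
definition Theta_curve :: "real \<Rightarrow> real" where "Theta_curve q = kap * hermite (k + 1) q * hermite k q powr (- p)"
text \<open>The value of \<open>c\<close> for which \<open>c powr k * hermite k q = 1\<close>, that
  is, the slope parameter of the touching point with first coordinate 1.\<close>

definition hscale :: "real \<Rightarrow> real" where "hscale q = hermite k q powr (- 1 / k)"

abbreviation "Hdom \<equiv> hermite_dom k"

lemma pk: "p * k = k + 1"
  using k0 by (simp add: p_def field_simps)

lemma p0: "p \<noteq> 0"
  using k0 k1 by (auto simp: p_def field_simps add_eq_0_iff)

lemma kap_p: "kap * p = sgn k * \<bar>p\<bar>"
  unfolding kap_def by (simp add: abs_sgn mult_ac)

lemma kap_pk: "kap * (k + 1) = \<bar>p\<bar> * \<bar>k\<bar>"
  unfolding pk[symmetric] mult.assoc[symmetric] kap_p by (simp add: abs_sgn mult_ac)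

lemma kap_cases: "kap = 1 \<or> kap = - 1"
  using k0 p0 by (auto simp: kap_def sgn_if)

lemma H_pos: "q \<in> Hdom \<Longrightarrow> hermite k q > 0" "q \<in> Hdom \<Longrightarrow> hermite (k - 1) q > 0"
  using hermite_pos_dom k0 by auto

lemma Theta_T:
  assumes "q \<in> Hdom"
  shows "Theta (hermite_T k q) = Theta_curve q"
  unfolding Theta_def Theta_curve_def hermite_F_T[OF k0 assms] p_def
  using H_pos(1)[OF assms] powr_minus_divide[of "hermite k q" "1 + 1 / k"] by simp

lemma Theta_0: "Theta 0 = kap"
  by (simp add: Theta_def hermite_F_0)

lemma hscale_pos: "q \<in> Hdom \<Longrightarrow> hscale q > 0"
  using H_pos[of q] by (simp add: hscale_def)

lemma hscale_deriv:
  assumes q: "q \<in> Hdom"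
  shows "(hscale has_real_derivative - hermite (k - 1) q * hermite k q powr (- 1 / k - 1)) (at q)"
  unfolding hscale_def[abs_def] using H_pos[OF q] k0
  by (auto intro!: derivative_eq_intros hermite_deriv)

lemma hscale_antimono:
  assumes q: "q \<in> Hdom" "q < r"
  shows "hscale r < hscale q"
proof (rule DERIV_neg_imp_decreasing[OF q(2)])
  fix x assume "q \<le> x" "x \<le> r"
  then have x: "x \<in> Hdom" using q(1) hermite_dom_upclosed by blast
  show "\<exists>y. (hscale has_real_derivative y) (at x) \<and> y < 0"
    by (intro exI conjI, rule hscale_deriv[OF x]) (use H_pos[OF x] in simp)
qed

lemma hscale_le_iff: "q \<in> Hdom \<Longrightarrow> r \<in> Hdom \<Longrightarrow> hscale q \<le> hscale r \<longleftrightarrow> r \<le> q"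
  using hscale_antimono[of q r] hscale_antimono[of r q] by (cases q r rule: linorder_cases) auto

text \<open>Since \<open>p * k = k + 1\<close>, both terms of the product rule carry the same
  coefficient and combine to the Turan determinant; \<open>kap\<close> makes this coefficient
  positive.\<close>

lemma Theta_curve_deriv:
  assumes q: "q \<in> Hdom"
  shows "(Theta_curve has_real_derivative \<bar>p\<bar> * \<bar>k\<bar> * hermite_turan k q * (hermite k q powr (- p - 1))) (at q)"
proof -
  have p: "hermite k q > 0" using H_pos[OF q] by simp
  have e: "hermite k q powr (- p) = hermite k q powr (- p - 1) * hermite k q"
    using p powr_add[of "hermite k q" "- p - 1" 1] by simp
  have "(Theta_curve has_real_derivative
     (kap * ((k + 1) * hermite (k + 1 - 1) q)) * hermite k q powr (- p)
      + (hermite k q powr (- p - 1) * (- p) * (k * hermite (k - 1) q)) * (kap * hermite (k + 1) q)) (at q)"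
    unfolding Theta_curve_def[abs_def] using p
    by (auto intro!: derivative_eq_intros hermite_deriv)
  then show ?thesis
  proof (rule DERIV_cong)
    have "(kap * ((k + 1) * hermite (k + 1 - 1) q)) * hermite k q powr (- p)
      + (hermite k q powr (- p - 1) * (- p) * (k * hermite (k - 1) q)) * (kap * hermite (k + 1) q)
      = (kap * (k + 1)) * hermite k q powr (- p - 1) * (hermite k q)\<^sup>2
      - (kap * (p * k)) * hermite k q powr (- p - 1) * (hermite (k - 1) q * hermite (k + 1) q)"
      unfolding e by (simp add: power2_eq_square algebra_simps)
    also have "\<dots> = (kap * (k + 1)) * hermite_turan k q * (hermite k q powr (- p - 1))"
      unfolding pk hermite_turan_def by (simp add: algebra_simps)
    finally show "(kap * ((k + 1) * hermite (k + 1 - 1) q)) * hermite k q powr (- p)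
      + (hermite k q powr (- p - 1) * (- p) * (k * hermite (k - 1) q)) * (kap * hermite (k + 1) q)
      = \<bar>p\<bar> * \<bar>k\<bar> * hermite_turan k q * (hermite k q powr (- p - 1))"
      unfolding kap_pk .
  qed
qed

text \<open>Along the curve \<open>q \<mapsto> (T q, \<Theta> q)\<close> one has \<open>d\<Theta> = - \<bar>p\<bar> s dT\<close> with both \<open>s\<close> and \<open>T\<close> decreasing
  in \<open>q\<close>, so the curve lies below its tangents.\<close>
lemma Theta_curve_tangent:
  assumes q: "q \<in> Hdom" and r: "r \<in> Hdom"
  shows "Theta_curve r \<le> Theta_curve q - \<bar>p\<bar> * hscale q * (hermite_T k r - hermite_T k q)"
proof -
  let ?f = "\<lambda>r. Theta_curve r + \<bar>p\<bar> * hscale q * hermite_T k r"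
  let ?d = "\<lambda>x. \<bar>p\<bar> * \<bar>k\<bar> * hermite_turan k x / (hermite k x)\<^sup>2 * (hscale x - hscale q)"
  have d: "(?f has_real_derivative ?d x) (at x)" if x: "x \<in> Hdom" for x
  proof -
    \<comment> \<open>The derivatives of \<open>Theta_curve\<close> and \<open>hermite_T\<close>
      differ by exactly this power of \<open>hermite k x\<close>, so the slope of the curve at
      \<open>x\<close> is \<open>- \<bar>p\<bar> * hscale x\<close>.\<close>
    have "hermite k x powr (- p - 1 + 2) = hermite k x powr (- p - 1) * (hermite k x)\<^sup>2"
      using H_pos[OF x] unfolding powr_add by simp
    moreover have "- p - 1 + 2 = - 1 / k" by (simp add: p_def)
    ultimately have e: "hermite k x powr (- p - 1) = hscale x / (hermite k x)\<^sup>2"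
      using H_pos[OF x] by (simp add: hscale_def)
    have "(?f has_real_derivative \<bar>p\<bar> * \<bar>k\<bar> * hermite_turan k x * (hermite k x powr (- p - 1))
       + \<bar>p\<bar> * hscale q * (- \<bar>k\<bar> * hermite_turan k x / (hermite k x)\<^sup>2)) (at x)"
      by (intro DERIV_add DERIV_cmult Theta_curve_deriv x hermite_T_deriv k0)
    then show ?thesis
      by (rule DERIV_cong) (simp add: e algebra_simps diff_divide_distrib)
  qed
  have pos: "\<bar>p\<bar> * \<bar>k\<bar> * hermite_turan k x / (hermite k x)\<^sup>2 \<ge> 0" if "x \<in> Hdom" for x
    using hermite_turan_pos[OF k0 that] by simp
  have "?f r \<le> ?f q"
  proof (cases "q \<le> r")
    case True
    show ?thesis
    proof (rule DERIV_nonpos_imp_nonincreasing[OF True])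
      fix x assume x: "q \<le> x" "x \<le> r"
      then have xd: "x \<in> Hdom" using q hermite_dom_upclosed by blast
      have "?d x \<le> 0"
        using pos[OF xd] hscale_le_iff[OF xd q] x by (intro mult_nonneg_nonpos) auto
      then show "\<exists>y. (?f has_real_derivative y) (at x) \<and> y \<le> 0" using d[OF xd] by blast
    qed
  next
    case False
    then have le: "r \<le> q" by simp
    show ?thesis
    proof (rule DERIV_nonneg_imp_nondecreasing[OF le])
      fix x assume x: "r \<le> x" "x \<le> q"
      then have xd: "x \<in> Hdom" using r hermite_dom_upclosed by blast
      have "?d x \<ge> 0"
        using pos[OF xd] hscale_le_iff[OF q xd] x by (intro mult_nonneg_nonneg) auto
      then show "\<exists>y. (?f has_real_derivative y) (at x) \<and> y \<ge> 0" using d[OF xd] by blast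
    qed
  qed
  then show ?thesis by (simp add: algebra_simps)
qed

lemma powr_ratio_at_top: "((\<lambda>q. (hermite j q * q powr (- j)) powr c) \<longlongrightarrow> 1) at_top"
  using tendsto_powr[OF hermite_asymp tendsto_const, of j c] by simp

lemma hermite_powr_ratio:
  "\<forall>\<^sub>F q in at_top. hermite j q powr c = (hermite j q * q powr (- j)) powr c * q powr (j * c)"
  using eventually_gt_at_top[of 0] hermite_eventually_pos[of j]
proof eventually_elim
  case (elim q)
  then show ?case by (simp add: powr_mult powr_powr mult.assoc flip: powr_add)
qed

lemma hscale_at_top: "(hscale \<longlongrightarrow> 0) at_top"
proof -
  have "((\<lambda>q. (hermite k q * q powr (- k)) powr (- 1 / k) * q powr (k * (- 1 / k))) \<longlongrightarrow> 1 * 0) at_top"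
  proof (rule tendsto_mult[OF powr_ratio_at_top])
    have "((\<lambda>q::real. q powr (- 1)) \<longlongrightarrow> 0) at_top" by real_asymp
    then show "((\<lambda>q::real. q powr (k * (- 1 / k))) \<longlongrightarrow> 0) at_top" using k0 by simp
  qed
  moreover have "\<forall>\<^sub>F q in at_top. (hermite k q * q powr (- k)) powr (- 1 / k) * q powr (k * (- 1 / k)) = hscale q"
    using hermite_powr_ratio[of k "- 1 / k"] by eventually_elim (simp add: hscale_def)
  ultimately show ?thesis by (subst (asm) filterlim_cong[OF refl refl]) auto
qed

lemma Theta_curve_at_top: "(Theta_curve \<longlongrightarrow> kap) at_top"
proof -
  have "((\<lambda>q. kap * (hermite (k + 1) q * q powr (- (k + 1))) * (hermite k q * q powr (- k)) powr (- p)) \<longlongrightarrow> kap * 1 * 1) at_top"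
    by (intro tendsto_mult tendsto_const hermite_asymp powr_ratio_at_top)
  moreover have "\<forall>\<^sub>F q in at_top. kap * (hermite (k + 1) q * q powr (- (k + 1))) * (hermite k q * q powr (- k)) powr (- p) = Theta_curve q"
    using hermite_powr_ratio[of k "- p"]
  proof eventually_elim
    case (elim q)
    have "k * - p = - (k + 1)" using pk by (simp add: algebra_simps)
    then show ?case unfolding Theta_curve_def elim by (simp only: mult_ac)
  qed
  ultimately show ?thesis by (subst (asm) filterlim_cong[OF refl refl]) auto
qed

lemma eventually_dom: "\<forall>\<^sub>F q in at_top. q \<in> Hdom"
proof -
  obtain a where "a \<in> Hdom" using hermite_dom_nonempty by blast
  then show ?thesis
    by (intro eventually_mono[OF eventually_ge_at_top[of a]]) (rule hermite_dom_upclosed)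
qed

text \<open>The tangent inequality with the point of tangency moved to infinity, where
  \<open>hscale\<close> and \<open>hermite_T\<close> vanish and the curve tends to
  \<open>kap\<close>.\<close>

lemma Theta_curve_le_kap: "r \<in> Hdom \<Longrightarrow> Theta_curve r \<le> kap"
proof -
  assume r: "r \<in> Hdom"
  have "((\<lambda>q. Theta_curve q - \<bar>p\<bar> * hscale q * (hermite_T k r - hermite_T k q)) \<longlongrightarrow> kap - \<bar>p\<bar> * 0 * (hermite_T k r - 0)) at_top"
    by (intro tendsto_intros Theta_curve_at_top hscale_at_top hermite_T_at_top k0)
  then show ?thesis
    using tendsto_lowerbound[of _ "kap - \<bar>p\<bar> * 0 * (hermite_T k r - 0)" at_top "Theta_curve r"]
      eventually_mono[OF eventually_dom Theta_curve_tangent[OF _ r]] by fastforce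
qed

text \<open>Here the other point is moved to infinity. The result is the tangent inequality at the
  argument \<open>t = 0\<close>, which no parameter \<open>q\<close> reaches.\<close>

lemma kap_le_tangent: "q \<in> Hdom \<Longrightarrow> kap \<le> Theta_curve q + \<bar>p\<bar> * hscale q * hermite_T k q"
proof -
  assume q: "q \<in> Hdom"
  have "((\<lambda>r. Theta_curve r + \<bar>p\<bar> * hscale q * hermite_T k r) \<longlongrightarrow> kap + \<bar>p\<bar> * hscale q * 0) at_top"
    by (intro tendsto_intros Theta_curve_at_top hermite_T_at_top k0)
  moreover have "\<forall>\<^sub>F r in at_top. Theta_curve r + \<bar>p\<bar> * hscale q * hermite_T k r \<le> Theta_curve q + \<bar>p\<bar> * hscale q * hermite_T k q"
    using eventually_dom
  proof eventually_elim
    case (elim r)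
    then show ?case using Theta_curve_tangent[OF q elim] by (simp add: algebra_simps)
  qed
  ultimately show ?thesis
    using tendsto_upperbound[of _ "kap + \<bar>p\<bar> * hscale q * 0" at_top] by fastforce
qed

lemma T_surj: "t > 0 \<Longrightarrow> \<exists>q\<in>Hdom. hermite_T k q = t"
  using hermite_T_surj[OF k0] by auto

lemma Theta_le_kap: "t \<ge> 0 \<Longrightarrow> Theta t \<le> kap"
  using T_surj[of t] Theta_T Theta_curve_le_kap Theta_0 by (cases "t = 0") force+

lemma Theta_tangent:
  assumes q: "q \<in> Hdom" and t: "t \<ge> 0"
  shows "Theta t \<le> Theta_curve q - \<bar>p\<bar> * hscale q * (t - hermite_T k q)"
proof (cases "t = 0")
  case True
  then show ?thesis using kap_le_tangent[OF q] by (simp add: Theta_0)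
next
  case False
  then obtain r where "r \<in> Hdom" "hermite_T k r = t" using T_surj[of t] t by auto
  then show ?thesis using Theta_T[of r] Theta_curve_tangent[OF q, of r] by simp
qed

lemma Theta_antimono:
  assumes "0 \<le> t" "t \<le> u"
  shows "Theta u \<le> Theta t"
proof (cases "t = 0")
  case True
  then show ?thesis using Theta_le_kap[of u] assms by (simp add: Theta_0)
next
  case False
  then obtain q where q: "q \<in> Hdom" "hermite_T k q = t" using T_surj[of t] assms by auto
  have "0 \<le> \<bar>p\<bar> * hscale q * (u - t)" using hscale_pos[OF q(1)] assms by simp
  then show ?thesis using Theta_tangent[OF q(1), of u] q Theta_T[OF q(1)] assms by simp
qed

end

lemma taylor_cubic_upper:
  fixes f :: "real \<Rightarrow> real"
  assumes "\<And>t. t \<in> {a..b} \<Longrightarrow> (f has_real_derivative f1 t) (at t)"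
    "\<And>t. t \<in> {a..b} \<Longrightarrow> (f1 has_real_derivative f2 t) (at t)"
    "\<And>t. t \<in> {a..b} \<Longrightarrow> (f2 has_real_derivative f3 t) (at t)"
    and C: "\<And>t. t \<in> {a..b} \<Longrightarrow> \<bar>f3 t\<bar> \<le> C"
    and xy: "x \<in> {a..b}" "y \<in> {a..b}"
  shows "f y \<le> f x + f1 x * (y - x) + f2 x / 2 * (y - x)\<^sup>2 + C * \<bar>y - x\<bar> ^ 3"
proof (cases "x = y")
  case False
  define diff where "diff m = (if m = 0 then f else if m = 1 then f1 else if m = 2 then f2 else f3)" for m :: nat
  have "\<exists>t. (if y < x then y < t \<and> t < x else x < t \<and> t < y) \<and>
      f y = (\<Sum>m<3. diff m x / fact m * (y - x) ^ m) + diff 3 t / fact 3 * (y - x) ^ 3"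
    using False xy assms by (intro Taylor[of 3 diff f a b x y]) (auto simp: diff_def)
  then obtain t where t: "if y < x then y < t \<and> t < x else x < t \<and> t < y"
    and e: "f y = (\<Sum>m<3. diff m x / fact m * (y - x) ^ m) + diff 3 t / fact 3 * (y - x) ^ 3" by blast
  have "t \<in> {a..b}" using t xy by (auto split: if_splits)
  have "f3 t / 6 * (y - x) ^ 3 \<le> \<bar>f3 t / 6 * (y - x) ^ 3\<bar>" by simp
  also have "\<dots> = \<bar>f3 t\<bar> / 6 * \<bar>y - x\<bar> ^ 3" by (simp add: abs_mult power_abs)
  also have "\<dots> \<le> C * \<bar>y - x\<bar> ^ 3"
    using C[OF \<open>t \<in> {a..b}\<close>] by (intro mult_right_mono) auto
  finally have "f3 t / 6 * (y - x) ^ 3 \<le> C * \<bar>y - x\<bar> ^ 3" .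
  moreover have "f y = f x + f1 x * (y - x) + f2 x / 2 * (y - x)\<^sup>2 + f3 t / 6 * (y - x) ^ 3"
    unfolding e by (simp add: diff_def numeral_3_eq_3 eval_nat_numeral)
  ultimately show ?thesis by simp
qed simp

context hermite_index
begin

section \<open>Inverse functions and the partial Legendre transform\<close>

lemma H_eq_sc: "q \<in> Hdom \<Longrightarrow> hermite k q = hscale q powr (- k)"
  using H_pos(1)[of q] k0 by (simp add: hscale_def powr_powr)

lemma isCont_sc: "q \<in> Hdom \<Longrightarrow> isCont hscale q"
  by (rule DERIV_isCont[OF hscale_deriv])

text \<open>For \<open>k > 0\<close> the function \<open>hermite k\<close> tends to 0 at the left
  end of the domain. For \<open>k < 0\<close> its derivative is at most \<open>- m\<close> on the
  negative axis, so it grows at least linearly to the left. In both cases \<open>d\<close> is the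
  value of \<open>hermite k\<close> at which \<open>hscale\<close> equals
  \<open>1 + \<bar>c\<bar>\<close>.\<close>

lemma hscale_unbounded: "\<exists>q\<in>Hdom. hscale q > c"
proof (cases "k > 0")
  case True
  obtain R where R: "Hdom = {R<..}" "hermite k R = 0"
    by (rule hermite_dom_pos[OF True])
  have "(hermite k \<longlongrightarrow> hermite k R) (at_right R)"
    using isCont_hermite[of R k] unfolding isCont_def by (rule tendsto_within_subset) simp
  then have l: "(hermite k \<longlongrightarrow> 0) (at_right R)" using R(2) by simp
  define d where "d = (1 + \<bar>c\<bar>) powr (- k)"
  have d: "d > 0" by (simp add: d_def)
  have "\<forall>\<^sub>F x in at_right R. hermite k x < d \<and> x > R"
    by (intro eventually_conj order_tendstoD(2)[OF l d] eventually_at_right_less)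
  then have "\<exists>x. hermite k x < d \<and> x > R"
    by (rule eventually_happens'[rotated]) simp
  then obtain x where x: "hermite k x < d" "x \<in> Hdom" using R(1) by auto
  have "1 + \<bar>c\<bar> = d powr (- 1 / k)"
    using k0 by (simp add: d_def powr_powr)
  also have "\<dots> < hscale x"
    unfolding hscale_def using x(1) H_pos(1)[OF x(2)] True by (intro powr_less_mono2_neg) auto
  finally show ?thesis using x(2) by (intro bexI[of _ x]) auto
next
  case False
  then have k: "k < 0" using k0 by simp
  have U: "Hdom = UNIV" using k by (simp add: hermite_dom_neg)
  define m where "m = - k * hermite (k - 1) 0"
  have m: "m > 0" using k hermite_neg_index_pos[of "k - 1" 0] by (simp add: m_def mult_neg_pos)
  define d where "d = (1 + \<bar>c\<bar>) powr (- k)"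
  have d: "d > 0" by (simp add: d_def)
  define x where "x = - d / m"
  have x: "x < 0" using d m by (simp add: x_def)
  obtain z where z: "x < z" "z < 0" "hermite k 0 - hermite k x = (0 - x) * (k * hermite (k - 1) z)"
    using MVT2[of x 0 "hermite k" "\<lambda>x. k * hermite (k - 1) x"] hermite_deriv x by auto
  have "hermite (k - 1) 0 \<le> hermite (k - 1) z"
  proof (rule DERIV_nonpos_imp_nonincreasing[of z 0])
    fix t assume "z \<le> t" "t \<le> 0"
    show "\<exists>y. (hermite (k - 1) has_real_derivative y) (at t) \<and> y \<le> 0"
      by (intro exI conjI, rule hermite_deriv)
         (use k hermite_neg_index_pos[of "k - 1 - 1" t] in \<open>simp add: mult_nonpos_nonneg\<close>)
  qed (use z in simp)
  then have "m \<le> - (k * hermite (k - 1) z)" using k by (simp add: m_def)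
  then have "(0 - x) * m \<le> (0 - x) * (- (k * hermite (k - 1) z))"
    using x by (intro mult_left_mono) auto
  moreover have "(0 - x) * m = d" using m by (simp add: x_def)
  moreover have "hermite k 0 > 0" using k by (rule hermite_neg_index_pos)
  ultimately have "d < hermite k x" using z(3) by simp
  have "1 + \<bar>c\<bar> = d powr (- 1 / k)"
    using k0 by (simp add: d_def powr_powr)
  also have "\<dots> < hscale x"
    unfolding hscale_def using \<open>d < hermite k x\<close> d k by (intro powr_less_mono2) (auto simp: divide_neg_neg)
  finally show ?thesis using U by (intro bexI[of _ x]) auto
qed

lemma hscale_surj: "c > 0 \<Longrightarrow> \<exists>q\<in>Hdom. hscale q = c"
proof -
  assume c: "c > 0"
  obtain a where a: "a \<in> Hdom" "hscale a > c" using hscale_unbounded by blast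
  have "\<forall>\<^sub>F x in at_top. hscale x < c" by (rule order_tendstoD(2)[OF hscale_at_top c])
  then obtain b where b: "b \<ge> a" "hscale b < c"
    unfolding eventually_at_top_linorder by (metis linorder_linear)
  have "\<exists>x\<ge>a. x \<le> b \<and> hscale x = c"
    using a b by (intro IVT2) (auto intro!: isCont_sc hermite_dom_upclosed[OF a(1)])
  then show ?thesis using hermite_dom_upclosed[OF a(1)] by blast
qed

definition H_inv :: "real \<Rightarrow> real" where "H_inv z = (THE q. q \<in> Hdom \<and> hermite k q = z)"

lemma H_inj: "q \<in> Hdom \<Longrightarrow> r \<in> Hdom \<Longrightarrow> hermite k q = hermite k r \<Longrightarrow> q = r"
  using hscale_antimono[of q r] hscale_antimono[of r q] by (cases q r rule: linorder_cases) (auto simp: hscale_def)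

lemma H_inv_H: "q \<in> Hdom \<Longrightarrow> H_inv (hermite k q) = q"
  unfolding H_inv_def by (rule the_equality) (use H_inj in auto)

lemma H_H_inv: "z > 0 \<Longrightarrow> hermite k (H_inv z) = z" and H_inv_dom: "z > 0 \<Longrightarrow> H_inv z \<in> Hdom"
proof -
  assume z: "z > 0"
  obtain q where q: "q \<in> Hdom" "hscale q = z powr (- 1 / k)" using hscale_surj[of "z powr (- 1 / k)"] z by auto
  have "hermite k q = z" using H_eq_sc[OF q(1)] q(2) z k0 by (simp add: powr_powr)
  then show "hermite k (H_inv z) = z" "H_inv z \<in> Hdom" using H_inv_H[OF q(1)] q(1) by auto
qed

lemma hscale_H_inv: "z > 0 \<Longrightarrow> hscale (H_inv z) = z powr (- 1 / k)"
  unfolding hscale_def by (simp add: H_H_inv)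

lemma H_inv_deriv:
  assumes z: "z > 0"
  shows "(H_inv has_real_derivative 1 / (k * hermite (k - 1) (H_inv z))) (at z)"
proof -
  let ?q = "H_inv z"
  have q: "?q \<in> Hdom" using H_inv_dom[OF z] .
  obtain e where e: "e > 0" "cball ?q e \<subseteq> Hdom"
    using open_hermite_dom[of k] q open_contains_cball by blast
  have "isCont H_inv (hermite k ?q)"
  proof (rule isCont_inverse_function2[of "?q - e" ?q "?q + e"])
    fix y assume "?q - e \<le> y" "y \<le> ?q + e"
    then have "y \<in> Hdom" using e by (auto simp: dist_real_def)
    then show "H_inv (hermite k y) = y" by (rule H_inv_H)
  qed (use e isCont_hermite in auto)
  then have c: "isCont H_inv z" by (simp add: H_H_inv[OF z])
  have "(H_inv has_real_derivative inverse (k * hermite (k - 1) ?q)) (at z)"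
  proof (rule DERIV_inverse_function[where a = 0 and b = "z + 1"])
    show "k * hermite (k - 1) ?q \<noteq> 0" using H_pos(2)[OF q] k0 by simp
  qed (use z c hermite_deriv H_H_inv in auto)
  then show ?thesis by (simp add: inverse_eq_divide)
qed

text \<open>With \<open>z = x * s powr (- k)\<close>, the function \<open>U(x) = s powr (k + 1) * dual z\<close> is the partial Legendre transform,
  in the first variable, of the backward heat polynomial \<open>t powr ((k + 1) / 2) * hermite (k + 1) (a / sqrt t)\<close>, \<open>t = s\<^sup>2\<close>.\<close>
definition dual :: "real \<Rightarrow> real" where
  "dual z = kap * hermite (k + 1) (H_inv z) + \<bar>p\<bar> * \<bar>k\<bar> * hermite (k - 1) (H_inv z)"
definition dual1 :: "real \<Rightarrow> real" where "dual1 z = kap * p * H_inv z"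
definition dual2 :: "real \<Rightarrow> real" where "dual2 z = \<bar>p\<bar> / (\<bar>k\<bar> * hermite (k - 1) (H_inv z))"
definition dual3 :: "real \<Rightarrow> real" where
  "dual3 z = - (\<bar>p\<bar> / \<bar>k\<bar>) * ((k - 1) / k) * hermite (k - 2) (H_inv z) / hermite (k - 1) (H_inv z) ^ 3"

text \<open>As for a Legendre transform, the derivative is a multiple of the parameter
  \<open>q\<close> alone. By \<open>kap_pk\<close> both terms have the same coefficient, and the
  recurrence turns their sum into \<open>q * hermite (k - 1) q\<close>; the derivative of
  \<open>H_inv\<close> cancels the Hermite factor.\<close>

lemma dual_deriv:
  assumes z: "z > 0"
  shows "(dual has_real_derivative dual1 z) (at z)"
proof -
  let ?q = "H_inv z"
  have q: "hermite (k - 1) ?q > 0" using H_pos(2)[OF H_inv_dom[OF z]] .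
  have r: "(k - 1) * hermite (k - 1 - 1) ?q = ?q * hermite (k - 1) ?q - hermite k ?q"
    using hermite_rec[of "k - 1" ?q] by simp
  have "(dual has_real_derivative (kap * ((k + 1) * hermite (k + 1 - 1) ?q * (1 / (k * hermite (k - 1) ?q)))
     + \<bar>p\<bar> * \<bar>k\<bar> * ((k - 1) * hermite (k - 1 - 1) ?q * (1 / (k * hermite (k - 1) ?q))))) (at z)"
    unfolding dual_def[abs_def]
    by (intro DERIV_add DERIV_cmult DERIV_chain2[OF hermite_deriv] H_inv_deriv z)
  then show ?thesis
  proof (rule DERIV_cong)
    have "kap * ((k + 1) * hermite (k + 1 - 1) ?q * (1 / (k * hermite (k - 1) ?q)))
     + \<bar>p\<bar> * \<bar>k\<bar> * ((k - 1) * hermite (k - 1 - 1) ?q * (1 / (k * hermite (k - 1) ?q)))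
     = (kap * (k + 1)) * (hermite k ?q + (k - 1) * hermite (k - 1 - 1) ?q) * (1 / (k * hermite (k - 1) ?q))"
      unfolding kap_pk[symmetric] by (simp only: add_diff_cancel_right' distrib_left distrib_right mult_ac)
    also have "\<dots> = kap * (k + 1) * ?q / k"
      unfolding r using q by simp
    also have "\<dots> = kap * p * ?q" unfolding pk[symmetric] using k0 by simp
    finally show "kap * ((k + 1) * hermite (k + 1 - 1) ?q * (1 / (k * hermite (k - 1) ?q)))
     + \<bar>p\<bar> * \<bar>k\<bar> * ((k - 1) * hermite (k - 1 - 1) ?q * (1 / (k * hermite (k - 1) ?q))) = dual1 z"
      by (simp add: dual1_def)
  qed
qed

lemma kap_p_div_k: "kap * p / k = \<bar>p\<bar> / \<bar>k\<bar>"
  unfolding kap_p using k0 by (simp add: sgn_if abs_if)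

lemma dual1_deriv:
  assumes z: "z > 0"
  shows "(dual1 has_real_derivative dual2 z) (at z)"
proof -
  have "(dual1 has_real_derivative kap * p * (1 / (k * hermite (k - 1) (H_inv z)))) (at z)"
    unfolding dual1_def[abs_def] by (intro DERIV_cmult H_inv_deriv z)
  then show ?thesis
  proof (rule DERIV_cong)
    have "kap * p * (1 / (k * hermite (k - 1) (H_inv z))) = kap * p / k / hermite (k - 1) (H_inv z)"
      by simp
    then show "kap * p * (1 / (k * hermite (k - 1) (H_inv z))) = dual2 z"
      unfolding kap_p_div_k dual2_def by simp
  qed
qed

lemma dual2_deriv:
  assumes z: "z > 0"
  shows "(dual2 has_real_derivative dual3 z) (at z)"
proof -
  let ?h = "hermite (k - 1) (H_inv z)"
  have q: "?h > 0" using H_pos(2)[OF H_inv_dom[OF z]] .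
  have "((\<lambda>z. hermite (k - 1) (H_inv z)) has_real_derivative (k - 1) * hermite (k - 1 - 1) (H_inv z) * (1 / (k * ?h))) (at z)"
    by (intro DERIV_chain2[OF hermite_deriv] H_inv_deriv z)
  then have "((\<lambda>z. (\<bar>p\<bar> / \<bar>k\<bar>) * inverse (hermite (k - 1) (H_inv z))) has_real_derivative
     (\<bar>p\<bar> / \<bar>k\<bar>) * (- ((k - 1) * hermite (k - 1 - 1) (H_inv z) * (1 / (k * ?h)) * inverse (?h ^ Suc (Suc 0))))) (at z)"
    using q by (intro DERIV_cmult DERIV_inverse_fun) auto
  then have "((\<lambda>z. (\<bar>p\<bar> / \<bar>k\<bar>) * inverse (hermite (k - 1) (H_inv z))) has_real_derivative dual3 z) (at z)"
  proof (rule DERIV_cong)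
    show "(\<bar>p\<bar> / \<bar>k\<bar>) * (- ((k - 1) * hermite (k - 1 - 1) (H_inv z) * (1 / (k * ?h)) * inverse (?h ^ Suc (Suc 0)))) = dual3 z"
      using q k0 unfolding dual3_def by (simp add: field_simps power3_eq_cube)
  qed
  moreover have "dual2 = (\<lambda>z. (\<bar>p\<bar> / \<bar>k\<bar>) * inverse (hermite (k - 1) (H_inv z)))"
    by (auto simp: dual2_def fun_eq_iff divide_inverse)
  ultimately show ?thesis by simp
qed

definition M :: "real \<Rightarrow> real \<Rightarrow> real" where "M x y = x powr p * Theta (y / x)"

text \<open>Up to the factor \<open>z powr p\<close>, the dual is the height at 0 of the tangent to
  \<open>Theta\<close> at the point with parameter \<open>H_inv z\<close>.\<close>

lemma dual_eq:
  assumes z: "z > 0"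
  shows "dual z = z powr p * (Theta_curve (H_inv z) + \<bar>p\<bar> * hscale (H_inv z) * hermite_T k (H_inv z))"
proof -
  let ?q = "H_inv z"
  have a: "z powr p * z powr (- p) = 1" using z by (simp flip: powr_add)
  have b: "z powr p * (z powr (- 1 / k) / z) = 1"
  proof -
    have "z powr p * (z powr (- 1 / k) * z powr (- 1)) = z powr (p + (- 1 / k) + (- 1))"
      by (simp only: powr_add mult.assoc)
    also have "p + (- 1 / k) + (- 1) = 0" by (simp add: p_def)
    finally show ?thesis using z by (simp add: powr_minus divide_inverse)
  qed
  have "z powr p * (Theta_curve ?q + \<bar>p\<bar> * hscale ?q * hermite_T k ?q)
     = kap * hermite (k + 1) ?q * (z powr p * z powr (- p)) + \<bar>p\<bar> * \<bar>k\<bar> * hermite (k - 1) ?q * (z powr p * (z powr (- 1 / k) / z))"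
    unfolding Theta_curve_def hscale_H_inv[OF z] hermite_T_def H_H_inv[OF z] by (simp add: algebra_simps)
  then show ?thesis unfolding a b dual_def by simp
qed

text \<open>For each \<open>x\<close> the right-hand side is the tangent to \<open>Theta\<close> at
  the parameter \<open>H_inv (x * s powr (- k))\<close>, rescaled by \<open>x powr p\<close>. At
  this parameter \<open>hscale\<close> equals \<open>s * x powr (- 1 / k)\<close>, which makes the
  slope in \<open>y\<close> the same number \<open>- \<bar>p\<bar> * s\<close> for all
  \<open>x\<close>.\<close>

lemma M_le_dual:
  assumes s: "s > 0" and x: "x > 0" and y: "y \<ge> 0"
  shows "M x y \<le> s powr (k + 1) * dual (x * s powr (- k)) - \<bar>p\<bar> * s * y"
    and "y = x * hermite_T k (H_inv (x * s powr (- k))) \<Longrightarrow> M x y = s powr (k + 1) * dual (x * s powr (- k)) - \<bar>p\<bar> * s * y"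
proof -
  let ?z = "x * s powr (- k)"
  let ?q = "H_inv ?z"
  have z: "?z > 0" using s x by simp
  have q: "?q \<in> Hdom" using H_inv_dom[OF z] .
  have hscale: "hscale ?q = s * x powr (- 1 / k)"
    unfolding hscale_H_inv[OF z] using s x k0 by (simp add: powr_mult powr_powr)
  have xs: "x powr p * x powr (- 1 / k) = x"
    using x by (simp add: p_def flip: powr_add)
  have zp: "?z powr p * s powr (k + 1) = x powr p"
  proof -
    have "?z powr p * s powr (k + 1) = x powr p * (s powr (- (p * k)) * s powr (k + 1))"
      using s x by (simp add: powr_mult powr_powr mult.commute[of k])
    also have "s powr (- (p * k)) * s powr (k + 1) = 1"
      unfolding pk using s by (simp flip: powr_add)
    finally show ?thesis by simp
  qed
  have U: "s powr (k + 1) * dual ?z = x powr p * (Theta_curve ?q + \<bar>p\<bar> * hscale ?q * hermite_T k ?q)"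
    unfolding dual_eq[OF z] zp[symmetric] by (simp add: mult_ac)
  have e: "x powr p * (Theta_curve ?q - \<bar>p\<bar> * hscale ?q * (y / x - hermite_T k ?q)) = s powr (k + 1) * dual ?z - \<bar>p\<bar> * s * y"
  proof -
    have "x powr p * (\<bar>p\<bar> * hscale ?q * (y / x)) = \<bar>p\<bar> * s * (y / x) * (x powr p * x powr (- 1 / k))"
      unfolding hscale by simp
    also have "\<dots> = \<bar>p\<bar> * s * y" unfolding xs using x by simp
    finally show ?thesis unfolding U by (simp add: algebra_simps)
  qed
  have "M x y \<le> x powr p * (Theta_curve ?q - \<bar>p\<bar> * hscale ?q * (y / x - hermite_T k ?q))"
    unfolding M_def using x y by (intro mult_left_mono Theta_tangent q) auto
  then show "M x y \<le> s powr (k + 1) * dual ?z - \<bar>p\<bar> * s * y" unfolding e .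
  assume "y = x * hermite_T k ?q"
  then have "M x y = x powr p * (Theta_curve ?q - \<bar>p\<bar> * hscale ?q * (y / x - hermite_T k ?q))"
    unfolding M_def using x Theta_T[OF q] by simp
  then show "M x y = s powr (k + 1) * dual ?z - \<bar>p\<bar> * s * y" unfolding e .
qed

end

section \<open>Second-order majorants of \<open>M\<close> with uniform constants\<close>

lemma bounded_on_upper_ray:
  fixes b :: "real \<Rightarrow> real"
  assumes c: "continuous_on {a..} b" and l: "(b \<longlongrightarrow> l) at_top"
  shows "\<exists>C. \<forall>q\<ge>a. \<bar>b q\<bar> \<le> C"
proof -
  have "\<forall>\<^sub>F q in at_top. \<bar>b q\<bar> < \<bar>l\<bar> + 1"
    by (rule order_tendstoD(2)[OF tendsto_rabs[OF l]]) simp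
  then obtain N where N: "\<And>q. q \<ge> N \<Longrightarrow> \<bar>b q\<bar> < \<bar>l\<bar> + 1"
    unfolding eventually_at_top_linorder by auto
  have "bounded (b ` {a..N})"
    by (intro compact_imp_bounded compact_continuous_image continuous_on_subset[OF c]) auto
  then obtain B where "\<forall>q\<in>{a..N}. \<bar>b q\<bar> \<le> B"
    unfolding bounded_iff by auto
  then have B: "\<bar>b q\<bar> \<le> B" if "a \<le> q" "q \<le> N" for q using that by simp
  have "\<bar>b q\<bar> \<le> max B (\<bar>l\<bar> + 1)" if "q \<ge> a" for q
    using N[of q] B[of q] that by (cases "q \<le> N") auto
  then show ?thesis by blast
qed

lemma powr_bounded:
  fixes c :: real
  assumes "0 < a"
  shows "\<exists>C>0. \<forall>x\<in>{a..b}. x powr c \<le> C"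
proof -
  have "bounded ((\<lambda>x. x powr c) ` {a..b})"
    using assms by (intro compact_imp_bounded compact_continuous_image continuous_intros) auto
  then obtain B where "\<forall>x\<in>{a..b}. \<bar>x powr c\<bar> \<le> B"
    unfolding bounded_iff by auto
  then have "\<forall>x\<in>{a..b}. x powr c \<le> \<bar>B\<bar> + 1" by fastforce
  then show ?thesis by (intro exI[of _ "\<bar>B\<bar> + 1"]) auto
qed

text \<open>Each factor behaves like a power of \<open>q\<close>, and under \<open>e\<close> the
  exponents cancel.\<close>

lemma hermite_quotient_at_top:
  "((\<lambda>q. hermite k q powr c * hermite i q / hermite j q ^ n) \<longlongrightarrow> 1) at_top" if e: "k * c + i = j * n"
proof -
  have "((\<lambda>q. (hermite k q * q powr (- k)) powr c * (hermite i q * q powr (- i)) / (hermite j q * q powr (- j)) ^ n) \<longlongrightarrow> 1 * 1 / 1 ^ n) at_top"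
    by (intro tendsto_divide tendsto_mult tendsto_power hermite_asymp tendsto_powr[OF hermite_asymp tendsto_const, of k c, simplified]) auto
  moreover have "\<forall>\<^sub>F q in at_top. (hermite k q * q powr (- k)) powr c * (hermite i q * q powr (- i)) / (hermite j q * q powr (- j)) ^ n
     = hermite k q powr c * hermite i q / hermite j q ^ n"
    using eventually_gt_at_top[of 0] hermite_eventually_pos[of k]
  proof eventually_elim
    case (elim q)
    have "(q powr (- j)) ^ n = q powr (- j * n)" using elim by (simp add: powr_powr flip: powr_realpow)
    also have "- j * n = - k * c + - i" using e by (simp add: algebra_simps)
    finally have jn: "(q powr (- j)) ^ n = q powr (- k * c) * q powr (- i)" by (simp only: powr_add)
    have "(hermite k q * q powr (- k)) powr c = hermite k q powr c * q powr (- k * c)"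
      using elim by (simp add: powr_mult powr_powr)
    then show ?case unfolding power_mult_distrib jn using elim by simp
  qed
  ultimately show ?thesis by (subst (asm) filterlim_cong[OF refl refl]) auto
qed

context hermite_index
begin

lemma hermite_quotient_bounded:
  assumes a: "a \<in> Hdom" and e: "k * c + i = (k - 1) * n"
  shows "\<exists>C. \<forall>q\<ge>a. \<bar>hermite k q powr c * hermite i q / hermite (k - 1) q ^ n\<bar> \<le> C"
proof (rule bounded_on_upper_ray[OF _ hermite_quotient_at_top[OF e]])
  have "\<forall>q\<in>{a..}. hermite k q \<noteq> 0 \<and> hermite (k - 1) q \<noteq> 0"
    using H_pos hermite_dom_upclosed[OF a] by (metis atLeast_iff less_irrefl)
  then show "continuous_on {a..} (\<lambda>q. hermite k q powr c * hermite i q / hermite (k - 1) q ^ n)"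
    by (intro continuous_intros continuous_at_imp_continuous_on ballI isCont_hermite) auto
qed

text \<open>For \<open>y = 0\<close> the touching point corresponds to infinite \<open>q\<close>,
  outside the reach of \<open>dual\<close>. The majorant is then \<open>kap * x powr p\<close>,
  constant in \<open>y\<close>, by \<open>Theta_le_kap\<close>; its second derivative is nonnegative
  because \<open>p - 1 = 1 / k\<close>. The vanishing term with \<open>be * 0\<close> gives it the
  form shared with positive \<open>y\<close>.\<close>

lemma tangent_at_zero:
  assumes eB: "0 < e" "e \<le> B"
  shows "\<exists>C. \<forall>x\<in>{e..B}. \<exists>al be. 0 \<le> be \<and> be \<le> C \<and>
    (\<forall>x'\<in>{e..B}. \<forall>y'\<ge>0. M x' y' \<le> M x 0 + al * (x' - x) - be * 0 * (y' - 0) + be / 2 * (x' - x)\<^sup>2 + C * \<bar>x' - x\<bar> ^ 3)"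
proof -
  let ?f1 = "\<lambda>x. kap * (p * x powr (p - 1))"
  let ?f2 = "\<lambda>x. kap * (p * ((p - 1) * x powr (p - 1 - 1)))"
  let ?f3 = "\<lambda>x. kap * (p * ((p - 1) * ((p - 1 - 1) * x powr (p - 1 - 1 - 1))))"
  obtain C2 where C2: "\<forall>x\<in>{e..B}. x powr (p - 1 - 1) \<le> C2" using powr_bounded[OF eB(1)] by blast
  obtain C3 where C3: "\<forall>x\<in>{e..B}. x powr (p - 1 - 1 - 1) \<le> C3" using powr_bounded[OF eB(1)] by blast
  have kp: "kap * (p * (p - 1)) \<ge> 0"
  proof -
    have "kap * (p * (p - 1)) = kap * p / k" by (simp add: p_def)
    then show ?thesis unfolding kap_p_div_k by simp
  qed
  define C where "C = max (kap * (p * (p - 1)) * C2) (\<bar>kap * (p * ((p - 1) * (p - 1 - 1)))\<bar> * C3)"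
  have d1: "((\<lambda>x. kap * x powr p) has_real_derivative ?f1 t) (at t)" and
       d2: "(?f1 has_real_derivative ?f2 t) (at t)" and d3: "(?f2 has_real_derivative ?f3 t) (at t)"
    if "t \<in> {e..B}" for t
    using that eB by (auto intro!: derivative_eq_intros)
  have b: "\<bar>?f3 t\<bar> \<le> C" if "t \<in> {e..B}" for t
  proof -
    have "\<bar>?f3 t\<bar> = \<bar>kap * (p * ((p - 1) * (p - 1 - 1)))\<bar> * t powr (p - 1 - 1 - 1)"
      by (simp add: abs_mult mult_ac)
    also have "\<dots> \<le> \<bar>kap * (p * ((p - 1) * (p - 1 - 1)))\<bar> * C3"
      using C3 that by (intro mult_left_mono) auto
    finally show ?thesis by (simp add: C_def)
  qed
  have "\<exists>al be. 0 \<le> be \<and> be \<le> C \<and>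
    (\<forall>x'\<in>{e..B}. \<forall>y'\<ge>0. M x' y' \<le> M x 0 + al * (x' - x) - be * 0 * (y' - 0) + be / 2 * (x' - x)\<^sup>2 + C * \<bar>x' - x\<bar> ^ 3)"
    if x: "x \<in> {e..B}" for x
  proof (intro exI conjI ballI allI impI)
    have e2: "?f2 x = (kap * (p * (p - 1))) * x powr (p - 1 - 1)" by simp
    show "?f2 x \<ge> 0" unfolding e2 using kp by simp
    have "?f2 x \<le> kap * (p * (p - 1)) * C2"
      unfolding e2 using kp C2 x by (intro mult_left_mono) auto
    then show "?f2 x \<le> C" by (simp add: C_def)
    fix x' y' :: real assume x': "x' \<in> {e..B}" and y': "0 \<le> y'"
    have "M x' y' \<le> kap * x' powr p"
      unfolding M_def using Theta_le_kap[of "y' / x'"] x' y' eB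
      by (subst mult.commute[of kap]) (intro mult_left_mono, auto)
    also have "\<dots> \<le> kap * x powr p + ?f1 x * (x' - x) + ?f2 x / 2 * (x' - x)\<^sup>2 + C * \<bar>x' - x\<bar> ^ 3"
      by (rule taylor_cubic_upper[OF d1 d2 d3 b x x'])
    also have "kap * x powr p = M x 0" by (simp add: M_def Theta_0)
    finally show "M x' y' \<le> M x 0 + ?f1 x * (x' - x) - ?f2 x * 0 * (y' - 0) + ?f2 x / 2 * (x' - x)\<^sup>2 + C * \<bar>x' - x\<bar> ^ 3"
      by simp
  qed
  then show ?thesis by blast
qed

text \<open>The majorant touching at \<open>(x, y)\<close> is expanded to third order in its first
  variable. The constants must not depend on the touching point, although \<open>q\<close> tends to
  infinity as \<open>y\<close> tends to 0. So the derivatives are rewritten as a power of the first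
  variable times a quotient of Hermite functions with a limit at infinity, and all occurring
  parameters are kept above one number \<open>q1\<close>.\<close>

lemma tangent_positive:
  assumes eB: "0 < e" "e \<le> B" and L: "0 \<le> L"
  shows "\<exists>C. \<forall>x\<in>{e..B}. \<forall>y\<in>{0<..L}. \<exists>al be. 0 \<le> be \<and> be \<le> C \<and>
    (\<forall>x'\<in>{e..B}. \<forall>y'\<ge>0. M x' y' \<le> M x y + al * (x' - x) - be * y * (y' - y) + be / 2 * (x' - x)\<^sup>2 + C * \<bar>x' - x\<bar> ^ 3)"
proof -
  \<comment> \<open>Touching parameters satisfy \<open>hermite_T k q \<le> L / e\<close>, so they
    lie to the right of \<open>q0\<close>; the summand 1 keeps the value in the range of
    \<open>hermite_T\<close> when \<open>L = 0\<close>.\<close>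
  have "L / e + 1 > 0" using L eB by (intro add_nonneg_pos) auto
  then obtain q0 where q0: "q0 \<in> Hdom" "hermite_T k q0 = L / e + 1" using T_surj by blast
  \<comment> \<open>With the slope \<open>s\<close> fixed, moving the first variable inside
    \<open>{e..B}\<close> multiplies \<open>hscale\<close> at most by this power of
    \<open>B / e\<close>, so every parameter met stays to the right of \<open>q1\<close>.\<close>
  have "hscale q0 * (B / e) powr (1 / \<bar>k\<bar>) > 0" using hscale_pos[OF q0(1)] eB by simp
  then obtain q1 where q1: "q1 \<in> Hdom" "hscale q1 = hscale q0 * (B / e) powr (1 / \<bar>k\<bar>)" using hscale_surj by blast
  have "k * (2 - 1 / k) + (k - 2) = (k - 1) * real 3" using k0 by (simp add: field_simps)
  then obtain b3 where b3: "\<And>q. q \<ge> q1 \<Longrightarrow> \<bar>hermite k q powr (2 - 1 / k) * hermite (k - 2) q / hermite (k - 1) q ^ 3\<bar> \<le> b3"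
    using hermite_quotient_bounded[OF q1(1)] by blast
  \<comment> \<open>\<open>hermite 0\<close> is the constant 1; with it the bound for the second
    derivative becomes an instance of the same quotient estimate.\<close>
  have "k * ((k - 1) / k) + 0 = (k - 1) * real 1" using k0 by (simp add: field_simps)
  then obtain b2 where b2: "\<And>q. q \<ge> q1 \<Longrightarrow> \<bar>hermite k q powr ((k - 1) / k) * hermite 0 q / hermite (k - 1) q ^ 1\<bar> \<le> b2"
    using hermite_quotient_bounded[OF q1(1)] by blast
  obtain c2 where c2: "c2 > 0" "\<forall>x\<in>{e..B}. x powr ((1 - k) / k) \<le> c2" using powr_bounded[OF eB(1)] by blast
  obtain c3 where c3: "c3 > 0" "\<forall>x\<in>{e..B}. x powr (1 / k - 2) \<le> c3" using powr_bounded[OF eB(1)] by blast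
  have b0: "b2 \<ge> 0" "b3 \<ge> 0" using b2[of q1] b3[of q1] by linarith+
  define C3 where "C3 = \<bar>(\<bar>p\<bar> / \<bar>k\<bar>) * ((k - 1) / k)\<bar> * (c3 * b3)"
  define C where "C = max (\<bar>p\<bar> / \<bar>k\<bar> * (c2 * b2)) C3"
  have "\<exists>al be. 0 \<le> be \<and> be \<le> C \<and>
    (\<forall>x'\<in>{e..B}. \<forall>y'\<ge>0. M x' y' \<le> M x y + al * (x' - x) - be * y * (y' - y) + be / 2 * (x' - x)\<^sup>2 + C * \<bar>x' - x\<bar> ^ 3)"
    if x: "x \<in> {e..B}" and y: "y \<in> {0<..L}" for x y
  proof -
    have xp: "x > 0" using x eB by auto
    have "y / x > 0" using y xp by simp
    then obtain q where q: "q \<in> Hdom" "hermite_T k q = y / x" using T_surj by blast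
    have "y / x \<le> L / e" using x y eB by (intro frac_le) auto
    then have "q0 \<le> q" using hermite_T_strict_antimono[OF k0 q(1), of q0] q q0 by force
    then have scq: "hscale q \<le> hscale q0" using hscale_le_iff[OF q(1) q0(1)] by simp
    \<comment> \<open>Solving \<open>x * s powr (- k) = hermite k q\<close> for \<open>s\<close>
      puts the touching point at \<open>(x, y)\<close>.\<close>
    define s where "s = hscale q * x powr (1 / k)"
    have s: "s > 0" using hscale_pos[OF q(1)] xp by (simp add: s_def)
    have sk: "s powr (- k) = hermite k q / x"
      unfolding s_def using H_eq_sc[OF q(1)] hscale_pos[OF q(1)] xp k0
      by (simp add: powr_mult powr_powr powr_minus divide_inverse)
    have z: "x * s powr (- k) = hermite k q" unfolding sk using xp by simp
    have Qz: "H_inv (x * s powr (- k)) = q" unfolding z by (rule H_inv_H[OF q(1)])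
    have ge: "q1 \<le> H_inv (t * s powr (- k))" if t: "t \<in> {e..B}" for t
    proof -
      have tp: "t > 0" and zt: "t * s powr (- k) > 0" using t eB s by auto
      have "hscale (H_inv (t * s powr (- k))) = s * t powr (- 1 / k)"
        unfolding hscale_H_inv[OF zt] using s tp k0 by (simp add: powr_mult powr_powr)
      also have "\<dots> = hscale q * (x / t) powr (1 / k)"
        using xp tp powr_minus_divide[of t "1 / k"] by (simp add: s_def powr_divide)
      also have "(x / t) powr (1 / k) \<le> (B / e) powr (1 / \<bar>k\<bar>)"
      proof (cases "k > 0")
        case True
        have "x / t \<le> B / e" using x t eB by (intro frac_le) auto
        then have "(x / t) powr (1 / k) \<le> (B / e) powr (1 / k)"
          using True xp tp by (intro powr_mono2) auto
        then show ?thesis using True by simp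
      next
        case False
        have "(x / t) powr (1 / k) = (t / x) powr (1 / \<bar>k\<bar>)"
        proof -
          have "1 / \<bar>k\<bar> = - (1 / k)" using False by simp
          then have "(t / x) powr (1 / \<bar>k\<bar>) = inverse ((t / x) powr (1 / k))"
            by (simp only: powr_minus)
          then show ?thesis using xp tp by (simp add: powr_divide)
        qed
        also have "t / x \<le> B / e" using x t eB by (intro frac_le) auto
        then have "(t / x) powr (1 / \<bar>k\<bar>) \<le> (B / e) powr (1 / \<bar>k\<bar>)"
          using xp tp by (intro powr_mono2) auto
        finally show ?thesis .
      qed
      then have "hscale q * (x / t) powr (1 / k) \<le> hscale q0 * (B / e) powr (1 / \<bar>k\<bar>)"
        using scq hscale_pos[OF q0(1)] by (intro mult_mono) auto
      finally show ?thesis using hscale_le_iff[OF H_inv_dom[OF zt] q1(1)] q1(2) by simp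
    qed
    let ?z = "\<lambda>t. t * s powr (- k)"
    let ?f = "\<lambda>t. s powr (k + 1) * dual (?z t)"
    let ?f1 = "\<lambda>t. s powr (k + 1) * (dual1 (?z t) * s powr (- k))"
    let ?f2 = "\<lambda>t. s powr (k + 1) * (dual2 (?z t) * s powr (- k) * s powr (- k))"
    let ?f3 = "\<lambda>t. s powr (k + 1) * (dual3 (?z t) * s powr (- k) * s powr (- k) * s powr (- k))"
    have zpos: "?z t > 0" if "t \<in> {e..B}" for t using that eB s by auto
    have dz: "(?z has_real_derivative s powr (- k)) (at t)" for t
      by (auto intro!: derivative_eq_intros)
    have d1: "(?f has_real_derivative ?f1 t) (at t)" if "t \<in> {e..B}" for t
      using DERIV_chain2[OF dual_deriv[OF zpos[OF that]] dz] by (intro DERIV_cmult)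
    have d2: "(?f1 has_real_derivative ?f2 t) (at t)" if "t \<in> {e..B}" for t
      using DERIV_chain2[OF dual1_deriv[OF zpos[OF that]] dz] by (intro DERIV_cmult DERIV_cmult_right)
    have d3: "(?f2 has_real_derivative ?f3 t) (at t)" if "t \<in> {e..B}" for t
      using DERIV_chain2[OF dual2_deriv[OF zpos[OF that]] dz] by (intro DERIV_cmult DERIV_cmult_right)
    \<comment> \<open>The powers of \<open>s\<close> are eliminated through
      \<open>hermite k ?q = t * s powr (- k)\<close>; what is left is a power of \<open>t\<close>
      times a bounded quotient.\<close>
    have f3: "\<bar>?f3 t\<bar> \<le> C" if t: "t \<in> {e..B}" for t
    proof -
      let ?q = "H_inv (?z t)"
      have tp: "t > 0" using t eB by simp
      have h: "hermite k ?q powr (2 - 1 / k) = t powr (2 - 1 / k) * s powr (1 - 2 * k)"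
        unfolding H_H_inv[OF zpos[OF t]] using tp s k0 by (simp add: powr_mult powr_powr right_diff_distrib mult.commute)
      have "s powr (k + 1) * (s powr (- k) * s powr (- k) * s powr (- k)) = s powr (1 - 2 * k)"
        by (simp flip: powr_add)
      also have "\<dots> = (t powr (1 / k - 2) * t powr (2 - 1 / k)) * s powr (1 - 2 * k)"
        using tp by (simp flip: powr_add)
      also have "\<dots> = t powr (1 / k - 2) * hermite k ?q powr (2 - 1 / k)"
        unfolding h by simp
      finally have e: "s powr (k + 1) * (s powr (- k) * s powr (- k) * s powr (- k)) = t powr (1 / k - 2) * hermite k ?q powr (2 - 1 / k)" .
      have "?f3 t = dual3 (?z t) * (s powr (k + 1) * (s powr (- k) * s powr (- k) * s powr (- k)))"
        by (simp only: mult_ac)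
      also have "\<dots> = - ((\<bar>p\<bar> / \<bar>k\<bar>) * ((k - 1) / k)) * (t powr (1 / k - 2) * (hermite k ?q powr (2 - 1 / k) * hermite (k - 2) ?q / hermite (k - 1) ?q ^ 3))"
        unfolding e dual3_def by (simp add: mult_ac)
      finally have "\<bar>?f3 t\<bar> = \<bar>(\<bar>p\<bar> / \<bar>k\<bar>) * ((k - 1) / k)\<bar> * (t powr (1 / k - 2) * \<bar>hermite k ?q powr (2 - 1 / k) * hermite (k - 2) ?q / hermite (k - 1) ?q ^ 3\<bar>)"
        by (simp only: abs_mult abs_minus_cancel abs_of_nonneg[OF powr_ge_zero])
      also have "\<dots> \<le> C3"
        unfolding C3_def using c3 t b3[OF ge[OF t]] b0 by (intro mult_left_mono mult_mono) auto
      finally show ?thesis by (simp add: C_def)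
    qed
    \<comment> \<open>At the touching point \<open>y\<close> contains the factor
      \<open>hermite (k - 1) q\<close> that \<open>dual2\<close> has in its denominator. This makes
      the quadratic coefficient determine the slope in \<open>y\<close>.\<close>
    have f2y: "?f2 x * y = \<bar>p\<bar> * s"
    proof -
      have "y = x * hermite_T k q" using q(2) xp by simp
      then have y': "y = x * (\<bar>k\<bar> * hermite (k - 1) q / hermite k q)" by (simp add: hermite_T_def)
      have hp: "hermite k q > 0" "hermite (k - 1) q > 0" using H_pos[OF q(1)] .
      have "?f2 x * y = s powr (k + 1) * s powr (- k) * (\<bar>p\<bar> * (s powr (- k) * x / hermite k q))"
        unfolding dual2_def Qz y' using hp k0 by (simp add: field_simps)
      also have "s powr (- k) * x / hermite k q = 1" using z hp by (simp add: mult.commute)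
      also have "s powr (k + 1) * s powr (- k) = s" using s by (simp flip: powr_add)
      finally show ?thesis by (simp add: mult.commute)
    qed
    have f2b: "0 \<le> ?f2 x" "?f2 x \<le> C"
    proof -
      have hp: "hermite k q > 0" "hermite (k - 1) q > 0" using H_pos[OF q(1)] .
      show "0 \<le> ?f2 x" unfolding dual2_def Qz using hp by simp
      have h: "hermite k q powr ((k - 1) / k) = x powr ((k - 1) / k) * s powr (1 - k)"
      proof -
        have "- k * ((k - 1) / k) = 1 - k" using k0 by simp
        then show ?thesis
          unfolding z[symmetric] using xp s by (simp only: powr_mult powr_powr less_imp_le powr_ge_zero)
      qed
      have "s powr (k + 1) * (s powr (- k) * s powr (- k)) = s powr (1 - k)"
        by (simp flip: powr_add)
      also have "\<dots> = (x powr ((1 - k) / k) * x powr ((k - 1) / k)) * s powr (1 - k)"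
        using xp k0 by (simp add: diff_divide_distrib flip: powr_add)
      also have "\<dots> = x powr ((1 - k) / k) * hermite k q powr ((k - 1) / k)"
        unfolding h by simp
      finally have e: "s powr (k + 1) * (s powr (- k) * s powr (- k)) = x powr ((1 - k) / k) * hermite k q powr ((k - 1) / k)" .
      have "?f2 x = dual2 (?z x) * (s powr (k + 1) * (s powr (- k) * s powr (- k)))"
        by (simp only: mult_ac)
      also have "\<dots> = \<bar>p\<bar> / \<bar>k\<bar> * (x powr ((1 - k) / k) * (hermite k q powr ((k - 1) / k) * hermite 0 q / hermite (k - 1) q ^ 1))"
        unfolding e dual2_def Qz by (simp add: hermite_0 mult_ac)
      also have "\<dots> \<le> \<bar>p\<bar> / \<bar>k\<bar> * (c2 * b2)"
        using c2 x b2[of q] ge[OF x] b0 unfolding Qz by (intro mult_left_mono mult_mono) (auto simp: hermite_0 hp less_imp_le)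
      finally show "?f2 x \<le> C" by (simp add: C_def)
    qed
    show ?thesis
    proof (rule exI[of _ "?f1 x"], rule exI[of _ "?f2 x"], intro conjI ballI allI impI f2b)
      fix x' y' :: real assume x': "x' \<in> {e..B}" and y': "0 \<le> y'"
      have m1: "M x' y' \<le> ?f x' - \<bar>p\<bar> * s * y'"
        using M_le_dual(1)[OF s, of x' y'] x' y' eB by auto
      have m2: "?f x' \<le> ?f x + ?f1 x * (x' - x) + ?f2 x / 2 * (x' - x)\<^sup>2 + C * \<bar>x' - x\<bar> ^ 3"
        by (rule taylor_cubic_upper[OF d1 d2 d3 f3 x x'])
      have m3: "?f x = M x y + \<bar>p\<bar> * s * y"
      proof -
        have "y = x * hermite_T k (H_inv (x * s powr (- k)))" unfolding Qz q(2) using xp by simp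
        moreover have "0 \<le> y" using y by simp
        ultimately show ?thesis using M_le_dual(2)[OF s xp] by fastforce
      qed
      have m4: "\<bar>p\<bar> * s * (y' - y) = \<bar>p\<bar> * s * y' - \<bar>p\<bar> * s * y" by (rule right_diff_distrib)
      show "M x' y' \<le> M x y + ?f1 x * (x' - x) - ?f2 x * y * (y' - y) + ?f2 x / 2 * (x' - x)\<^sup>2 + C * \<bar>x' - x\<bar> ^ 3"
        unfolding f2y m4 using m1 m2 m3 by linarith
    qed
  qed
  then show ?thesis by blast
qed

text \<open>The coefficient \<open>be\<close> of the quadratic term is the one of the linear term in \<open>y'\<close>: this is the
  Monge-Ampere equation satisfied by \<open>M\<close>, and it makes the drift vanish in the heat flow argument.\<close>
lemma tangent:
  assumes eB: "0 < e" "e \<le> B" and L: "0 \<le> L"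
  shows "\<exists>C. \<forall>x\<in>{e..B}. \<forall>y\<in>{0..L}. \<exists>al be. 0 \<le> be \<and> be \<le> C \<and>
    (\<forall>x'\<in>{e..B}. \<forall>y'\<ge>0. M x' y' \<le> M x y + al * (x' - x) - be * y * (y' - y) + be / 2 * (x' - x)\<^sup>2 + C * \<bar>x' - x\<bar> ^ 3)"
proof -
  obtain C1 where C1: "\<And>x. x \<in> {e..B} \<Longrightarrow> \<exists>al be. 0 \<le> be \<and> be \<le> C1 \<and>
    (\<forall>x'\<in>{e..B}. \<forall>y'\<ge>0. M x' y' \<le> M x 0 + al * (x' - x) - be * 0 * (y' - 0) + be / 2 * (x' - x)\<^sup>2 + C1 * \<bar>x' - x\<bar> ^ 3)"
    using tangent_at_zero[OF eB] by blast
  obtain C2 where C2: "\<And>x y. x \<in> {e..B} \<Longrightarrow> y \<in> {0<..L} \<Longrightarrow> \<exists>al be. 0 \<le> be \<and> be \<le> C2 \<and>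
    (\<forall>x'\<in>{e..B}. \<forall>y'\<ge>0. M x' y' \<le> M x y + al * (x' - x) - be * y * (y' - y) + be / 2 * (x' - x)\<^sup>2 + C2 * \<bar>x' - x\<bar> ^ 3)"
    using tangent_positive[OF eB L] by blast
  define C where "C = max C1 C2"
  have mono: "D * \<bar>x' - x\<bar> ^ 3 \<le> C * \<bar>x' - x\<bar> ^ 3" if "D \<le> C" for D x x' :: real
    using that by (intro mult_right_mono) auto
  have "\<exists>al be. 0 \<le> be \<and> be \<le> C \<and>
    (\<forall>x'\<in>{e..B}. \<forall>y'\<ge>0. M x' y' \<le> M x y + al * (x' - x) - be * y * (y' - y) + be / 2 * (x' - x)\<^sup>2 + C * \<bar>x' - x\<bar> ^ 3)"
    if x: "x \<in> {e..B}" and y: "y \<in> {0..L}" for x y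
  proof -
    have "\<exists>D\<le>C. \<exists>al be. 0 \<le> be \<and> be \<le> D \<and>
      (\<forall>x'\<in>{e..B}. \<forall>y'\<ge>0. M x' y' \<le> M x y + al * (x' - x) - be * y * (y' - y) + be / 2 * (x' - x)\<^sup>2 + D * \<bar>x' - x\<bar> ^ 3)"
    proof (cases "y = 0")
      case True
      moreover have "C1 \<le> C" by (simp add: C_def)
      ultimately show ?thesis using C1[OF x] by blast
    next
      case False
      then have "y \<in> {0<..L}" using y by simp
      moreover have "C2 \<le> C" by (simp add: C_def)
      ultimately show ?thesis using C2[OF x] by blast
    qed
    then obtain D al be where D: "D \<le> C" "0 \<le> be" "be \<le> D" and
      i: "\<And>x' y'. x' \<in> {e..B} \<Longrightarrow> y' \<ge> 0 \<Longrightarrow> M x' y' \<le> M x y + al * (x' - x) - be * y * (y' - y) + be / 2 * (x' - x)\<^sup>2 + D * \<bar>x' - x\<bar> ^ 3"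
      by blast
    show ?thesis
      by (intro exI[of _ al] exI[of _ be] conjI ballI allI impI)
         (use D in simp, use D in simp, use i mono[OF D(1)] in \<open>fastforce intro: order_trans[OF i]\<close>)
  qed
  then show ?thesis by blast
qed

end

subsection \<open>Gaussian averages\<close>

definition gauss_density :: "'a::euclidean_space \<Rightarrow> real" where
  "gauss_density x = (2 * pi) powr (- real DIM('a) / 2) * exp (- (norm x)\<^sup>2 / 2)"

lemma gaussian_density: "gaussian = density lborel (\<lambda>x. ennreal (gauss_density x))"
  by (simp add: gaussian_def gauss_density_def)

lemma gauss_density_pos: "gauss_density x > 0"
  by (simp add: gauss_density_def)

lemma gauss_density_measurable[measurable]: "gauss_density \<in> borel_measurable borel"
  unfolding gauss_density_def[abs_def] by measurable

lemma sets_gaussian[measurable_cong, simp]: "sets gaussian = sets borel"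
  by (simp add: gaussian_def)

lemma space_gaussian[simp]: "space gaussian = UNIV"
  by (simp add: gaussian_def)

lemma nn_integral_exp_square_real: "(\<integral>\<^sup>+ x. ennreal (exp (- x\<^sup>2 / 2)) \<partial>lborel) = ennreal (sqrt (2 * pi))"
proof -
  have "(\<integral>\<^sup>+ x. ennreal (exp (- x\<^sup>2 / 2)) \<partial>lborel) = (\<integral>\<^sup>+ x. ennreal (sqrt (2 * pi)) * ennreal (normal_density 0 1 x) \<partial>lborel)"
    by (rule nn_integral_cong) (simp add: normal_density_def flip: ennreal_mult)
  also have "\<dots> = ennreal (sqrt (2 * pi)) * (\<integral>\<^sup>+ x. ennreal (normal_density 0 1 x) \<partial>lborel)"
    by (rule nn_integral_cmult) simp
  also have "(\<integral>\<^sup>+ x. ennreal (normal_density 0 1 x) \<partial>lborel) = 1"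
    using nn_integral_eq_integral[OF integrable_normal_density[of 1 0]] integral_normal_density[of 1 0] by simp
  finally show ?thesis by simp
qed

lemma nn_integral_gauss_density: "(\<integral>\<^sup>+ x. ennreal (gauss_density (x::'a::euclidean_space)) \<partial>lborel) = 1"
proof -
  have e: "exp (- (norm x)\<^sup>2 / 2) = (\<Prod>b\<in>Basis. exp (- (x \<bullet> b)\<^sup>2 / 2))" for x :: 'a
  proof -
    have "(norm x)\<^sup>2 = (\<Sum>b\<in>Basis. (x \<bullet> b)\<^sup>2)"
      unfolding power2_norm_eq_inner by (subst euclidean_inner) (simp add: power2_eq_square)
    then show ?thesis
      by (simp add: exp_sum[symmetric] sum_negf sum_divide_distrib)
  qed
  have "(\<integral>\<^sup>+ x. ennreal (exp (- (norm (x::'a))\<^sup>2 / 2)) \<partial>lborel)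
      = (\<integral>\<^sup>+ x. (\<Prod>b\<in>Basis. ennreal (exp (- ((x::'a) \<bullet> b)\<^sup>2 / 2))) \<partial>lborel)"
    unfolding e by (simp add: prod_ennreal)
  also have "\<dots> = (\<Prod>b\<in>(Basis::'a set). ennreal (sqrt (2 * pi)))"
    by (subst nn_integral_lborel_prod) (simp_all add: nn_integral_exp_square_real[simplified])
  also have "\<dots> = ennreal ((2 * pi) powr (real DIM('a) / 2))"
  proof -
    have "(2 * pi) powr (real DIM('a) / 2) = sqrt (2 * pi) ^ DIM('a)"
      using powr_powr[of "2 * pi" "1 / 2" "real DIM('a)"] by (simp add: powr_half_sqrt powr_realpow mult.commute)
    then show ?thesis by (simp add: ennreal_power)
  qed
  finally have I: "(\<integral>\<^sup>+ x. ennreal (exp (- (norm (x::'a))\<^sup>2 / 2)) \<partial>lborel) = ennreal ((2 * pi) powr (real DIM('a) / 2))" .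
  have "(\<integral>\<^sup>+ x. ennreal (gauss_density (x::'a)) \<partial>lborel)
      = ennreal ((2 * pi) powr (- real DIM('a) / 2)) * (\<integral>\<^sup>+ x. ennreal (exp (- (norm (x::'a))\<^sup>2 / 2)) \<partial>lborel)"
    unfolding gauss_density_def by (subst nn_integral_cmult[symmetric]) (simp_all add: ennreal_mult)
  also have "\<dots> = ennreal ((2 * pi) powr (- real DIM('a) / 2) * (2 * pi) powr (real DIM('a) / 2))"
    unfolding I by (simp add: ennreal_mult)
  also have "\<dots> = 1" by (simp flip: powr_add)
  finally show ?thesis .
qed

interpretation gaussian: prob_space "gaussian :: 'a::euclidean_space measure"
proof
  show "emeasure (gaussian :: 'a measure) (space gaussian) = 1"
    unfolding space_gaussian unfolding gaussian_density
    by (subst emeasure_density) (simp_all add: nn_integral_gauss_density)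
qed

lemma nn_integral_gaussian:
  "f \<in> borel_measurable borel \<Longrightarrow> (\<integral>\<^sup>+ x. f x \<partial>gaussian) = (\<integral>\<^sup>+ x. ennreal (gauss_density x) * f x \<partial>lborel)"
  unfolding gaussian_density by (rule nn_integral_density) auto

section \<open>Rotation invariance and convolution of Gaussians\<close>

lemma nn_integral_lborel_affine:
  fixes f :: "'a::euclidean_space \<Rightarrow> ennreal"
  assumes [measurable]: "f \<in> borel_measurable borel" and c: "c \<noteq> 0"
  shows "(\<integral>\<^sup>+ x. f x \<partial>lborel) = ennreal (\<bar>c\<bar> ^ DIM('a)) * (\<integral>\<^sup>+ x. f (t + c *\<^sub>R x) \<partial>lborel)"
  by (subst lborel_affine[OF c, of t])
     (simp add: nn_integral_density nn_integral_distr nn_integral_cmult)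

text \<open>With \<open>w = (y - a *\<^sub>R z) /\<^sub>R b\<close>, the pair formed by
  \<open>y\<close> and \<open>(z - a *\<^sub>R y) /\<^sub>R b\<close> is \<open>(a *\<^sub>R z + b
  *\<^sub>R w, b *\<^sub>R z - a *\<^sub>R w)\<close>, an orthogonal image of
  \<open>(z, w)\<close>.\<close>

lemma gauss_density_rotation:
  fixes y z :: "'a::euclidean_space"
  assumes ab: "a\<^sup>2 + b\<^sup>2 = 1" and b: "b > 0"
  shows "gauss_density z * gauss_density ((y - a *\<^sub>R z) /\<^sub>R b) = gauss_density y * gauss_density ((z - a *\<^sub>R y) /\<^sub>R b)"
proof -
  have b2: "b\<^sup>2 = 1 - a\<^sup>2" using ab by simp
  have n: "(norm ((y - a *\<^sub>R z) /\<^sub>R b))\<^sup>2 = (y \<bullet> y - 2 * a * (y \<bullet> z) + a\<^sup>2 * (z \<bullet> z)) / b\<^sup>2" for y z :: 'a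
  proof -
    have "(norm ((y - a *\<^sub>R z) /\<^sub>R b))\<^sup>2 = (norm (y - a *\<^sub>R z))\<^sup>2 / b\<^sup>2"
      by (simp only: norm_scaleR power_mult_distrib power2_abs power_inverse divide_inverse mult.commute)
    also have "(norm (y - a *\<^sub>R z))\<^sup>2 = y \<bullet> y - 2 * a * (y \<bullet> z) + a\<^sup>2 * (z \<bullet> z)"
      unfolding power2_norm_eq_inner by (simp add: inner_diff inner_commute power2_eq_square algebra_simps)
    finally show ?thesis .
  qed
  have "(norm z)\<^sup>2 + (norm ((y - a *\<^sub>R z) /\<^sub>R b))\<^sup>2 = (norm y)\<^sup>2 + (norm ((z - a *\<^sub>R y) /\<^sub>R b))\<^sup>2"
  proof -
    have "b\<^sup>2 * (z \<bullet> z) + (y \<bullet> y - 2 * a * (y \<bullet> z) + a\<^sup>2 * (z \<bullet> z)) = b\<^sup>2 * (y \<bullet> y) + (z \<bullet> z - 2 * a * (z \<bullet> y) + a\<^sup>2 * (y \<bullet> y))"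
      unfolding b2 by (simp add: algebra_simps inner_commute)
    then have "(b\<^sup>2 * (z \<bullet> z) + (y \<bullet> y - 2 * a * (y \<bullet> z) + a\<^sup>2 * (z \<bullet> z))) / b\<^sup>2
        = (b\<^sup>2 * (y \<bullet> y) + (z \<bullet> z - 2 * a * (z \<bullet> y) + a\<^sup>2 * (y \<bullet> y))) / b\<^sup>2" by (simp only:)
    then have "z \<bullet> z + (y \<bullet> y - 2 * a * (y \<bullet> z) + a\<^sup>2 * (z \<bullet> z)) / b\<^sup>2
        = y \<bullet> y + (z \<bullet> z - 2 * a * (z \<bullet> y) + a\<^sup>2 * (y \<bullet> y)) / b\<^sup>2"
      using b by (simp only: add_divide_distrib) simp
    then show ?thesis
      unfolding n by (simp only: power2_norm_eq_inner)
  qed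
  then have "exp (- (norm z)\<^sup>2 / 2) * exp (- (norm ((y - a *\<^sub>R z) /\<^sub>R b))\<^sup>2 / 2)
      = exp (- (norm y)\<^sup>2 / 2) * exp (- (norm ((z - a *\<^sub>R y) /\<^sub>R b))\<^sup>2 / 2)"
    unfolding exp_add[symmetric] by (simp only: minus_add_distrib[symmetric] add_divide_distrib[symmetric])
  then show ?thesis
    unfolding gauss_density_def by (simp add: mult_ac)
qed

lemma ennreal_gauss_mult: "ennreal (gauss_density z * c) = ennreal (gauss_density z) * ennreal c"
  by (rule ennreal_mult') (simp add: less_imp_le gauss_density_pos)

text \<open>The substitution \<open>y = a *\<^sub>R z + b *\<^sub>R w\<close> in the inner integral
  and an exchange of integrals move \<open>y\<close> outside. By
  \<open>gauss_density_rotation\<close> the remaining integral over \<open>z\<close> is that of a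
  normalised Gaussian with mean \<open>a *\<^sub>R y\<close>.\<close>

lemma nn_integral_gaussian_convolution:
  fixes g :: "'a::euclidean_space \<Rightarrow> ennreal"
  assumes ab: "a\<^sup>2 + b\<^sup>2 = 1" and b: "b > 0" and [measurable]: "g \<in> borel_measurable borel"
  shows "(\<integral>\<^sup>+ z. (\<integral>\<^sup>+ w. g (a *\<^sub>R z + b *\<^sub>R w) \<partial>gaussian) \<partial>gaussian) = (\<integral>\<^sup>+ y. g y \<partial>gaussian)"
proof -
  let ?c = "ennreal (\<bar>1 / b\<bar> ^ DIM('a))"
  have inner: "(\<integral>\<^sup>+ w. g (a *\<^sub>R z + b *\<^sub>R w) \<partial>gaussian)
     = ?c * (\<integral>\<^sup>+ y. ennreal (gauss_density ((y - a *\<^sub>R z) /\<^sub>R b)) * g y \<partial>lborel)" for z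
  proof -
    have "(\<integral>\<^sup>+ w. g (a *\<^sub>R z + b *\<^sub>R w) \<partial>gaussian) = (\<integral>\<^sup>+ w. ennreal (gauss_density w) * g (a *\<^sub>R z + b *\<^sub>R w) \<partial>lborel)"
      by (rule nn_integral_gaussian) measurable
    also have "\<dots> = ?c * (\<integral>\<^sup>+ y. ennreal (gauss_density (- (1 / b) *\<^sub>R (a *\<^sub>R z) + (1 / b) *\<^sub>R y))
        * g (a *\<^sub>R z + b *\<^sub>R (- (1 / b) *\<^sub>R (a *\<^sub>R z) + (1 / b) *\<^sub>R y)) \<partial>lborel)"
      using b by (intro nn_integral_lborel_affine) auto
    also have "\<dots> = ?c * (\<integral>\<^sup>+ y. ennreal (gauss_density ((y - a *\<^sub>R z) /\<^sub>R b)) * g y \<partial>lborel)"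
      using b by (intro arg_cong2[where f = "(*)"] refl nn_integral_cong)
        (auto simp: algebra_simps divide_inverse intro!: arg_cong2[where f = "\<lambda>u v. ennreal (gauss_density u) * g v"])
    finally show ?thesis .
  qed
  have one: "?c * (\<integral>\<^sup>+ z. ennreal (gauss_density ((z - a *\<^sub>R y) /\<^sub>R b)) \<partial>lborel) = 1" for y :: 'a
  proof -
    have "1 = (\<integral>\<^sup>+ w. ennreal (gauss_density (w::'a)) \<partial>lborel)" by (simp add: nn_integral_gauss_density)
    also have "\<dots> = ?c * (\<integral>\<^sup>+ z. ennreal (gauss_density (- (1 / b) *\<^sub>R (a *\<^sub>R y) + (1 / b) *\<^sub>R z)) \<partial>lborel)"
      using b by (intro nn_integral_lborel_affine) auto
    also have "\<dots> = ?c * (\<integral>\<^sup>+ z. ennreal (gauss_density ((z - a *\<^sub>R y) /\<^sub>R b)) \<partial>lborel)"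
      using b by (intro arg_cong2[where f = "(*)"] refl nn_integral_cong)
        (auto simp: algebra_simps divide_inverse intro!: arg_cong[where f = "\<lambda>u. ennreal (gauss_density u)"])
    finally show ?thesis by simp
  qed
  have "(\<integral>\<^sup>+ z. (\<integral>\<^sup>+ w. g (a *\<^sub>R z + b *\<^sub>R w) \<partial>gaussian) \<partial>gaussian)
     = (\<integral>\<^sup>+ z. ennreal (gauss_density z) * (?c * (\<integral>\<^sup>+ y. ennreal (gauss_density ((y - a *\<^sub>R z) /\<^sub>R b)) * g y \<partial>lborel)) \<partial>lborel)"
    unfolding inner by (rule nn_integral_gaussian) measurable
  also have "\<dots> = (\<integral>\<^sup>+ z. (\<integral>\<^sup>+ y. ?c * (ennreal (gauss_density z * gauss_density ((y - a *\<^sub>R z) /\<^sub>R b)) * g y) \<partial>lborel) \<partial>lborel)"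
    by (intro nn_integral_cong) (simp add: nn_integral_cmult[symmetric] ennreal_gauss_mult mult_ac)
  also have "\<dots> = (\<integral>\<^sup>+ y. (\<integral>\<^sup>+ z. ?c * (ennreal (gauss_density z * gauss_density ((y - a *\<^sub>R z) /\<^sub>R b)) * g y) \<partial>lborel) \<partial>lborel)"
    by (rule lborel_pair.Fubini') measurable
  also have "\<dots> = (\<integral>\<^sup>+ y. ennreal (gauss_density y) * g y * (?c * (\<integral>\<^sup>+ z. ennreal (gauss_density ((z - a *\<^sub>R y) /\<^sub>R b)) \<partial>lborel)) \<partial>lborel)"
    unfolding gauss_density_rotation[OF ab b]
    by (intro nn_integral_cong) (simp add: nn_integral_cmult[symmetric] ennreal_gauss_mult mult_ac)
  also have "\<dots> = (\<integral>\<^sup>+ y. g y \<partial>gaussian)"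
    unfolding one by (subst nn_integral_gaussian) simp_all
  finally show ?thesis .
qed

lemma distr_gaussian_convolution:
  assumes ab: "a\<^sup>2 + b\<^sup>2 = 1" and b: "b > 0"
  shows "distr (gaussian \<Otimes>\<^sub>M gaussian) borel (\<lambda>(z, w). a *\<^sub>R z + b *\<^sub>R w) = (gaussian :: 'a::euclidean_space measure)"
proof (rule measure_eqI)
  fix A :: "'a set" assume A: "A \<in> sets (distr (gaussian \<Otimes>\<^sub>M gaussian) borel (\<lambda>(z, w). a *\<^sub>R z + b *\<^sub>R w))"
  then have [measurable]: "A \<in> sets borel" by simp
  have "emeasure (distr (gaussian \<Otimes>\<^sub>M gaussian) borel (\<lambda>(z, w). a *\<^sub>R z + b *\<^sub>R w)) A
      = (\<integral>\<^sup>+ y. indicator A y \<partial>distr (gaussian \<Otimes>\<^sub>M gaussian) borel (\<lambda>(z, w). a *\<^sub>R z + b *\<^sub>R w))"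
    by simp
  also have "\<dots> = (\<integral>\<^sup>+ x. indicator A (case x of (z, w) \<Rightarrow> a *\<^sub>R z + b *\<^sub>R w) \<partial>(gaussian \<Otimes>\<^sub>M gaussian))"
    by (rule nn_integral_distr) measurable
  also have "\<dots> = (\<integral>\<^sup>+ z. (\<integral>\<^sup>+ w. indicator A (a *\<^sub>R z + b *\<^sub>R w) \<partial>gaussian) \<partial>gaussian)"
    by (subst gaussian.nn_integral_fst[symmetric]) (auto simp: case_prod_beta)
  also have "\<dots> = emeasure gaussian A"
    by (subst nn_integral_gaussian_convolution[OF ab b]) simp_all
  finally show "emeasure (distr (gaussian \<Otimes>\<^sub>M gaussian) borel (\<lambda>(z, w). a *\<^sub>R z + b *\<^sub>R w)) A = emeasure gaussian A" .
qed simp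

lemma integral_gaussian_convolution:
  fixes F :: "'a::euclidean_space \<Rightarrow> 'b::euclidean_space"
  assumes c: "c\<^sup>2 = a\<^sup>2 + b\<^sup>2" and b: "b > 0" and c0: "c > 0"
    and [measurable]: "F \<in> borel_measurable borel" and bd: "\<And>x. norm (F x) \<le> B"
  shows "(\<integral> z. (\<integral> w. F (x + a *\<^sub>R z + b *\<^sub>R w) \<partial>gaussian) \<partial>gaussian) = (\<integral> y. F (x + c *\<^sub>R y) \<partial>gaussian)"
proof -
  interpret P: pair_prob_space "gaussian :: 'a measure" "gaussian :: 'a measure" ..
  have ab: "(a / c)\<^sup>2 + (b / c)\<^sup>2 = 1"
  proof -
    have "(a / c)\<^sup>2 + (b / c)\<^sup>2 = (a\<^sup>2 + b\<^sup>2) / c\<^sup>2" by (simp add: power_divide add_divide_distrib)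
    then show ?thesis unfolding c[symmetric] using c0 by simp
  qed
  have bc: "b / c > 0" using b c0 by simp
  have "(\<integral> y. F (x + c *\<^sub>R y) \<partial>gaussian)
      = (\<integral> y. F (x + c *\<^sub>R y) \<partial>distr (gaussian \<Otimes>\<^sub>M gaussian) borel (\<lambda>(z, w). (a / c) *\<^sub>R z + (b / c) *\<^sub>R w))"
    unfolding distr_gaussian_convolution[OF ab bc] ..
  also have "\<dots> = (\<integral> u. F (x + c *\<^sub>R (case u of (z, w) \<Rightarrow> (a / c) *\<^sub>R z + (b / c) *\<^sub>R w)) \<partial>(gaussian \<Otimes>\<^sub>M gaussian))"
    by (rule integral_distr) measurable
  also have "\<dots> = (\<integral> (z, w). F (x + a *\<^sub>R z + b *\<^sub>R w) \<partial>(gaussian \<Otimes>\<^sub>M gaussian))"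
    using c0 by (intro Bochner_Integration.integral_cong) (auto simp: algebra_simps)
  also have "\<dots> = (\<integral> z. (\<integral> w. F (x + a *\<^sub>R z + b *\<^sub>R w) \<partial>gaussian) \<partial>gaussian)"
  proof -
    have "integrable (gaussian \<Otimes>\<^sub>M gaussian) (\<lambda>(z, w). F (x + a *\<^sub>R z + b *\<^sub>R w))"
      by (rule P.integrable_const_bound[of _ B]) (auto simp: bd)
    from P.integral_fst'[OF this] show ?thesis by simp
  qed
  finally show ?thesis by simp
qed

lemma integrable_gaussian_bounded:
  fixes F :: "'a::euclidean_space \<Rightarrow> 'b::euclidean_space"
  assumes "F \<in> borel_measurable borel" "\<And>x. norm (F x) \<le> B"
  shows "integrable gaussian F"
  using assms by (intro gaussian.integrable_const_bound[of _ B]) auto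

section \<open>Moments of the Gaussian measure\<close>

lemma gauss_density_shift:
  fixes g z :: "'a::euclidean_space"
  shows "gauss_density z * exp (g \<bullet> z) = exp ((norm g)\<^sup>2 / 2) * gauss_density (z - g)"
proof -
  have "- (norm z)\<^sup>2 / 2 + g \<bullet> z = (norm g)\<^sup>2 / 2 + (- (norm (z - g))\<^sup>2 / 2)"
    unfolding power2_norm_eq_inner by (simp add: inner_diff inner_commute field_simps)
  then show ?thesis
    unfolding gauss_density_def by (simp add: mult_ac flip: exp_add)
qed

lemma has_bochner_integral_gaussian_mgf:
  fixes g :: "'a::euclidean_space"
  shows "has_bochner_integral gaussian (\<lambda>z. exp (g \<bullet> z)) (exp ((norm g)\<^sup>2 / 2))"
proof (rule has_bochner_integral_nn_integral)
  have "(\<integral>\<^sup>+ z. ennreal (exp (g \<bullet> z)) \<partial>gaussian) = (\<integral>\<^sup>+ z. ennreal (exp ((norm g)\<^sup>2 / 2)) * ennreal (gauss_density (- g + 1 *\<^sub>R z)) \<partial>lborel)"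
  proof (subst nn_integral_gaussian, simp, rule nn_integral_cong)
    fix z :: 'a
    show "ennreal (gauss_density z) * ennreal (exp (g \<bullet> z)) = ennreal (exp ((norm g)\<^sup>2 / 2)) * ennreal (gauss_density (- g + 1 *\<^sub>R z))"
      unfolding ennreal_gauss_mult[symmetric] gauss_density_shift by (simp add: ennreal_mult')
  qed
  also have "\<dots> = ennreal (exp ((norm g)\<^sup>2 / 2)) * (\<integral>\<^sup>+ z. ennreal (gauss_density (- g + 1 *\<^sub>R z)) \<partial>lborel)"
    by (rule nn_integral_cmult) measurable
  also have "(\<integral>\<^sup>+ z. ennreal (gauss_density (- g + 1 *\<^sub>R z)) \<partial>lborel) = 1"
    using nn_integral_lborel_affine[of "\<lambda>z. ennreal (gauss_density z)" 1 "- g"] nn_integral_gauss_density[where 'a = 'a] by simp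
  finally show "(\<integral>\<^sup>+ z. ennreal (exp (g \<bullet> z)) \<partial>gaussian) = ennreal (exp ((norm g)\<^sup>2 / 2))" by simp
qed auto

lemma integrable_gaussian_exp: "integrable gaussian (\<lambda>z. exp (g \<bullet> z))"
  using has_bochner_integral_gaussian_mgf by (auto simp: has_bochner_integral_iff)

text \<open>The squared norm is at most the dimension times the square of the largest coordinate,
  hence a multiple of the exponential of its modulus. Its \<open>n\<close>-th power is dominated by
  one summand of \<open>E\<close>, a sum of exponentials of linear forms, which are
  integrable.\<close>

lemma integrable_gaussian_moment: "integrable gaussian (\<lambda>z::'a::euclidean_space. (1 + (norm z)\<^sup>2) ^ n)"
proof -
  define E where "E z = (\<Sum>b\<in>Basis. exp (real (2 * n) *\<^sub>R b \<bullet> z) + exp (- real (2 * n) *\<^sub>R b \<bullet> z))" for z :: 'a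
  have E: "integrable gaussian E"
    unfolding E_def
    by (intro Bochner_Integration.integrable_sum Bochner_Integration.integrable_add integrable_gaussian_exp)
  define d where "d = real DIM('a)"
  have d1: "d \<ge> 1" unfolding d_def using DIM_positive[where 'a = 'a] by linarith
  show ?thesis
  proof (rule Bochner_Integration.integrable_bound)
    show "integrable gaussian (\<lambda>z. (1 + d * 2) ^ n * E z)" using E by (rule integrable_mult_right)
    show "AE z in gaussian. norm ((1 + (norm (z::'a))\<^sup>2) ^ n) \<le> norm ((1 + d * 2) ^ n * E z)"
    proof (rule AE_I2)
      fix z :: 'a
      obtain b where b: "b \<in> Basis" "\<And>c. c \<in> Basis \<Longrightarrow> \<bar>c \<bullet> z\<bar> \<le> \<bar>b \<bullet> z\<bar>"
      proof -
        let ?S = "(\<lambda>c. \<bar>c \<bullet> z\<bar>) ` Basis"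
        have "Max ?S \<in> ?S" by (rule Max_in) auto
        then obtain b where b: "b \<in> Basis" "Max ?S = \<bar>b \<bullet> z\<bar>" by (elim imageE)
        show ?thesis
        proof (rule that[OF b(1)])
          fix c :: 'a assume "c \<in> Basis"
          then show "\<bar>c \<bullet> z\<bar> \<le> \<bar>b \<bullet> z\<bar>" unfolding b(2)[symmetric] by (intro Max_ge) auto
        qed
      qed
      let ?m = "\<bar>b \<bullet> z\<bar>"
      have "(norm z)\<^sup>2 = (\<Sum>c\<in>Basis. (c \<bullet> z)\<^sup>2)"
        unfolding power2_norm_eq_inner by (subst euclidean_inner) (simp add: power2_eq_square inner_commute)
      also have "\<dots> \<le> (\<Sum>c\<in>(Basis::'a set). ?m\<^sup>2)"
        by (intro sum_mono) (use b(2) in \<open>metis abs_ge_zero power2_abs power_mono\<close>)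
      also have "\<dots> = d * ?m\<^sup>2" by (simp add: d_def)
      also have "?m\<^sup>2 \<le> 2 * exp ?m"
        using exp_lower_Taylor_quadratic[of ?m] by simp
      then have "d * ?m\<^sup>2 \<le> d * (2 * exp ?m)" using d1 by (intro mult_left_mono) auto
      finally have "1 + (norm z)\<^sup>2 \<le> 1 + d * (2 * exp ?m)" by simp
      also have "\<dots> \<le> exp ?m + d * (2 * exp ?m)" by simp
      finally have "1 + (norm z)\<^sup>2 \<le> (1 + d * 2) * exp ?m" by (simp add: algebra_simps)
      then have "(1 + (norm z)\<^sup>2) ^ n \<le> ((1 + d * 2) * exp ?m) ^ n"
        by (intro power_mono) auto
      also have "\<dots> = (1 + d * 2) ^ n * exp (real n * ?m)"
        by (simp add: power_mult_distrib exp_of_nat_mult)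
      also have "exp (real n * ?m) \<le> exp (real (2 * n) *\<^sub>R b \<bullet> z) + exp (- real (2 * n) *\<^sub>R b \<bullet> z)"
      proof (cases "b \<bullet> z \<ge> 0")
        case True
        have "real n * ?m \<le> real (2 * n) *\<^sub>R b \<bullet> z" using True by (auto intro!: mult_right_mono)
        then show ?thesis by (intro add_increasing2) auto
      next
        case False
        have "real n * ?m \<le> - real (2 * n) *\<^sub>R b \<bullet> z" using False by (auto simp: mult_le_0_iff)
        then show ?thesis by (intro add_increasing) auto
      qed
      also have "\<dots> \<le> E z"
        unfolding E_def using b(1) by (intro member_le_sum) (auto intro: add_nonneg_nonneg)
      finally have "(1 + (norm z)\<^sup>2) ^ n \<le> (1 + d * 2) ^ n * E z" using d1 by (auto simp: mult_left_mono)
      then show "norm ((1 + (norm z)\<^sup>2) ^ n) \<le> norm ((1 + d * 2) ^ n * E z)" by simp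
    qed
  qed measurable
qed

lemma le_one_plus_sq: "t \<le> 1 + t * t" for t :: real
  using zero_le_power2[of "t - 1 / 2"] by (simp add: power2_eq_square algebra_simps)

lemma integrable_gaussian_norm: "integrable gaussian (\<lambda>z::'a::euclidean_space. z)"
  by (rule Bochner_Integration.integrable_bound[OF integrable_gaussian_moment[of 1]])
     (auto intro!: AE_I2 simp: power2_eq_square le_one_plus_sq)

lemma integral_gaussian_uminus:
  fixes F :: "'a::euclidean_space \<Rightarrow> 'b::euclidean_space"
  assumes [measurable]: "F \<in> borel_measurable borel"
  shows "(\<integral> z. F (- z) \<partial>gaussian) = (\<integral> z. F z \<partial>gaussian)"
proof -
  have "distr gaussian borel uminus = (gaussian :: 'a measure)"
  proof (rule measure_eqI)
    fix A :: "'a set" assume "A \<in> sets (distr gaussian borel uminus)"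
    then have [measurable]: "A \<in> sets borel" by simp
    have "emeasure (distr gaussian borel uminus) A = (\<integral>\<^sup>+ z. indicator A z \<partial>distr gaussian borel uminus)"
      by simp
    also have "\<dots> = (\<integral>\<^sup>+ z. indicator A (- z) \<partial>gaussian)"
      by (rule nn_integral_distr) measurable
    also have "\<dots> = (\<integral>\<^sup>+ z. ennreal (gauss_density (0 + (- 1) *\<^sub>R z)) * indicator A (0 + (- 1) *\<^sub>R z) \<partial>lborel)"
      by (subst nn_integral_gaussian) (auto simp: gauss_density_def)
    also have "\<dots> = (\<integral>\<^sup>+ z. ennreal (gauss_density z) * indicator A z \<partial>lborel)"
      using nn_integral_lborel_affine[of "\<lambda>z. ennreal (gauss_density z) * indicator A z" "- 1" 0] by simp
    also have "\<dots> = emeasure gaussian A"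
      by (subst nn_integral_gaussian[symmetric]) simp_all
    finally show "emeasure (distr gaussian borel uminus) A = emeasure gaussian A" .
  qed simp
  then have "(\<integral> z. F z \<partial>gaussian) = (\<integral> z. F z \<partial>distr gaussian borel uminus)" by simp
  also have "\<dots> = (\<integral> z. F (- z) \<partial>gaussian)" by (rule integral_distr) measurable
  finally show ?thesis by simp
qed

lemma integral_gaussian_id: "(\<integral> z. z \<partial>gaussian) = (0::'a::euclidean_space)"
proof -
  have "(\<integral> z. - z \<partial>gaussian) = (\<integral> z. z \<partial>(gaussian :: 'a measure))"
    using integral_gaussian_uminus[of "\<lambda>z::'a. z"] by simp
  then have e: "- (\<integral> z. z \<partial>gaussian) = (\<integral> z. z \<partial>(gaussian :: 'a measure))"
    using integrable_gaussian_norm[where 'a = 'a] by simp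
  have "2 *\<^sub>R (\<integral> z. z \<partial>(gaussian :: 'a measure)) = 0"
    unfolding scaleR_2 using add.right_inverse[of "\<integral> z. z \<partial>(gaussian :: 'a measure)"] unfolding e .
  then show ?thesis by simp
qed

lemma integrable_gaussian_inner_sq: "integrable gaussian (\<lambda>z::'a::euclidean_space. (g \<bullet> z)\<^sup>2)"
proof (rule Bochner_Integration.integrable_bound)
  show "integrable gaussian (\<lambda>z::'a. (norm g)\<^sup>2 * (1 + (norm z)\<^sup>2) ^ 1)"
    by (intro integrable_mult_right integrable_gaussian_moment)
  show "AE z in gaussian. norm ((g \<bullet> z)\<^sup>2) \<le> norm ((norm g)\<^sup>2 * (1 + (norm (z::'a))\<^sup>2) ^ 1)"
  proof (rule AE_I2)
    fix z :: 'a
    have "(g \<bullet> z)\<^sup>2 \<le> (norm g * norm z)\<^sup>2"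
      using Cauchy_Schwarz_ineq2[of g z] by (metis abs_ge_zero power2_abs power_mono)
    then show "norm ((g \<bullet> z)\<^sup>2) \<le> norm ((norm g)\<^sup>2 * (1 + (norm z)\<^sup>2) ^ 1)"
      by (simp add: power_mult_distrib distrib_left add_increasing)
  qed
qed measurable

text \<open>The second moment is read off from exponential moments: with
  \<open>t = l * (g \<bullet> z)\<close>, the inequality
  \<open>t\<^sup>2 \<le> exp t + exp (- t) - 2\<close> is integrated, divided by
  \<open>l\<^sup>2\<close>, and \<open>l\<close> tends to 0.\<close>

lemma gaussian_inner_sq_le: "(\<integral> z. (g \<bullet> z)\<^sup>2 \<partial>gaussian) \<le> (norm (g::'a::euclidean_space))\<^sup>2"
proof -
  let ?I = "\<integral> z. (g \<bullet> z)\<^sup>2 \<partial>gaussian"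
  let ?a = "(norm g)\<^sup>2"
  have b: "?I \<le> 2 * (exp (l\<^sup>2 * ?a / 2) - 1) / l\<^sup>2" if l: "l > 0" for l :: real
  proof -
    have mgf: "has_bochner_integral gaussian (\<lambda>z. exp (c *\<^sub>R g \<bullet> z)) (exp ((norm (c *\<^sub>R g))\<^sup>2 / 2))" for c
      by (rule has_bochner_integral_gaussian_mgf)
    have h: "has_bochner_integral gaussian (\<lambda>z. exp (l *\<^sub>R g \<bullet> z) + exp ((- l) *\<^sub>R g \<bullet> z) - 2)
       (exp ((norm (l *\<^sub>R g))\<^sup>2 / 2) + exp ((norm ((- l) *\<^sub>R g))\<^sup>2 / 2) - 2)"
      by (intro has_bochner_integral_diff has_bochner_integral_add mgf)
         (use gaussian.prob_space in \<open>auto simp: has_bochner_integral_iff\<close>)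
    have "(\<integral> z. l\<^sup>2 * (g \<bullet> z)\<^sup>2 \<partial>gaussian) \<le> (\<integral> z. exp (l *\<^sub>R g \<bullet> z) + exp ((- l) *\<^sub>R g \<bullet> z) - 2 \<partial>gaussian)"
    proof (rule integral_mono)
      show "integrable gaussian (\<lambda>z. l\<^sup>2 * (g \<bullet> z)\<^sup>2)" by (intro integrable_mult_right integrable_gaussian_inner_sq)
      show "integrable gaussian (\<lambda>z. exp (l *\<^sub>R g \<bullet> z) + exp ((- l) *\<^sub>R g \<bullet> z) - 2)"
        using h by (auto simp: has_bochner_integral_iff)
      fix z :: 'a
      define t where "t = l * (g \<bullet> z)"
      have "t\<^sup>2 \<le> exp t + exp (- t) - 2"
      proof -
        \<comment> \<open>Stopping after an odd order leaves a remainder of even order, which is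
          nonnegative; the odd terms cancel between \<open>t\<close> and \<open>- t\<close>.\<close>
        have e: "1 + s + s\<^sup>2 / 2 + s ^ 3 / 6 \<le> exp s" for s :: real
        proof -
          obtain u where "exp s = (\<Sum>m<4. s ^ m / fact m) + exp u / fact 4 * s ^ 4"
            using Maclaurin_exp_le[of s 4] by blast
          moreover have "0 \<le> exp u / fact 4 * s ^ 4" by simp
          ultimately show ?thesis by (simp add: eval_nat_numeral)
        qed
        show ?thesis using e[of t] e[of "- t"] by simp
      qed
      then show "l\<^sup>2 * (g \<bullet> z)\<^sup>2 \<le> exp (l *\<^sub>R g \<bullet> z) + exp ((- l) *\<^sub>R g \<bullet> z) - 2"
        by (simp add: t_def power_mult_distrib)
    qed
    also have "\<dots> = 2 * (exp (l\<^sup>2 * ?a / 2) - 1)"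
      using has_bochner_integral_integral_eq[OF h] by (simp add: power_mult_distrib)
    finally have "l\<^sup>2 * ?I \<le> 2 * (exp (l\<^sup>2 * ?a / 2) - 1)" by simp
    then show ?thesis using l by (simp add: field_simps)
  qed
  have "((\<lambda>l. 2 * (exp (l\<^sup>2 * ?a / 2) - 1) / l\<^sup>2) \<longlongrightarrow> ?a) (at_right 0)"
    by real_asymp
  then show ?thesis
    by (rule tendsto_lowerbound[OF _ eventually_mono[OF eventually_at_right_less[of 0] b]]) (assumption, rule trivial_limit_at_right_real)
qed

section \<open>Averages of functions with Lipschitz gradient\<close>

lemma gaussian_prob_UNIV: "measure (gaussian :: 'a::euclidean_space measure) UNIV = 1"
  using gaussian.prob_space[where 'a = 'a] by simp

text \<open>The heat flow with time measured by the standard deviation \<open>r\<close>.\<close>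

definition gauss_avg :: "real \<Rightarrow> ('a::euclidean_space \<Rightarrow> 'b::euclidean_space) \<Rightarrow> 'a \<Rightarrow> 'b" where
  "gauss_avg r F x = (\<integral> z. F (x + r *\<^sub>R z) \<partial>gaussian)"

text \<open>\<open>G\<close> is the gradient of \<open>F\<close>. Stated by inequalities between values, the class is invariant under
  averaging over translations without any differentiation under the integral.\<close>
definition C11_pair :: "real \<Rightarrow> real \<Rightarrow> real \<Rightarrow> real \<Rightarrow> ('a::euclidean_space \<Rightarrow> real) \<Rightarrow> ('a \<Rightarrow> 'a) \<Rightarrow> bool" where
  "C11_pair e B L K F G \<longleftrightarrow> (\<forall>x. e \<le> F x \<and> F x \<le> B) \<and> (\<forall>x. norm (G x) \<le> L) \<and>
     (\<forall>x y. norm (G y - G x) \<le> K * norm (y - x)) \<and>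
     (\<forall>x y. \<bar>F y - F x - G x \<bullet> (y - x)\<bar> \<le> K * (norm (y - x))\<^sup>2)"

lemma gaussian_integral_norm_le:
  fixes F :: "'a::euclidean_space \<Rightarrow> 'b::euclidean_space"
  assumes F: "F \<in> borel_measurable borel" and b: "\<And>x. norm (F x) \<le> B"
  shows "norm (\<integral> z. F z \<partial>gaussian) \<le> B"
proof -
  have "norm (\<integral> z. F z \<partial>gaussian) \<le> (\<integral> z. norm (F z) \<partial>gaussian)" by (rule integral_norm_bound)
  also have "\<dots> \<le> B"
    by (rule gaussian.integral_le_const[OF integrable_norm[OF integrable_gaussian_bounded[OF F b]]]) (simp add: b)
  finally show ?thesis .
qed

lemma C11_pair_continuous:
  assumes "C11_pair e B L K F G"
  shows "continuous_on UNIV F" "continuous_on UNIV G"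
proof -
  have G: "norm (G y - G x) \<le> K * norm (y - x)" and L: "norm (G x) \<le> L"
    and F: "\<bar>F y - F x - G x \<bullet> (y - x)\<bar> \<le> K * (norm (y - x))\<^sup>2" for x y
    using assms unfolding C11_pair_def by blast+
  show "continuous_on UNIV G"
  proof (rule continuous_at_imp_continuous_on, rule ballI, unfold isCont_def, rule LIM_zero_cancel, rule Lim_null_comparison)
    fix x
    show "\<forall>\<^sub>F y in at x. norm (G y - G x) \<le> K * norm (y - x)" using G by simp
    show "((\<lambda>y. K * norm (y - x)) \<longlongrightarrow> 0) (at x)" by (auto intro!: tendsto_eq_intros)
  qed
  show "continuous_on UNIV F"
  proof (rule continuous_at_imp_continuous_on, rule ballI, unfold isCont_def, rule LIM_zero_cancel, rule Lim_null_comparison)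
    fix x
    have "norm (F y - F x) \<le> L * norm (y - x) + K * (norm (y - x))\<^sup>2" for y
    proof -
      have "\<bar>G x \<bullet> (y - x)\<bar> \<le> L * norm (y - x)"
        using Cauchy_Schwarz_ineq2[of "G x" "y - x"] mult_right_mono[OF L[of x], of "norm (y - x)"] by simp
      then show ?thesis using F[of y x] by simp
    qed
    then show "\<forall>\<^sub>F y in at x. norm (F y - F x) \<le> L * norm (y - x) + K * (norm (y - x))\<^sup>2" by simp
    show "((\<lambda>y. L * norm (y - x) + K * (norm (y - x))\<^sup>2) \<longlongrightarrow> 0) (at x)" by (auto intro!: tendsto_eq_intros)
  qed
qed

lemma C11_pair_measurable:
  assumes "C11_pair e B L K F G"
  shows "F \<in> borel_measurable borel" "G \<in> borel_measurable borel"
  using C11_pair_continuous[OF assms] by (auto intro: borel_measurable_continuous_onI)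

lemma integrable_gauss_avg:
  fixes F :: "'a::euclidean_space \<Rightarrow> 'b::euclidean_space"
  assumes [measurable]: "F \<in> borel_measurable borel" and "\<And>x. norm (F x) \<le> B"
  shows "integrable gaussian (\<lambda>z. F (x + r *\<^sub>R z))"
  using assms(2) by (intro integrable_gaussian_bounded[of _ B]) auto

lemma C11_pair_integrable:
  assumes "C11_pair e B L K F G"
  shows "integrable gaussian (\<lambda>z. F (x + r *\<^sub>R z))" "integrable gaussian (\<lambda>z. G (x + r *\<^sub>R z))"
proof -
  have b: "norm (F x) \<le> max \<bar>e\<bar> \<bar>B\<bar>" "norm (G x) \<le> L" for x
    using assms unfolding C11_pair_def by (auto simp: abs_le_iff le_max_iff_disj; smt (verit))+
  show "integrable gaussian (\<lambda>z. F (x + r *\<^sub>R z))" "integrable gaussian (\<lambda>z. G (x + r *\<^sub>R z))"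
    using integrable_gauss_avg[OF C11_pair_measurable(1)[OF assms] b(1)]
      integrable_gauss_avg[OF C11_pair_measurable(2)[OF assms] b(2)] .
qed

lemma C11_pair_gauss_avg:
  assumes A: "C11_pair e B L K F G"
  shows "C11_pair e B L K (gauss_avg r F) (gauss_avg r G)"
proof -
  note [measurable] = C11_pair_measurable[OF A]
  note I = C11_pair_integrable[OF A]
  have b: "e \<le> F x" "F x \<le> B" "norm (G x) \<le> L" "norm (G y - G x) \<le> K * norm (y - x)"
    "\<bar>F y - F x - G x \<bullet> (y - x)\<bar> \<le> K * (norm (y - x))\<^sup>2" for x y
    using A unfolding C11_pair_def by blast+
  show ?thesis
    unfolding C11_pair_def
  proof (intro conjI allI)
    fix x y :: 'a
    show "e \<le> gauss_avg r F x" "gauss_avg r F x \<le> B"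
      unfolding gauss_avg_def using I b by (auto intro!: gaussian.integral_ge_const gaussian.integral_le_const)
    show "norm (gauss_avg r G x) \<le> L"
      unfolding gauss_avg_def by (rule gaussian_integral_norm_le) (use b in auto)
    have "gauss_avg r G y - gauss_avg r G x = (\<integral> z. G (y + r *\<^sub>R z) - G (x + r *\<^sub>R z) \<partial>gaussian)"
      unfolding gauss_avg_def by (rule Bochner_Integration.integral_diff[symmetric]) (rule I)+
    also have "norm \<dots> \<le> K * norm (y - x)"
    proof (rule gaussian_integral_norm_le)
      fix z show "norm (G (y + r *\<^sub>R z) - G (x + r *\<^sub>R z)) \<le> K * norm (y - x)"
        using b(4)[of "y + r *\<^sub>R z" "x + r *\<^sub>R z"] by simp
    qed measurable
    finally show "norm (gauss_avg r G y - gauss_avg r G x) \<le> K * norm (y - x)" .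
    have "gauss_avg r F y - gauss_avg r F x - gauss_avg r G x \<bullet> (y - x)
      = (\<integral> z. F (y + r *\<^sub>R z) - F (x + r *\<^sub>R z) - G (x + r *\<^sub>R z) \<bullet> (y - x) \<partial>gaussian)"
      unfolding gauss_avg_def using I by simp
    also have "norm \<dots> \<le> K * (norm (y - x))\<^sup>2"
    proof (rule gaussian_integral_norm_le)
      fix z show "norm (F (y + r *\<^sub>R z) - F (x + r *\<^sub>R z) - G (x + r *\<^sub>R z) \<bullet> (y - x)) \<le> K * (norm (y - x))\<^sup>2"
        using b(5)[of "y + r *\<^sub>R z" "x + r *\<^sub>R z"] by simp
    qed measurable
    finally show "\<bar>gauss_avg r F y - gauss_avg r F x - gauss_avg r G x \<bullet> (y - x)\<bar> \<le> K * (norm (y - x))\<^sup>2"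
      by simp
  qed
qed

text \<open>Three errors of order \<open>b\<^sup>2\<close> add up: the Taylor remainder at
  \<open>x\<close>; the shift of \<open>F\<close> by averaging, whose linear part integrates to 0;
  and the change of the gradient by averaging, which is of order \<open>b\<close> and enters
  multiplied by \<open>b\<close>. The moment \<open>m\<close> has the third power because the flow
  estimate cubes this error.\<close>

lemma gauss_avg_expansion:
  assumes A: "C11_pair e B L K F (G :: 'a::euclidean_space \<Rightarrow> 'a)" and K: "K \<ge> 0" and b: "b \<ge> 0"
  defines "m \<equiv> \<integral> w. (1 + (norm (w::'a))\<^sup>2) ^ 3 \<partial>gaussian"
  shows "\<bar>F (x + b *\<^sub>R z) - gauss_avg b F x - b * (gauss_avg b G x \<bullet> z)\<bar> \<le> 2 * K * m * b\<^sup>2 * (1 + (norm z)\<^sup>2)"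
    and "m \<ge> 1"
proof -
  note [measurable] = C11_pair_measurable[OF A]
  note I = C11_pair_integrable[OF A]
  have bd: "norm (G y - G x) \<le> K * norm (y - x)"
    "\<bar>F y - F x - G x \<bullet> (y - x)\<bar> \<le> K * (norm (y - x))\<^sup>2" for x y
    using A unfolding C11_pair_def by blast+
  have Im: "integrable gaussian (\<lambda>w::'a. (1 + (norm w)\<^sup>2) ^ 3)" by (rule integrable_gaussian_moment)
  have w3: "(norm w)\<^sup>2 \<le> (1 + (norm w)\<^sup>2) ^ 3" "norm w \<le> (1 + (norm w)\<^sup>2) ^ 3" "1 \<le> (1 + (norm w)\<^sup>2) ^ 3" for w :: 'a
  proof -
    have "(1 + (norm w)\<^sup>2) ^ 1 \<le> (1 + (norm w)\<^sup>2) ^ 3" by (rule power_increasing) auto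
    then show "(norm w)\<^sup>2 \<le> (1 + (norm w)\<^sup>2) ^ 3" "norm w \<le> (1 + (norm w)\<^sup>2) ^ 3" "1 \<le> (1 + (norm w)\<^sup>2) ^ 3"
      using le_one_plus_sq[of "norm w"] zero_le_power2[of "norm w"] unfolding power2_eq_square power_one_right by linarith+
  qed
  have I2: "integrable gaussian (\<lambda>w::'a. (norm w)\<^sup>2)" and I1: "integrable gaussian (\<lambda>w::'a. norm w)"
    using w3 by (auto intro!: Bochner_Integration.integrable_bound[OF Im] AE_I2)
  have m2: "(\<integral> w. (norm (w::'a))\<^sup>2 \<partial>gaussian) \<le> m" and m1: "(\<integral> w. norm (w::'a) \<partial>gaussian) \<le> m"
    unfolding m_def by (rule integral_mono[OF I2 Im w3(1)], rule integral_mono[OF I1 Im w3(2)])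
  show m: "m \<ge> 1"
    unfolding m_def by (rule gaussian.integral_ge_const[OF Im]) (simp add: w3)
  have t1: "\<bar>F (x + b *\<^sub>R w) - F x - b * (G x \<bullet> w)\<bar> \<le> K * b\<^sup>2 * (norm w)\<^sup>2" for w
    using bd(2)[of "x + b *\<^sub>R w" x] b by (simp add: power_mult_distrib mult.assoc)
  have IG: "integrable gaussian (\<lambda>w. b * (G x \<bullet> w))"
    using integrable_gaussian_norm[where 'a='a] by simp
  have "(\<integral> w. b * (G x \<bullet> w) \<partial>gaussian) = 0"
    using integrable_gaussian_norm[where 'a='a] integral_gaussian_id[where 'a='a] by simp
  then have "gauss_avg b F x - F x = (\<integral> w. F (x + b *\<^sub>R w) - F x - b * (G x \<bullet> w) \<partial>gaussian)"
    unfolding gauss_avg_def using I(1)[of x b] IG by (auto simp: gaussian_prob_UNIV)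
  then have "\<bar>gauss_avg b F x - F x\<bar> \<le> (\<integral> w. \<bar>F (x + b *\<^sub>R w) - F x - b * (G x \<bullet> w)\<bar> \<partial>gaussian)"
    using integral_abs_bound by metis
  also have "\<dots> \<le> (\<integral> w. K * b\<^sup>2 * (norm (w::'a))\<^sup>2 \<partial>gaussian)"
    by (rule integral_mono) (use I(1)[of x b] IG I2 t1 in auto)
  also have "\<dots> \<le> K * b\<^sup>2 * m"
    using m2 K by (simp add: mult_left_mono)
  finally have s1: "\<bar>gauss_avg b F x - F x\<bar> \<le> K * b\<^sup>2 * m" .
  have "gauss_avg b G x - G x = (\<integral> w. G (x + b *\<^sub>R w) - G x \<partial>gaussian)"
    unfolding gauss_avg_def using I(2)[of x b] by (simp add: gaussian_prob_UNIV)
  then have "norm (gauss_avg b G x - G x) \<le> (\<integral> w. norm (G (x + b *\<^sub>R w) - G x) \<partial>gaussian)"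
    using integral_norm_bound by metis
  also have "\<dots> \<le> (\<integral> w. K * b * norm (w::'a) \<partial>gaussian)"
  proof (rule integral_mono)
    fix w :: 'a show "norm (G (x + b *\<^sub>R w) - G x) \<le> K * b * norm w"
      using bd(1)[of "x + b *\<^sub>R w" x] b by (simp add: mult.assoc)
  qed (use I(2)[of x b] I1 in auto)
  also have "\<dots> \<le> K * b * m"
    using m1 K b by (simp add: mult_left_mono)
  finally have s2: "norm (gauss_avg b G x - G x) \<le> K * b * m" .
  have "\<bar>b * ((gauss_avg b G x - G x) \<bullet> z)\<bar> \<le> b * (K * b * m * norm z)"
    using Cauchy_Schwarz_ineq2[of "gauss_avg b G x - G x" z] mult_right_mono[OF s2, of "norm z"] b
    by (simp add: abs_mult mult_left_mono)
  then have s3: "\<bar>b * (gauss_avg b G x \<bullet> z) - b * (G x \<bullet> z)\<bar> \<le> K * b\<^sup>2 * m * norm z"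
    by (simp add: inner_diff_left right_diff_distrib power2_eq_square mult_ac)
  let ?n = "norm z"
  have "K * b\<^sup>2 * ?n\<^sup>2 * 1 \<le> K * b\<^sup>2 * ?n\<^sup>2 * m"
    using m K by (intro mult_left_mono) auto
  then have h1: "K * b\<^sup>2 * ?n\<^sup>2 \<le> K * b\<^sup>2 * m * ?n\<^sup>2" by (simp only: mult_ac mult_1_right)
  have "K * b\<^sup>2 * m * (?n\<^sup>2 + 1 + ?n) \<le> K * b\<^sup>2 * m * (2 * (1 + ?n\<^sup>2))"
    using K m le_one_plus_sq[of "norm z"] by (intro mult_left_mono) (auto simp: power2_eq_square)
  then have h2: "K * b\<^sup>2 * m * ?n\<^sup>2 + K * b\<^sup>2 * m + K * b\<^sup>2 * m * ?n \<le> 2 * K * m * b\<^sup>2 * (1 + ?n\<^sup>2)"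
    by (simp only: distrib_left mult_1_right mult_ac)
  show "\<bar>F (x + b *\<^sub>R z) - gauss_avg b F x - b * (gauss_avg b G x \<bullet> z)\<bar> \<le> 2 * K * m * b\<^sup>2 * (1 + ?n\<^sup>2)"
    using t1[of z] s1 s3 h1 h2 by linarith
qed

lemma gauss_avg_gauss_avg:
  fixes F :: "'a::euclidean_space \<Rightarrow> 'b::euclidean_space"
  assumes "c\<^sup>2 = a\<^sup>2 + b\<^sup>2" "b > 0" "c > 0" "F \<in> borel_measurable borel" "\<And>x. norm (F x) \<le> B"
  shows "gauss_avg a (gauss_avg b F) x = gauss_avg c F x"
  unfolding gauss_avg_def using integral_gaussian_convolution[OF assms] .

lemma gauss_avg_0: "gauss_avg 0 F x = F x"
  by (simp add: gauss_avg_def gaussian_prob_UNIV)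

section \<open>Monotonicity along the heat flow\<close>

context hermite_index
begin

text \<open>Measurability of \<open>Theta\<close> comes from its monotonicity, once negative
  arguments are clipped to 0.\<close>

lemma M_measurable:
  fixes F N :: "'a \<Rightarrow> real"
  assumes [measurable]: "F \<in> borel_measurable A" "N \<in> borel_measurable A"
    and p: "\<And>z. F z \<ge> 0" "\<And>z. N z \<ge> 0"
  shows "(\<lambda>z. M (F z) (N z)) \<in> borel_measurable A"
proof -
  have "mono (\<lambda>t. - Theta (max 0 t))"
    by (rule monoI) (auto intro!: Theta_antimono simp: max_def)
  then have "(\<lambda>t. - Theta (max 0 t)) \<in> borel_measurable borel" by (rule borel_measurable_mono)
  then have "(\<lambda>t. - (- Theta (max 0 t))) \<in> borel_measurable borel" by (rule borel_measurable_uminus)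
  then have [measurable]: "(\<lambda>t. Theta (max 0 t)) \<in> borel_measurable borel" by simp
  have "(\<lambda>z. F z powr p * Theta (max 0 (N z / F z))) \<in> borel_measurable A" by measurable
  moreover have "F z powr p * Theta (max 0 (N z / F z)) = M (F z) (N z)" for z
    using p[of z] by (simp add: M_def max_absorb2)
  ultimately show ?thesis by simp
qed

lemma M_bounded:
  assumes eB: "0 < e" "e \<le> B" and L: "0 \<le> L"
  shows "\<exists>C. \<forall>x\<in>{e..B}. \<forall>y\<in>{0..L}. \<bar>M x y\<bar> \<le> C"
proof -
  obtain c where c: "c > 0" "\<forall>x\<in>{e..B}. x powr p \<le> c" using powr_bounded[OF eB(1)] by blast
  have "\<bar>M x y\<bar> \<le> c * (1 + \<bar>Theta (L / e)\<bar>)" if x: "x \<in> {e..B}" and y: "y \<in> {0..L}" for x y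
  proof -
    have "0 \<le> y / x" "y / x \<le> L / e" using x y eB by (auto intro!: frac_le)
    then have "Theta (L / e) \<le> Theta (y / x)" "Theta (y / x) \<le> kap"
      using Theta_antimono[of "y / x" "L / e"] Theta_le_kap by auto
    then have "\<bar>Theta (y / x)\<bar> \<le> 1 + \<bar>Theta (L / e)\<bar>" using kap_cases by auto
    then show ?thesis unfolding M_def abs_mult using c x by (intro mult_mono) auto
  qed
  then show ?thesis by blast
qed

text \<open>One step of the flow, from time \<open>(r + d)\<^sup>2\<close> back to \<open>r\<^sup>2\<close>; with times parametrised by their square roots
  the first-order terms cancel also near \<open>r = 0\<close>.\<close>
lemma flow_one_step:
  assumes eB: "0 < e" "e \<le> B" and L: "0 \<le> L" and K: "0 \<le> K"
  shows "\<exists>C\<ge>0. \<forall>F (G :: 'a::euclidean_space \<Rightarrow> 'a) r d x. C11_pair e B L K F G \<longrightarrow> 0 \<le> r \<longrightarrow> 0 < d \<longrightarrow> r + d \<le> 1 \<longrightarrow>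
    gauss_avg (sqrt ((r + d)\<^sup>2 - r\<^sup>2)) (\<lambda>y. M (F y) ((r + d) * norm (G y))) x
     \<le> M (gauss_avg (sqrt ((r + d)\<^sup>2 - r\<^sup>2)) F x) (r * norm (gauss_avg (sqrt ((r + d)\<^sup>2 - r\<^sup>2)) G x))
       + C * (sqrt ((r + d)\<^sup>2 - r\<^sup>2) ^ 3 + d\<^sup>2)"
proof -
  obtain C0 where C0: "\<And>x y. x \<in> {e..B} \<Longrightarrow> y \<in> {0..L} \<Longrightarrow> \<exists>al be. 0 \<le> be \<and> be \<le> C0 \<and>
    (\<forall>x'\<in>{e..B}. \<forall>y'\<ge>0. M x' y' \<le> M x y + al * (x' - x) - be * y * (y' - y) + be / 2 * (x' - x)\<^sup>2 + C0 * \<bar>x' - x\<bar> ^ 3)"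
    using tangent[OF eB L] by blast
  have C0p: "C0 \<ge> 0" using C0[of e 0] eB L by force
  define m where "m = (\<integral> w. (1 + (norm (w::'a))\<^sup>2) ^ 3 \<partial>gaussian)"
  define c where "c = 2 * K * m"
  \<comment> \<open>The first two summands bound the cross term and the square of the expansion
    error in \<open>sq\<close>, the third bounds the cube of the increment in
    \<open>cu\<close>.\<close>
  define c1 where "c1 = 2 * L * c + c\<^sup>2 + (L + c) ^ 3"
  define C where "C = C0 * L\<^sup>2 + 2 * C0 * c1 * m"
  have m1: "m \<ge> 1"
    unfolding m_def by (rule gaussian.integral_ge_const[OF integrable_gaussian_moment]) (auto intro!: AE_I2 one_le_power)
  have cp: "c \<ge> 0" using m1 K by (simp add: c_def)
  have c1p: "c1 \<ge> 0" using cp L by (simp add: c1_def)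
  have Cp: "C \<ge> 0" using C0p c1p m1 by (simp add: C_def)
  have main: "gauss_avg b (\<lambda>y. M (F y) ((r + d) * norm (G y))) x
     \<le> M (gauss_avg b F x) (r * norm (gauss_avg b G x)) + C * (b ^ 3 + d\<^sup>2)"
    if A: "C11_pair e B L K F (G :: 'a \<Rightarrow> 'a)" and r: "0 \<le> r" and d: "0 < d" and rd: "r + d \<le> 1"
      and b_def: "b = sqrt ((r + d)\<^sup>2 - r\<^sup>2)" for F G r d x b
  proof -
    note [measurable] = C11_pair_measurable[OF A]
    have bd: "e \<le> F x" "F x \<le> B" "norm (G x) \<le> L" for x using A unfolding C11_pair_def by blast+
    have bsq: "b\<^sup>2 = 2 * r * d + d\<^sup>2"
      using r d unfolding b_def by (simp add: power2_eq_square algebra_simps)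
    have b0: "b \<ge> 0" unfolding b_def using r d by (simp add: power2_eq_square algebra_simps)
    have "(r + d)\<^sup>2 \<le> 1" using r d rd by (simp add: power_le_one)
    then have b1: "b \<le> 1"
    proof -
      have "(r + d)\<^sup>2 - r\<^sup>2 \<le> 1" using \<open>(r + d)\<^sup>2 \<le> 1\<close> zero_le_power2[of r] by linarith
      then show ?thesis by (simp add: b_def)
    qed
    let ?u = "gauss_avg b F x" and ?g = "gauss_avg b G x"
    have avg: "C11_pair e B L K (gauss_avg b F) (gauss_avg b G)" by (rule C11_pair_gauss_avg[OF A])
    then have u: "?u \<in> {e..B}" and gL: "norm ?g \<le> L" unfolding C11_pair_def by auto
    let ?y = "r * norm ?g"
    have y: "?y \<in> {0..L}" using r rd d gL mult_mono[of r 1 "norm ?g" L] by auto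
    obtain al be where be: "0 \<le> be" "be \<le> C0" and
      tan: "\<And>x' y'. x' \<in> {e..B} \<Longrightarrow> y' \<ge> 0 \<Longrightarrow>
       M x' y' \<le> M ?u ?y + al * (x' - ?u) - be * ?y * (y' - ?y) + be / 2 * (x' - ?u)\<^sup>2 + C0 * \<bar>x' - ?u\<bar> ^ 3"
      using C0[OF u y] by blast
    let ?W = "\<lambda>z::'a. 1 + (norm z)\<^sup>2"
    define E where "E = 2 * C0 * c1 * b ^ 3"
    \<comment> \<open>A majorant that can be integrated term by term: the norm of \<open>G\<close>
      is replaced by its component along \<open>?g\<close>, and the squared increment of
      \<open>F\<close> by the square of its linear part; all errors of order \<open>b ^ 3\<close>
      sit in the last term.\<close>
    define Rz where "Rz z = (M ?u ?y + be * ?y\<^sup>2) + al * (F (x + b *\<^sub>R z) - ?u) - be * r * (r + d) * (?g \<bullet> G (x + b *\<^sub>R z))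
       + be / 2 * b\<^sup>2 * (?g \<bullet> z)\<^sup>2 + E * ?W z ^ 3" for z
    have pw: "M (F (x + b *\<^sub>R z)) ((r + d) * norm (G (x + b *\<^sub>R z))) \<le> Rz z" for z
    proof -
      let ?x' = "F (x + b *\<^sub>R z)" and ?G' = "G (x + b *\<^sub>R z)"
      let ?y' = "(r + d) * norm ?G'"
      have dual1: "?W z \<ge> 1" by simp
      define er where "er = ?x' - ?u - b * (?g \<bullet> z)"
      have er: "\<bar>er\<bar> \<le> c * b\<^sup>2 * ?W z"
        using gauss_avg_expansion(1)[OF A K b0, of x z] unfolding er_def c_def m_def by simp
      have nz: "norm z \<le> ?W z" using le_one_plus_sq[of "norm z"] by (simp add: power2_eq_square)
      have gz: "\<bar>b * (?g \<bullet> z)\<bar> \<le> b * L * ?W z"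
      proof -
        have "\<bar>?g \<bullet> z\<bar> \<le> norm ?g * norm z" by (rule Cauchy_Schwarz_ineq2)
        also have "\<dots> \<le> L * ?W z" using gL nz L by (intro mult_mono) auto
        finally show ?thesis using b0 by (simp add: abs_mult mult_left_mono mult.assoc)
      qed
      have dual3: "?W z ^ 2 \<le> ?W z ^ 3" using dual1 by (intro power_increasing) auto
      have dx: "?x' - ?u = b * (?g \<bullet> z) + er" by (simp add: er_def)
      have sq: "(?x' - ?u)\<^sup>2 \<le> b\<^sup>2 * (?g \<bullet> z)\<^sup>2 + c1 * b ^ 3 * ?W z ^ 3"
      proof -
        have "(?x' - ?u)\<^sup>2 = b\<^sup>2 * (?g \<bullet> z)\<^sup>2 + 2 * (b * (?g \<bullet> z)) * er + er\<^sup>2"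
          unfolding dx by (simp add: power2_eq_square algebra_simps)
        moreover have "2 * (b * (?g \<bullet> z)) * er \<le> 2 * L * c * b ^ 3 * ?W z ^ 3"
        proof -
          have "2 * (b * (?g \<bullet> z)) * er \<le> 2 * (\<bar>b * (?g \<bullet> z)\<bar> * \<bar>er\<bar>)"
            using abs_ge_self[of "(b * (?g \<bullet> z)) * er"] by (simp add: abs_mult)
          also have "\<dots> \<le> 2 * ((b * L * ?W z) * (c * b\<^sup>2 * ?W z))"
            using gz er b0 L dual1 by (intro mult_left_mono mult_mono) auto
          also have "\<dots> = (2 * L * c * b ^ 3) * ?W z ^ 2"
            by (simp add: power2_eq_square power3_eq_cube)
          also have "\<dots> \<le> (2 * L * c * b ^ 3) * ?W z ^ 3"
            using dual3 L cp b0 by (intro mult_left_mono) auto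
          finally show ?thesis by simp
        qed
        moreover have "er\<^sup>2 \<le> c\<^sup>2 * b ^ 3 * ?W z ^ 3"
        proof -
          have "er\<^sup>2 \<le> (c * b\<^sup>2 * ?W z)\<^sup>2" using er by (metis abs_ge_zero power2_abs power_mono)
          also have "\<dots> = c\<^sup>2 * b ^ 4 * ?W z ^ 2" by (simp add: power_mult_distrib flip: power_mult)
          also have "\<dots> \<le> c\<^sup>2 * b ^ 3 * ?W z ^ 3"
          proof -
            have "b ^ 4 \<le> b ^ 3" by (rule power_decreasing) (use b0 b1 in auto)
            then show ?thesis using dual3 b0 by (intro mult_mono order_refl) auto
          qed
          finally show ?thesis .
        qed
        moreover have "0 \<le> (L + c) ^ 3 * b ^ 3 * ?W z ^ 3" using L cp b0 dual1 by simp
        ultimately show ?thesis unfolding c1_def by (simp add: distrib_right)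
      qed
      have cu: "\<bar>?x' - ?u\<bar> ^ 3 \<le> c1 * b ^ 3 * ?W z ^ 3"
      proof -
        have "c * b\<^sup>2 * ?W z \<le> c * b * ?W z"
          using b0 b1 cp dual1 mult_left_le[of b b] by (intro mult_right_mono mult_left_mono) (auto simp: power2_eq_square)
        then have "\<bar>?x' - ?u\<bar> \<le> (L + c) * b * ?W z"
          unfolding dx using gz er by (simp add: algebra_simps)
        then have "\<bar>?x' - ?u\<bar> ^ 3 \<le> ((L + c) * b * ?W z) ^ 3" by (intro power_mono) auto
        also have "\<dots> = (L + c) ^ 3 * b ^ 3 * ?W z ^ 3" by (simp add: power_mult_distrib)
        also have "\<dots> \<le> c1 * b ^ 3 * ?W z ^ 3"
          unfolding c1_def using L cp b0 dual1 by (intro mult_right_mono) auto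
        finally show ?thesis .
      qed
      have inner: "be * r * (r + d) * (?g \<bullet> ?G') \<le> be * ?y * ?y'"
      proof -
        have "be * r * (r + d) * (?g \<bullet> ?G') \<le> be * r * (r + d) * (norm ?g * norm ?G')"
          using be r d by (intro mult_left_mono norm_cauchy_schwarz) auto
        then show ?thesis by (simp add: mult_ac)
      qed
      have "M ?x' ?y' \<le> M ?u ?y + al * (?x' - ?u) - be * ?y * (?y' - ?y) + be / 2 * (?x' - ?u)\<^sup>2 + C0 * \<bar>?x' - ?u\<bar> ^ 3"
        using bd r d by (intro tan) auto
      moreover have "be * ?y * (?y' - ?y) = be * ?y * ?y' - be * ?y\<^sup>2" by (simp add: power2_eq_square algebra_simps)
      moreover have "be / 2 * (?x' - ?u)\<^sup>2 \<le> be / 2 * b\<^sup>2 * (?g \<bullet> z)\<^sup>2 + C0 * (c1 * b ^ 3 * ?W z ^ 3)"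
      proof -
        have "be / 2 * (?x' - ?u)\<^sup>2 \<le> be / 2 * (b\<^sup>2 * (?g \<bullet> z)\<^sup>2 + c1 * b ^ 3 * ?W z ^ 3)"
          using be sq by (intro mult_left_mono) auto
        also have "\<dots> = be / 2 * b\<^sup>2 * (?g \<bullet> z)\<^sup>2 + be / 2 * (c1 * b ^ 3 * ?W z ^ 3)" by (simp add: algebra_simps)
        also have "be / 2 * (c1 * b ^ 3 * ?W z ^ 3) \<le> C0 * (c1 * b ^ 3 * ?W z ^ 3)"
          using be c1p b0 dual1 by (intro mult_right_mono) auto
        finally show ?thesis by simp
      qed
      moreover have "C0 * \<bar>?x' - ?u\<bar> ^ 3 \<le> C0 * (c1 * b ^ 3 * ?W z ^ 3)"
        using cu C0p by (intro mult_left_mono) auto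
      moreover have "E * ?W z ^ 3 = C0 * (c1 * b ^ 3 * ?W z ^ 3) + C0 * (c1 * b ^ 3 * ?W z ^ 3)"
        by (simp add: E_def)
      ultimately show ?thesis using inner unfolding Rz_def by linarith
    qed
    have IF: "integrable gaussian (\<lambda>z. F (x + b *\<^sub>R z))" and IG: "integrable gaussian (\<lambda>z. G (x + b *\<^sub>R z))"
      using C11_pair_integrable[OF A] by auto
    have h: "has_bochner_integral gaussian Rz ((M ?u ?y + be * ?y\<^sup>2) + al * (?u - ?u) - be * r * (r + d) * (?g \<bullet> ?g)
       + be / 2 * b\<^sup>2 * (\<integral> z. (?g \<bullet> z)\<^sup>2 \<partial>gaussian) + E * m)"
      unfolding Rz_def[abs_def]
    proof (intro has_bochner_integral_add has_bochner_integral_diff has_bochner_integral_mult_right)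
      have one: "has_bochner_integral (gaussian :: 'a measure) (\<lambda>_. k) k" for k :: real
        by (simp add: has_bochner_integral_iff gaussian_prob_UNIV)
      show "has_bochner_integral gaussian (\<lambda>z::'a. M ?u ?y) (M ?u ?y)" by (rule one)
      show "has_bochner_integral gaussian (\<lambda>z::'a. ?u) ?u" by (rule one)
      show "has_bochner_integral gaussian (\<lambda>z::'a. ?y\<^sup>2) (?y\<^sup>2)" by (rule one)
      show "has_bochner_integral gaussian (\<lambda>z. F (x + b *\<^sub>R z)) ?u"
        using IF by (simp add: has_bochner_integral_iff gauss_avg_def)
      show "has_bochner_integral gaussian (\<lambda>z. ?g \<bullet> G (x + b *\<^sub>R z)) (?g \<bullet> ?g)"
        using IG by (simp add: has_bochner_integral_iff gauss_avg_def)
      show "has_bochner_integral gaussian (\<lambda>z. (?g \<bullet> z)\<^sup>2) (\<integral> z. (?g \<bullet> z)\<^sup>2 \<partial>gaussian)"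
        by (rule has_bochner_integral_integrable[OF integrable_gaussian_inner_sq])
      show "has_bochner_integral gaussian (\<lambda>z. ?W z ^ 3) m"
        unfolding m_def by (rule has_bochner_integral_integrable[OF integrable_gaussian_moment])
    qed
    obtain CM where CM: "\<And>x y. x \<in> {e..B} \<Longrightarrow> y \<in> {0..L} \<Longrightarrow> \<bar>M x y\<bar> \<le> CM"
      using M_bounded[OF eB L] by blast
    have yL: "(r + d) * norm (G w) \<in> {0..L}" for w
      using r d rd bd(3)[of w] mult_mono[of "r + d" 1 "norm (G w)" L] by auto
    have "gauss_avg b (\<lambda>y. M (F y) ((r + d) * norm (G y))) x \<le> (\<integral> z. Rz z \<partial>gaussian)"
      unfolding gauss_avg_def
    proof (rule integral_mono)
      show "integrable gaussian (\<lambda>z. M (F (x + b *\<^sub>R z)) ((r + d) * norm (G (x + b *\<^sub>R z))))"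
      proof (rule integrable_gaussian_bounded)
        show "(\<lambda>z. M (F (x + b *\<^sub>R z)) ((r + d) * norm (G (x + b *\<^sub>R z)))) \<in> borel_measurable borel"
          using bd(1) eB r d by (intro M_measurable) (auto intro: order_trans[OF less_imp_le])
        show "norm (M (F (x + b *\<^sub>R z)) ((r + d) * norm (G (x + b *\<^sub>R z)))) \<le> CM" for z
          using CM[of "F (x + b *\<^sub>R z)"] bd yL by simp
      qed
      show "integrable gaussian Rz" using h by (simp add: has_bochner_integral_iff)
    qed (rule pw)
    also have "(\<integral> z. Rz z \<partial>gaussian) = (M ?u ?y + be * ?y\<^sup>2) + al * (?u - ?u) - be * r * (r + d) * (?g \<bullet> ?g)
       + be / 2 * b\<^sup>2 * (\<integral> z. (?g \<bullet> z)\<^sup>2 \<partial>gaussian) + E * m"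
      using h by (rule has_bochner_integral_integral_eq)
    also have "\<dots> \<le> M ?u ?y + C * (b ^ 3 + d\<^sup>2)"
    proof -
      let ?n = "(norm ?g)\<^sup>2"
      have "be / 2 * b\<^sup>2 * (\<integral> z. (?g \<bullet> z)\<^sup>2 \<partial>gaussian) \<le> be / 2 * b\<^sup>2 * ?n"
        using be by (intro mult_left_mono gaussian_inner_sq_le) auto
      \<comment> \<open>The cancellation of the drift: since
        \<open>b\<^sup>2 = 2 * r * d + d\<^sup>2\<close>, all terms of first order in
        \<open>d\<close> disappear, also for \<open>r\<close> near 0.\<close>
      moreover have "be * ?y\<^sup>2 - be * r * (r + d) * (?g \<bullet> ?g) + be / 2 * b\<^sup>2 * ?n = be / 2 * d\<^sup>2 * ?n"
        unfolding bsq power2_norm_eq_inner[symmetric] by (simp add: power2_eq_square algebra_simps)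
      moreover have "be / 2 * d\<^sup>2 * ?n \<le> C0 * L\<^sup>2 * d\<^sup>2"
      proof -
        have "be / 2 * d\<^sup>2 * ?n \<le> C0 * d\<^sup>2 * L\<^sup>2"
        proof -
          have "?n \<le> L\<^sup>2" using gL by (intro power_mono) auto
          then show ?thesis using be C0p by (intro mult_mono order_refl) auto
        qed
        then show ?thesis by (simp add: mult_ac)
      qed
      moreover have "0 \<le> C0 * L\<^sup>2 * b ^ 3" "0 \<le> 2 * C0 * c1 * m * d\<^sup>2" using C0p b0 c1p m1 by auto
      ultimately show ?thesis unfolding C_def E_def by (simp add: algebra_simps)
    qed
    finally show ?thesis .
  qed
  show ?thesis using main Cp by (intro exI[of _ C]) blast
qed

text \<open>An average of width \<open>r + d\<close> is an average of width \<open>r\<close> of one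
  of width \<open>b\<close>, where \<open>b\<^sup>2 = (r + d)\<^sup>2 - r\<^sup>2\<close>. The inner
  one is estimated by \<open>E\<close>, and the induction hypothesis is applied to the averaged
  pair; hence \<open>F\<close> and \<open>G\<close> vary in the induction and \<open>E\<close> is
  assumed for all pairs of the class.\<close>

lemma flow_steps:
  assumes eB: "0 < e" "e \<le> B" and L: "0 \<le> L" and K: "0 \<le> K"
    and d: "0 < d" and E: "\<And>F (G :: 'a::euclidean_space \<Rightarrow> 'a) r x. C11_pair e B L K F G \<Longrightarrow> 0 \<le> r \<Longrightarrow> r + d \<le> 1 \<Longrightarrow>
      gauss_avg (sqrt ((r + d)\<^sup>2 - r\<^sup>2)) (\<lambda>y. M (F y) ((r + d) * norm (G y))) x
     \<le> M (gauss_avg (sqrt ((r + d)\<^sup>2 - r\<^sup>2)) F x) (r * norm (gauss_avg (sqrt ((r + d)\<^sup>2 - r\<^sup>2)) G x)) + E"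
  shows "C11_pair e B L K F (G :: 'a \<Rightarrow> 'a) \<Longrightarrow> real j * d \<le> 1 \<Longrightarrow>
    gauss_avg (real j * d) (\<lambda>y. M (F y) (real j * d * norm (G y))) x \<le> M (gauss_avg (real j * d) F x) 0 + real j * E"
proof (induction j arbitrary: F G x)
  case 0
  then show ?case by (simp add: gauss_avg_0)
next
  case (Suc j)
  define r where "r = real j * d"
  define b where "b = sqrt ((r + d)\<^sup>2 - r\<^sup>2)"
  have r: "0 \<le> r" and rd: "real (Suc j) * d = r + d" and rd1: "r + d \<le> 1"
    using d Suc.prems(2) by (auto simp: r_def algebra_simps)
  have pos: "(r + d)\<^sup>2 - r\<^sup>2 > 0" using r d by (simp add: power2_eq_square algebra_simps add_pos_nonneg)
  then have b: "b > 0" and c: "(r + d)\<^sup>2 = r\<^sup>2 + b\<^sup>2" by (simp_all add: b_def)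
  note A = Suc.prems(1)
  note [measurable] = C11_pair_measurable[OF A]
  have A': "C11_pair e B L K (gauss_avg b F) (gauss_avg b G)" by (rule C11_pair_gauss_avg[OF A])
  note [measurable] = C11_pair_measurable[OF A']
  have bd: "e \<le> F x" "F x \<le> B" "norm (G x) \<le> L" for x using A unfolding C11_pair_def by blast+
  have bd': "e \<le> gauss_avg b F x" "gauss_avg b F x \<le> B" "norm (gauss_avg b G x) \<le> L" for x
    using A' unfolding C11_pair_def by blast+
  obtain CM where CM: "\<And>x y. x \<in> {e..B} \<Longrightarrow> y \<in> {0..L} \<Longrightarrow> \<bar>M x y\<bar> \<le> CM"
    using M_bounded[OF eB L] by blast
  have scale: "s * norm (v::'a) \<in> {0..L}" if "0 \<le> s" "s \<le> 1" "norm v \<le> L" for s v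
    using that mult_mono[of s 1 "norm v" L] by auto
  let ?Phi = "\<lambda>y. M (F y) ((r + d) * norm (G y))"
  let ?Psi = "\<lambda>y. M (gauss_avg b F y) (r * norm (gauss_avg b G y))"
  have Phi_m[measurable]: "?Phi \<in> borel_measurable borel"
    using bd(1) eB r d by (intro M_measurable) (auto intro: order_trans[OF less_imp_le])
  have Psi_m[measurable]: "?Psi \<in> borel_measurable borel"
    using bd'(1) eB r d by (intro M_measurable) (auto intro: order_trans[OF less_imp_le])
  have Phi_b: "norm (?Phi y) \<le> CM" for y
    using CM[of "F y"] bd scale[of "r + d" "G y"] r d rd1 by simp
  have Psi_b: "norm (?Psi y) \<le> CM" for y
    using CM[of "gauss_avg b F y"] bd' scale[of r "gauss_avg b G y"] r d rd1 by simp
  have avg_b: "norm (gauss_avg b ?Phi y) \<le> CM" for y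
    unfolding gauss_avg_def by (rule gaussian_integral_norm_le) (use Phi_b in auto)
  have avg_m: "gauss_avg b ?Phi \<in> borel_measurable borel"
    unfolding gauss_avg_def[abs_def] by measurable
  have "gauss_avg (r + d) ?Phi x = gauss_avg r (gauss_avg b ?Phi) x"
    by (rule gauss_avg_gauss_avg[OF c b _ Phi_m Phi_b, symmetric]) (use r d in simp)
  also have "\<dots> \<le> gauss_avg r (\<lambda>y. ?Psi y + E) x"
    unfolding gauss_avg_def[of r]
  proof (rule integral_mono)
    show "integrable gaussian (\<lambda>z. gauss_avg b ?Phi (x + r *\<^sub>R z))"
      by (rule integrable_gauss_avg[OF avg_m avg_b])
    show "integrable gaussian (\<lambda>z. ?Psi (x + r *\<^sub>R z) + E)"
      using integrable_gauss_avg[OF Psi_m Psi_b] by simp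
    show "gauss_avg b ?Phi (x + r *\<^sub>R z) \<le> ?Psi (x + r *\<^sub>R z) + E" for z
      unfolding b_def by (rule E[OF A r rd1])
  qed
  also have "\<dots> = gauss_avg r ?Psi x + E"
    unfolding gauss_avg_def[of r] using integrable_gauss_avg[OF Psi_m Psi_b] by (simp add: gaussian_prob_UNIV)
  also have "gauss_avg r ?Psi x \<le> M (gauss_avg r (gauss_avg b F) x) 0 + real j * E"
    using Suc.IH[OF A'] rd1 d unfolding r_def by simp
  also have "gauss_avg r (gauss_avg b F) x = gauss_avg (r + d) F x"
  proof (rule gauss_avg_gauss_avg[OF c b])
    show "norm (F y) \<le> B" for y using bd[of y] eB by simp
  qed (use r d in auto)
  finally show ?case unfolding rd by (simp add: distrib_right)
qed

lemma step_error_limit: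
  "(\<lambda>n. a + real n * (C * (sqrt (2 / real n) ^ 3 + (1 / real n)\<^sup>2))) \<longlonglongrightarrow> a"
  by real_asymp

lemma flow_inequality:
  assumes A: "C11_pair e B L K F (G :: 'a::euclidean_space \<Rightarrow> 'a)" and e: "0 < e"
  shows "(\<integral> z. M (F z) (norm (G z)) \<partial>gaussian) \<le> M (\<integral> z. F z \<partial>gaussian) 0"
proof -
  have eB: "e \<le> B" and L: "0 \<le> L"
    using A unfolding C11_pair_def by (meson order_trans, meson norm_ge_zero order_trans)
  \<comment> \<open>\<open>C11_pair\<close> does not record the sign of \<open>K\<close>, which the
    one-step estimate assumes.\<close>
  have A': "C11_pair e B L \<bar>K\<bar> F G"
    using A unfolding C11_pair_def
    by (meson abs_ge_self mult_right_mono norm_ge_zero order_trans zero_le_power2)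
  obtain C where C: "C \<ge> 0" "\<And>F (G :: 'a \<Rightarrow> 'a) r d x. C11_pair e B L \<bar>K\<bar> F G \<Longrightarrow> 0 \<le> r \<Longrightarrow> 0 < d \<Longrightarrow> r + d \<le> 1 \<Longrightarrow>
    gauss_avg (sqrt ((r + d)\<^sup>2 - r\<^sup>2)) (\<lambda>y. M (F y) ((r + d) * norm (G y))) x
     \<le> M (gauss_avg (sqrt ((r + d)\<^sup>2 - r\<^sup>2)) F x) (r * norm (gauss_avg (sqrt ((r + d)\<^sup>2 - r\<^sup>2)) G x))
       + C * (sqrt ((r + d)\<^sup>2 - r\<^sup>2) ^ 3 + d\<^sup>2)"
    using flow_one_step[OF e eB L abs_ge_zero[of K]] by blast
  have bound: "(\<integral> z. M (F z) (norm (G z)) \<partial>gaussian) \<le> M (\<integral> z. F z \<partial>gaussian) 0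
      + real n * (C * (sqrt (2 / real n) ^ 3 + (1 / real n)\<^sup>2))" if n: "n > 0" for n :: nat
  proof -
    define d where "d = 1 / real n"
    have d: "d > 0" using n by (simp add: d_def)
    have nd: "real n * d = 1" using n by (simp add: d_def)
    have "gauss_avg (real n * d) (\<lambda>y. M (F y) (real n * d * norm (G y))) 0
        \<le> M (gauss_avg (real n * d) F 0) 0 + real n * (C * (sqrt (2 * d) ^ 3 + d\<^sup>2))"
    proof (rule flow_steps[OF e eB L abs_ge_zero[of K] d _ A'])
      fix F :: "'a \<Rightarrow> real" and G r x
      assume H: "C11_pair e B L \<bar>K\<bar> F G" "0 \<le> r" "r + d \<le> 1"
      \<comment> \<open>A bound independent of \<open>r\<close>, so that all \<open>n\<close> steps
        share one error, of order \<open>n powr (- 3 / 2)\<close>.\<close>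
      have "(r + d)\<^sup>2 - r\<^sup>2 = d * (2 * r + d)" by (simp add: power2_eq_square algebra_simps)
      also have "\<dots> \<le> d * 2" using H d by (intro mult_left_mono) auto
      finally have "sqrt ((r + d)\<^sup>2 - r\<^sup>2) \<le> sqrt (2 * d)" by (simp add: mult.commute)
      moreover have "0 \<le> (r + d)\<^sup>2 - r\<^sup>2" using H d by (simp add: power2_eq_square algebra_simps)
      ultimately have "sqrt ((r + d)\<^sup>2 - r\<^sup>2) ^ 3 \<le> sqrt (2 * d) ^ 3" by (intro power_mono) auto
      then have "C * (sqrt ((r + d)\<^sup>2 - r\<^sup>2) ^ 3 + d\<^sup>2) \<le> C * (sqrt (2 * d) ^ 3 + d\<^sup>2)"
        using C(1) by (intro mult_left_mono) auto
      then show "gauss_avg (sqrt ((r + d)\<^sup>2 - r\<^sup>2)) (\<lambda>y. M (F y) ((r + d) * norm (G y))) x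
         \<le> M (gauss_avg (sqrt ((r + d)\<^sup>2 - r\<^sup>2)) F x) (r * norm (gauss_avg (sqrt ((r + d)\<^sup>2 - r\<^sup>2)) G x))
           + C * (sqrt (2 * d) ^ 3 + d\<^sup>2)"
        using C(2)[OF H(1,2) d H(3), of x] by linarith
    qed (simp add: nd)
    then show ?thesis unfolding nd by (simp add: gauss_avg_def d_def)
  qed
  have "(\<lambda>n. M (\<integral> z. F z \<partial>gaussian) 0 + real n * (C * (sqrt (2 / real n) ^ 3 + (1 / real n)\<^sup>2))) \<longlonglongrightarrow> M (\<integral> z. F z \<partial>gaussian) 0"
    by (rule step_error_limit)
  then show ?thesis
    by (rule tendsto_lowerbound) (auto intro!: eventually_mono[OF eventually_gt_at_top[of 0]] bound)
qed

end

subsection \<open>Approximation\<close>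

text \<open>The local counterpart of \<open>C11_pair\<close>. The bounds on \<open>F\<close> itself,
  in size and in Lipschitz constant, make the class closed under products and compositions.\<close>

definition C11_on :: "'a::euclidean_space set \<Rightarrow> ('a \<Rightarrow> real) \<Rightarrow> ('a \<Rightarrow> 'a) \<Rightarrow> bool" where
  "C11_on S F G \<longleftrightarrow> (\<exists>K\<ge>0. \<forall>x\<in>S. \<forall>y\<in>S. \<bar>F x\<bar> \<le> K \<and> norm (G x) \<le> K \<and> \<bar>F y - F x\<bar> \<le> K * norm (y - x) \<and>
     norm (G y - G x) \<le> K * norm (y - x) \<and> \<bar>F y - F x - G x \<bullet> (y - x)\<bar> \<le> K * (norm (y - x))\<^sup>2)"

lemma C11_onE:
  assumes "C11_on S F G"
  obtains K where "K \<ge> 0" "\<And>x. x \<in> S \<Longrightarrow> \<bar>F x\<bar> \<le> K" "\<And>x. x \<in> S \<Longrightarrow> norm (G x) \<le> K"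
    "\<And>x y. x \<in> S \<Longrightarrow> y \<in> S \<Longrightarrow> \<bar>F y - F x\<bar> \<le> K * norm (y - x)"
    "\<And>x y. x \<in> S \<Longrightarrow> y \<in> S \<Longrightarrow> norm (G y - G x) \<le> K * norm (y - x)"
    "\<And>x y. x \<in> S \<Longrightarrow> y \<in> S \<Longrightarrow> \<bar>F y - F x - G x \<bullet> (y - x)\<bar> \<le> K * (norm (y - x))\<^sup>2"
proof -
  obtain K where "K \<ge> 0" and *: "\<forall>x\<in>S. \<forall>y\<in>S. \<bar>F x\<bar> \<le> K \<and> norm (G x) \<le> K \<and> \<bar>F y - F x\<bar> \<le> K * norm (y - x) \<and>
     norm (G y - G x) \<le> K * norm (y - x) \<and> \<bar>F y - F x - G x \<bullet> (y - x)\<bar> \<le> K * (norm (y - x))\<^sup>2"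
    using assms unfolding C11_on_def by blast
  then show ?thesis by (intro that[of K]) blast+
qed

lemma C11_onI:
  assumes "\<And>x. x \<in> S \<Longrightarrow> \<bar>F x\<bar> \<le> K1" "\<And>x. x \<in> S \<Longrightarrow> norm (G x) \<le> K2"
    "\<And>x y. x \<in> S \<Longrightarrow> y \<in> S \<Longrightarrow> \<bar>F y - F x\<bar> \<le> K3 * norm (y - x)"
    "\<And>x y. x \<in> S \<Longrightarrow> y \<in> S \<Longrightarrow> norm (G y - G x) \<le> K4 * norm (y - x)"
    "\<And>x y. x \<in> S \<Longrightarrow> y \<in> S \<Longrightarrow> \<bar>F y - F x - G x \<bullet> (y - x)\<bar> \<le> K5 * (norm (y - x))\<^sup>2"
  shows "C11_on S F G"
proof -
  define K where "K = \<bar>K1\<bar> + \<bar>K2\<bar> + \<bar>K3\<bar> + \<bar>K4\<bar> + \<bar>K5\<bar>"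
  have K: "K1 \<le> K" "K2 \<le> K" "K3 \<le> K" "K4 \<le> K" "K5 \<le> K" "K \<ge> 0" by (simp_all add: K_def)
  have m: "c * norm z \<le> K * norm z" "c * (norm z)\<^sup>2 \<le> K * (norm z)\<^sup>2" if "c \<le> K" for c and z :: 'a
    using that by (auto intro!: mult_right_mono)
  show ?thesis
    unfolding C11_on_def
    by (intro exI[of _ K] conjI ballI K(6); rule order_trans, rule assms, assumption+, intro K m order_refl)
qed

lemma C11_on_const: "C11_on S (\<lambda>_. c) (\<lambda>_. 0)"
  by (rule C11_onI[of _ _ "\<bar>c\<bar>" _ 0 0 0 0]) auto

lemma C11_on_add:
  assumes "C11_on S F G" "C11_on S F' G'"
  shows "C11_on S (\<lambda>x. F x + F' x) (\<lambda>x. G x + G' x)"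
proof -
  obtain K where K: "K \<ge> 0" "\<And>x. x \<in> S \<Longrightarrow> \<bar>F x\<bar> \<le> K" "\<And>x. x \<in> S \<Longrightarrow> norm (G x) \<le> K"
    "\<And>x y. x \<in> S \<Longrightarrow> y \<in> S \<Longrightarrow> \<bar>F y - F x\<bar> \<le> K * norm (y - x)"
    "\<And>x y. x \<in> S \<Longrightarrow> y \<in> S \<Longrightarrow> norm (G y - G x) \<le> K * norm (y - x)"
    "\<And>x y. x \<in> S \<Longrightarrow> y \<in> S \<Longrightarrow> \<bar>F y - F x - G x \<bullet> (y - x)\<bar> \<le> K * (norm (y - x))\<^sup>2"
    using C11_onE[OF assms(1)] by blast
  obtain L where L: "L \<ge> 0" "\<And>x. x \<in> S \<Longrightarrow> \<bar>F' x\<bar> \<le> L" "\<And>x. x \<in> S \<Longrightarrow> norm (G' x) \<le> L"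
    "\<And>x y. x \<in> S \<Longrightarrow> y \<in> S \<Longrightarrow> \<bar>F' y - F' x\<bar> \<le> L * norm (y - x)"
    "\<And>x y. x \<in> S \<Longrightarrow> y \<in> S \<Longrightarrow> norm (G' y - G' x) \<le> L * norm (y - x)"
    "\<And>x y. x \<in> S \<Longrightarrow> y \<in> S \<Longrightarrow> \<bar>F' y - F' x - G' x \<bullet> (y - x)\<bar> \<le> L * (norm (y - x))\<^sup>2"
    using C11_onE[OF assms(2)] by blast
  show ?thesis
  proof (rule C11_onI)
    fix x y assume x: "x \<in> S" and y: "y \<in> S"
    show "\<bar>F x + F' x\<bar> \<le> K + L" using K(2)[OF x] L(2)[OF x] by linarith
    show "norm (G x + G' x) \<le> K + L" using K(3)[OF x] L(3)[OF x] norm_triangle_ineq[of "G x" "G' x"] by linarith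
    show "\<bar>F y + F' y - (F x + F' x)\<bar> \<le> (K + L) * norm (y - x)"
      using K(4)[OF x y] L(4)[OF x y] unfolding distrib_right by linarith
    have e: "G y + G' y - (G x + G' x) = (G y - G x) + (G' y - G' x)" by simp
    show "norm (G y + G' y - (G x + G' x)) \<le> (K + L) * norm (y - x)"
      unfolding e distrib_right
      using K(5)[OF x y] L(5)[OF x y] norm_triangle_ineq[of "G y - G x" "G' y - G' x"] by linarith
    show "\<bar>F y + F' y - (F x + F' x) - (G x + G' x) \<bullet> (y - x)\<bar> \<le> (K + L) * (norm (y - x))\<^sup>2"
      using K(6)[OF x y] L(6)[OF x y] unfolding distrib_right inner_add_left by linarith
  qed
qed

lemma C11_on_mult:
  assumes "C11_on S F G" "C11_on S F' G'"
  shows "C11_on S (\<lambda>x. F x * F' x) (\<lambda>x. F x *\<^sub>R G' x + F' x *\<^sub>R G x)"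
proof -
  obtain K where K: "K \<ge> 0" "\<And>x. x \<in> S \<Longrightarrow> \<bar>F x\<bar> \<le> K" "\<And>x. x \<in> S \<Longrightarrow> norm (G x) \<le> K"
    "\<And>x y. x \<in> S \<Longrightarrow> y \<in> S \<Longrightarrow> \<bar>F y - F x\<bar> \<le> K * norm (y - x)"
    "\<And>x y. x \<in> S \<Longrightarrow> y \<in> S \<Longrightarrow> norm (G y - G x) \<le> K * norm (y - x)"
    "\<And>x y. x \<in> S \<Longrightarrow> y \<in> S \<Longrightarrow> \<bar>F y - F x - G x \<bullet> (y - x)\<bar> \<le> K * (norm (y - x))\<^sup>2"
    using C11_onE[OF assms(1)] by blast
  obtain L where L: "L \<ge> 0" "\<And>x. x \<in> S \<Longrightarrow> \<bar>F' x\<bar> \<le> L" "\<And>x. x \<in> S \<Longrightarrow> norm (G' x) \<le> L"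
    "\<And>x y. x \<in> S \<Longrightarrow> y \<in> S \<Longrightarrow> \<bar>F' y - F' x\<bar> \<le> L * norm (y - x)"
    "\<And>x y. x \<in> S \<Longrightarrow> y \<in> S \<Longrightarrow> norm (G' y - G' x) \<le> L * norm (y - x)"
    "\<And>x y. x \<in> S \<Longrightarrow> y \<in> S \<Longrightarrow> \<bar>F' y - F' x - G' x \<bullet> (y - x)\<bar> \<le> L * (norm (y - x))\<^sup>2"
    using C11_onE[OF assms(2)] by blast
  have ab: "\<bar>a * b\<bar> \<le> K' * (L' * n)" if "\<bar>a\<bar> \<le> K'" "\<bar>b\<bar> \<le> L' * n" for a b K' L' n :: real
    unfolding abs_mult using that by (intro mult_mono) auto
  have nb: "norm (a *\<^sub>R v) \<le> K' * (L' * n)" if "\<bar>a\<bar> \<le> K'" "norm v \<le> L' * n" for a K' L' n and v :: 'a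
    unfolding norm_scaleR using that by (intro mult_mono) auto
  show ?thesis
  proof (rule C11_onI)
    fix x y assume x: "x \<in> S" and y: "y \<in> S"
    let ?n = "norm (y - x)"
    show "\<bar>F x * F' x\<bar> \<le> K * L" unfolding abs_mult using K(1,2) L(2) x by (intro mult_mono) auto
    have "norm (F x *\<^sub>R G' x) \<le> K * (L * 1)" "norm (F' x *\<^sub>R G x) \<le> L * (K * 1)"
      using K(2,3)[OF x] L(2,3)[OF x] by - (rule nb; (assumption | simp))+
    then show "norm (F x *\<^sub>R G' x + F' x *\<^sub>R G x) \<le> 2 * K * L"
      using norm_triangle_ineq[of "F x *\<^sub>R G' x" "F' x *\<^sub>R G x"] by (simp add: mult_ac)
    have e: "F y * F' y - F x * F' x = F y * (F' y - F' x) + F' x * (F y - F x)" by (simp add: algebra_simps)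
    have "\<bar>F y * (F' y - F' x)\<bar> \<le> K * (L * ?n)" "\<bar>F' x * (F y - F x)\<bar> \<le> L * (K * ?n)"
      using K(2)[OF y] L(4)[OF x y] L(2)[OF x] K(4)[OF x y] by - (rule ab; assumption)+
    then show "\<bar>F y * F' y - F x * F' x\<bar> \<le> (2 * K * L) * ?n" unfolding e by (simp add: mult_ac)
    have eG: "F y *\<^sub>R G' y + F' y *\<^sub>R G y - (F x *\<^sub>R G' x + F' x *\<^sub>R G x)
       = (F y - F x) *\<^sub>R G' y + F x *\<^sub>R (G' y - G' x) + ((F' y - F' x) *\<^sub>R G y + F' x *\<^sub>R (G y - G x))"
      by (simp add: algebra_simps)
    have "norm ((F y - F x) *\<^sub>R G' y) \<le> (K * ?n) * (L * 1)" "norm (F x *\<^sub>R (G' y - G' x)) \<le> K * (L * ?n)"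
      "norm ((F' y - F' x) *\<^sub>R G y) \<le> (L * ?n) * (K * 1)" "norm (F' x *\<^sub>R (G y - G x)) \<le> L * (K * ?n)"
      using K(2,3)[OF x] L(2,3)[OF x] K(3)[OF y] L(3)[OF y] K(4,5)[OF x y] L(4,5)[OF x y] by - (rule nb; (assumption | simp))+
    then show "norm (F y *\<^sub>R G' y + F' y *\<^sub>R G y - (F x *\<^sub>R G' x + F' x *\<^sub>R G x)) \<le> (4 * K * L) * ?n"
      unfolding eG
      using norm_triangle_ineq[of "(F y - F x) *\<^sub>R G' y + F x *\<^sub>R (G' y - G' x)" "(F' y - F' x) *\<^sub>R G y + F' x *\<^sub>R (G y - G x)"]
        norm_triangle_ineq[of "(F y - F x) *\<^sub>R G' y" "F x *\<^sub>R (G' y - G' x)"]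
        norm_triangle_ineq[of "(F' y - F' x) *\<^sub>R G y" "F' x *\<^sub>R (G y - G x)"]
      by (simp add: mult_ac)
    have eq: "F y * F' y - F x * F' x - (F x *\<^sub>R G' x + F' x *\<^sub>R G x) \<bullet> (y - x)
       = F x * (F' y - F' x - G' x \<bullet> (y - x)) + F' x * (F y - F x - G x \<bullet> (y - x)) + (F y - F x) * (F' y - F' x)"
      by (simp add: inner_add_left) (simp add: algebra_simps)
    have "\<bar>F x * (F' y - F' x - G' x \<bullet> (y - x))\<bar> \<le> K * (L * ?n\<^sup>2)" "\<bar>F' x * (F y - F x - G x \<bullet> (y - x))\<bar> \<le> L * (K * ?n\<^sup>2)"
      "\<bar>(F y - F x) * (F' y - F' x)\<bar> \<le> (K * ?n) * (L * ?n)"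
      using K(2)[OF x] L(2)[OF x] K(4,6)[OF x y] L(4,6)[OF x y] by - (rule ab; assumption)+
    then show "\<bar>F y * F' y - F x * F' x - (F x *\<^sub>R G' x + F' x *\<^sub>R G x) \<bullet> (y - x)\<bar> \<le> (3 * K * L) * ?n\<^sup>2"
      unfolding eq by (simp add: mult_ac power2_eq_square)
  qed
qed

definition C11_real :: "(real \<Rightarrow> real) \<Rightarrow> (real \<Rightarrow> real) \<Rightarrow> real \<Rightarrow> bool" where
  "C11_real u v q \<longleftrightarrow> q \<ge> 0 \<and> (\<forall>s t. \<bar>v s\<bar> \<le> 1 \<and> \<bar>v t - v s\<bar> \<le> q * \<bar>t - s\<bar> \<and> \<bar>u t - u s - v s * (t - s)\<bar> \<le> q * (t - s)\<^sup>2)"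

lemma C11_on_compose:
  assumes "C11_on S F G" and uv: "C11_real u v q"
  shows "C11_on S (\<lambda>x. u (F x)) (\<lambda>x. v (F x) *\<^sub>R G x)"
proof -
  obtain K where K: "K \<ge> 0" "\<And>x. x \<in> S \<Longrightarrow> \<bar>F x\<bar> \<le> K" "\<And>x. x \<in> S \<Longrightarrow> norm (G x) \<le> K"
    "\<And>x y. x \<in> S \<Longrightarrow> y \<in> S \<Longrightarrow> \<bar>F y - F x\<bar> \<le> K * norm (y - x)"
    "\<And>x y. x \<in> S \<Longrightarrow> y \<in> S \<Longrightarrow> norm (G y - G x) \<le> K * norm (y - x)"
    "\<And>x y. x \<in> S \<Longrightarrow> y \<in> S \<Longrightarrow> \<bar>F y - F x - G x \<bullet> (y - x)\<bar> \<le> K * (norm (y - x))\<^sup>2"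
    using C11_onE[OF assms(1)] by blast
  have q: "q \<ge> 0" and v1: "\<bar>v s\<bar> \<le> 1" and vl: "\<bar>v t - v s\<bar> \<le> q * \<bar>t - s\<bar>" and uq: "\<bar>u t - u s - v s * (t - s)\<bar> \<le> q * (t - s)\<^sup>2" for s t
    using uv unfolding C11_real_def by blast+
  \<comment> \<open>A Lipschitz bound for \<open>u\<close> on the range of \<open>F\<close> is drawn
    from the quadratic remainder; that range is bounded.\<close>
  have ul: "\<bar>u t - u s\<bar> \<le> (1 + q * \<bar>t - s\<bar>) * \<bar>t - s\<bar>" for s t
  proof -
    have "\<bar>v s * (t - s)\<bar> \<le> 1 * \<bar>t - s\<bar>" unfolding abs_mult using v1 by (intro mult_right_mono) auto
    moreover have "q * (t - s)\<^sup>2 = q * \<bar>t - s\<bar> * \<bar>t - s\<bar>" by (simp add: power2_eq_square)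
    ultimately show ?thesis using uq[of t s] unfolding distrib_right by linarith
  qed
  show ?thesis
  proof (rule C11_onI)
    fix x y assume x: "x \<in> S" and y: "y \<in> S"
    let ?n = "norm (y - x)"
    have "\<bar>u (F x) - u 0\<bar> \<le> (1 + q * K) * K"
    proof -
      have "\<bar>u (F x) - u 0\<bar> \<le> (1 + q * \<bar>F x\<bar>) * \<bar>F x\<bar>" using ul[of "F x" 0] by simp
      also have "\<dots> \<le> (1 + q * K) * K"
        using K(2)[OF x] K(1) q by (intro mult_mono add_mono) auto
      finally show ?thesis .
    qed
    then show "\<bar>u (F x)\<bar> \<le> \<bar>u 0\<bar> + (1 + q * K) * K" by linarith
    show "norm (v (F x) *\<^sub>R G x) \<le> 1 * K"
      unfolding norm_scaleR using v1[of "F x"] K(1) K(3)[OF x] by (intro mult_mono) auto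
    have d: "\<bar>F y - F x\<bar> \<le> 2 * K" using K(2)[OF x] K(2)[OF y] by linarith
    have "\<bar>u (F y) - u (F x)\<bar> \<le> (1 + q * \<bar>F y - F x\<bar>) * \<bar>F y - F x\<bar>" by (rule ul)
    also have "\<dots> \<le> (1 + q * (2 * K)) * (K * ?n)"
      using d K(4)[OF x y] K(1) q by (intro mult_mono add_mono) auto
    finally show "\<bar>u (F y) - u (F x)\<bar> \<le> ((1 + q * (2 * K)) * K) * ?n" by (simp add: mult.assoc)
    have e: "v (F y) *\<^sub>R G y - v (F x) *\<^sub>R G x = (v (F y) - v (F x)) *\<^sub>R G y + v (F x) *\<^sub>R (G y - G x)"
      by (simp add: algebra_simps)
    have "\<bar>v (F y) - v (F x)\<bar> \<le> q * (K * ?n)"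
      using vl[of "F y" "F x"] mult_left_mono[OF K(4)[OF x y] q] by linarith
    then have "norm ((v (F y) - v (F x)) *\<^sub>R G y) \<le> q * (K * ?n) * K"
      unfolding norm_scaleR using K(1) K(3)[OF y] q by (intro mult_mono) auto
    moreover have "norm (v (F x) *\<^sub>R (G y - G x)) \<le> 1 * (K * ?n)"
      unfolding norm_scaleR using v1[of "F x"] K(5)[OF x y] by (intro mult_mono) auto
    ultimately show "norm (v (F y) *\<^sub>R G y - v (F x) *\<^sub>R G x) \<le> (q * K * K + K) * ?n"
      unfolding e using norm_triangle_ineq[of "(v (F y) - v (F x)) *\<^sub>R G y" "v (F x) *\<^sub>R (G y - G x)"]
      by (simp add: algebra_simps)
    have eq: "u (F y) - u (F x) - (v (F x) *\<^sub>R G x) \<bullet> (y - x)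
       = (u (F y) - u (F x) - v (F x) * (F y - F x)) + v (F x) * (F y - F x - G x \<bullet> (y - x))"
      by (simp add: algebra_simps)
    have "(F y - F x)\<^sup>2 \<le> (K * ?n)\<^sup>2" using K(4)[OF x y] by (metis abs_ge_zero power2_abs power_mono)
    then have "\<bar>u (F y) - u (F x) - v (F x) * (F y - F x)\<bar> \<le> q * (K * ?n)\<^sup>2"
      using uq[of "F y" "F x"] q by (meson mult_left_mono order_trans)
    moreover have "\<bar>v (F x) * (F y - F x - G x \<bullet> (y - x))\<bar> \<le> 1 * (K * ?n\<^sup>2)"
      unfolding abs_mult using v1[of "F x"] K(6)[OF x y] by (intro mult_mono) auto
    ultimately show "\<bar>u (F y) - u (F x) - (v (F x) *\<^sub>R G x) \<bullet> (y - x)\<bar> \<le> (q * K\<^sup>2 + K) * ?n\<^sup>2"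
      unfolding eq by (simp add: algebra_simps power_mult_distrib)
  qed
qed

lemma C11_on_scale:
  assumes "C11_on (cball 0 r) F G" and s: "0 \<le> s" "s \<le> 1"
  shows "C11_on (cball 0 r) (\<lambda>x. F (s *\<^sub>R x)) (\<lambda>x. s *\<^sub>R G (s *\<^sub>R x))"
proof -
  obtain K where K: "K \<ge> 0" "\<And>x. x \<in> cball 0 r \<Longrightarrow> \<bar>F x\<bar> \<le> K" "\<And>x. x \<in> cball 0 r \<Longrightarrow> norm (G x) \<le> K"
    "\<And>x y. x \<in> cball 0 r \<Longrightarrow> y \<in> cball 0 r \<Longrightarrow> \<bar>F y - F x\<bar> \<le> K * norm (y - x)"
    "\<And>x y. x \<in> cball 0 r \<Longrightarrow> y \<in> cball 0 r \<Longrightarrow> norm (G y - G x) \<le> K * norm (y - x)"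
    "\<And>x y. x \<in> cball 0 r \<Longrightarrow> y \<in> cball 0 r \<Longrightarrow> \<bar>F y - F x - G x \<bullet> (y - x)\<bar> \<le> K * (norm (y - x))\<^sup>2"
    using C11_onE[OF assms(1)] by blast
  have mem: "s *\<^sub>R x \<in> cball 0 r" if "x \<in> cball 0 r" for x :: 'a
    using that s mult_left_le_one_le[of "norm x" s] by auto
  have n: "norm (s *\<^sub>R y - s *\<^sub>R x) = s * norm (y - x)" for x y :: 'a
    using s by (simp flip: scaleR_diff_right)
  show ?thesis
  proof (rule C11_onI)
    fix x y :: 'a assume x: "x \<in> cball 0 r" and y: "y \<in> cball 0 r"
    have le: "c * (s * norm (y - x)) \<le> c * norm (y - x)" if "c \<ge> 0" for c
      using that s by (intro mult_left_mono mult_left_le_one_le) auto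
    show "\<bar>F (s *\<^sub>R x)\<bar> \<le> K" using K(2)[OF mem[OF x]] .
    show "norm (s *\<^sub>R G (s *\<^sub>R x)) \<le> 1 * K"
      unfolding norm_scaleR using s K(1) K(3)[OF mem[OF x]] by (intro mult_mono) auto
    show "\<bar>F (s *\<^sub>R y) - F (s *\<^sub>R x)\<bar> \<le> K * norm (y - x)"
      using K(4)[OF mem[OF x] mem[OF y]] le[OF K(1)] unfolding n by linarith
    have "norm (s *\<^sub>R (G (s *\<^sub>R y) - G (s *\<^sub>R x))) \<le> 1 * (K * norm (y - x))"
      unfolding norm_scaleR using s K(5)[OF mem[OF x] mem[OF y]] le[OF K(1)] unfolding n by (intro mult_mono) auto
    then show "norm (s *\<^sub>R G (s *\<^sub>R y) - s *\<^sub>R G (s *\<^sub>R x)) \<le> K * norm (y - x)"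
      by (simp add: scaleR_diff_right)
    have e: "(s *\<^sub>R G (s *\<^sub>R x)) \<bullet> (y - x) = G (s *\<^sub>R x) \<bullet> (s *\<^sub>R y - s *\<^sub>R x)"
      by (simp flip: scaleR_diff_right)
    have "(s * norm (y - x))\<^sup>2 \<le> (norm (y - x))\<^sup>2"
      using s by (intro power_mono mult_left_le_one_le) auto
    then show "\<bar>F (s *\<^sub>R y) - F (s *\<^sub>R x) - (s *\<^sub>R G (s *\<^sub>R x)) \<bullet> (y - x)\<bar> \<le> K * (norm (y - x))\<^sup>2"
      using K(6)[OF mem[OF x] mem[OF y]] mult_left_mono[of "(s * norm (y - x))\<^sup>2" "(norm (y - x))\<^sup>2" K] K(1) unfolding e n by linarith
  qed
qed

lemma C11_on_norm_sq: "C11_on (cball 0 r) (\<lambda>x. c * (norm x)\<^sup>2) (\<lambda>x. (2 * c) *\<^sub>R x)"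
proof (rule C11_onI)
  fix x y :: 'a assume x: "x \<in> cball 0 r" and y: "y \<in> cball 0 r"
  then have r: "norm x \<le> r" "norm y \<le> r" by auto
  show "\<bar>c * (norm x)\<^sup>2\<bar> \<le> \<bar>c\<bar> * r\<^sup>2" unfolding abs_mult using r by (intro mult_mono) (auto intro!: power_mono)
  show "norm ((2 * c) *\<^sub>R x) \<le> 2 * \<bar>c\<bar> * r" using r by (auto simp: abs_mult mult_left_mono)
  show "norm ((2 * c) *\<^sub>R y - (2 * c) *\<^sub>R x) \<le> (2 * \<bar>c\<bar>) * norm (y - x)"
    by (simp add: abs_mult flip: scaleR_diff_right)
  have "c * (norm y)\<^sup>2 - c * (norm x)\<^sup>2 - ((2 * c) *\<^sub>R x) \<bullet> (y - x) = c * (norm (y - x))\<^sup>2"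
    by (simp add: power2_norm_eq_inner inner_diff inner_commute algebra_simps)
  then show "\<bar>c * (norm y)\<^sup>2 - c * (norm x)\<^sup>2 - ((2 * c) *\<^sub>R x) \<bullet> (y - x)\<bar> \<le> \<bar>c\<bar> * (norm (y - x))\<^sup>2"
    by (simp add: abs_mult)
  have "c * (norm y)\<^sup>2 - c * (norm x)\<^sup>2 = c * ((norm y - norm x) * (norm y + norm x))"
    by (simp add: power2_eq_square algebra_simps)
  also have "\<bar>\<dots>\<bar> \<le> \<bar>c\<bar> * (norm (y - x) * (2 * r))"
    unfolding abs_mult using r norm_triangle_ineq3[of y x] by (intro mult_mono mult_nonneg_nonneg) auto
  finally show "\<bar>c * (norm y)\<^sup>2 - c * (norm x)\<^sup>2\<bar> \<le> (\<bar>c\<bar> * (2 * r)) * norm (y - x)" by (simp add: mult_ac)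
qed

text \<open>For a pair supported in the ball of radius \<open>r\<close>, estimates on the doubled
  ball suffice: if one point lies in the small ball and the other outside the doubled one, their
  distance is at least \<open>r\<close>, and the bounds on size give the claim with constants built
  from \<open>K / r\<close> and \<open>K / r\<^sup>2\<close>.\<close>

lemma C11_on_UNIV:
  fixes F :: "'a::euclidean_space \<Rightarrow> real"
  assumes "C11_on (cball 0 (2 * r)) F G" and r: "r > 0"
    and z: "\<And>x. norm x > r \<Longrightarrow> F x = 0" "\<And>x. norm x > r \<Longrightarrow> G x = 0"
  shows "C11_on UNIV F G"
proof -
  obtain K where K: "K \<ge> 0" "\<And>x. x \<in> cball 0 (2 * r) \<Longrightarrow> \<bar>F x\<bar> \<le> K" "\<And>x. x \<in> cball 0 (2 * r) \<Longrightarrow> norm (G x) \<le> K"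
    "\<And>x y. x \<in> cball 0 (2 * r) \<Longrightarrow> y \<in> cball 0 (2 * r) \<Longrightarrow> \<bar>F y - F x\<bar> \<le> K * norm (y - x)"
    "\<And>x y. x \<in> cball 0 (2 * r) \<Longrightarrow> y \<in> cball 0 (2 * r) \<Longrightarrow> norm (G y - G x) \<le> K * norm (y - x)"
    "\<And>x y. x \<in> cball 0 (2 * r) \<Longrightarrow> y \<in> cball 0 (2 * r) \<Longrightarrow> \<bar>F y - F x - G x \<bullet> (y - x)\<bar> \<le> K * (norm (y - x))\<^sup>2"
    using C11_onE[OF assms(1)] by blast
  have F: "\<bar>F x\<bar> \<le> K" and G: "norm (G x) \<le> K" for x
    using K(1) K(2,3)[of x] z[of x] r by (cases "norm x \<le> r"; force)+
  define C where "C = K + K / r + K / r\<^sup>2"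
  have C: "K \<le> C" "K / r \<le> C" "0 \<le> C" using K(1) r by (auto simp: C_def)
  have far: "\<bar>F y - F x\<bar> \<le> C * norm (y - x) \<and> norm (G y - G x) \<le> C * norm (y - x) \<and> \<bar>F y - F x - G x \<bullet> (y - x)\<bar> \<le> C * (norm (y - x))\<^sup>2"
    for x y
  proof -
    let ?n = "norm (y - x)"
    consider "norm x \<le> 2 * r" "norm y \<le> 2 * r" | "norm x > r" "norm y > r" |
      "norm x \<le> r" "norm y > 2 * r" | "norm x > 2 * r" "norm y \<le> r"
      using r by linarith
    then show ?thesis
    proof cases
      case 1
      have "K * ?n \<le> C * ?n" "K * ?n\<^sup>2 \<le> C * ?n\<^sup>2" using C by (auto intro!: mult_right_mono)
      then show ?thesis using K(4-6)[of x y] 1 by fastforce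
    next
      case 2
      then show ?thesis using z C by simp
    next
      case 3
      have n: "?n \<ge> r" using 3 norm_triangle_ineq2[of y x] by linarith
      have y0: "F y = 0" "G y = 0" using z[of y] 3 r by auto
      have "K \<le> K / r * ?n" using n r K(1) by (simp add: field_simps mult_left_mono)
      also have "\<dots> \<le> C * ?n" using C by (intro mult_right_mono) auto
      finally have k1: "K \<le> C * ?n" .
      have "K \<le> K / r\<^sup>2 * ?n\<^sup>2"
        using n r K(1) power_mono[of r ?n 2] by (simp add: field_simps mult_left_mono)
      moreover have "K * ?n \<le> K / r * ?n\<^sup>2"
        using n r K(1) mult_right_mono[of r ?n ?n] by (simp add: field_simps power2_eq_square mult_left_mono)
      moreover have "0 \<le> K * ?n\<^sup>2" using K(1) by simp
      ultimately have k2: "K + K * ?n \<le> C * ?n\<^sup>2" unfolding C_def distrib_right by linarith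
      have "\<bar>G x \<bullet> (y - x)\<bar> \<le> K * ?n"
        using Cauchy_Schwarz_ineq2[of "G x" "y - x"] mult_right_mono[OF G[of x], of ?n] by simp
      then show ?thesis using y0 k1 k2 F[of x] G[of x] by simp
    next
      case 4
      have n: "?n \<ge> r" using 4 norm_triangle_ineq2[of x y] by (simp add: norm_minus_commute)
      have x0: "F x = 0" "G x = 0" using z[of x] 4 r by auto
      have "K \<le> K / r * ?n" using n r K(1) by (simp add: field_simps mult_left_mono)
      also have "\<dots> \<le> C * ?n" using C by (intro mult_right_mono) auto
      finally have k1: "K \<le> C * ?n" .
      have "K \<le> K / r\<^sup>2 * ?n\<^sup>2"
        using n r K(1) power_mono[of r ?n 2] by (simp add: field_simps mult_left_mono)
      moreover have "0 \<le> K * ?n\<^sup>2" "0 \<le> K / r * ?n\<^sup>2" using K(1) r by auto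
      ultimately have k2: "K \<le> C * ?n\<^sup>2" unfolding C_def distrib_right by linarith
      show ?thesis using x0 k1 k2 F[of y] G[of y] by simp
    qed
  qed
  show ?thesis by (rule C11_onI[of _ _ K _ K C C C]) (use F G far in auto)
qed

section \<open>Quadratic splines for flattening and cutting off\<close>

definition pos_sq :: "real \<Rightarrow> real" where "pos_sq r = (max 0 r)\<^sup>2"

lemma pos_sq_expansion: "\<bar>pos_sq t - pos_sq s - 2 * max 0 s * (t - s)\<bar> \<le> (t - s)\<^sup>2"
proof -
  have "pos_sq t - pos_sq s - 2 * max 0 s * (t - s) = (max 0 t - max 0 s)\<^sup>2 + 2 * max 0 s * (max 0 t - t)"
    by (auto simp: pos_sq_def max_def power2_eq_square algebra_simps)
  moreover have "(max 0 t - max 0 s)\<^sup>2 + 2 * max 0 s * (max 0 t - t) \<le> (t - s)\<^sup>2"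
    using sum_squares_bound[of s t]
    by (auto simp: max_def power2_eq_square algebra_simps mult_nonneg_nonneg mult_nonneg_nonpos mult_nonpos_nonneg mult_nonpos_nonpos)
  moreover have "0 \<le> (max 0 t - max 0 s)\<^sup>2 + 2 * max 0 s * (max 0 t - t)"
    by (intro add_nonneg_nonneg mult_nonneg_nonneg) auto
  ultimately show ?thesis by simp
qed

text \<open>A \<open>C\<^sup>1\<^sup>,\<^sup>1\<close> replacement of the identity that is constant below \<open>e\<close> and the identity above \<open>2 e\<close>. Being flat
  at small values it needs no growth information on \<open>Theta\<close> where \<open>f\<close> is small.\<close>
definition soft :: "real \<Rightarrow> real \<Rightarrow> real" where
  "soft e t = 3 / 2 * e + (pos_sq (t - e) - pos_sq (t - 2 * e)) / (2 * e)"
definition soft' :: "real \<Rightarrow> real \<Rightarrow> real" where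
  "soft' e t = (max 0 (t - e) - max 0 (t - 2 * e)) / e"

lemma max0_lip: "\<bar>max 0 t - max 0 s\<bar> \<le> \<bar>t - s\<bar>" for s t :: real
  by (auto simp: max_def)

lemma soft'_range: "e > 0 \<Longrightarrow> 0 \<le> soft' e t \<and> soft' e t \<le> 1"
  by (auto simp: soft'_def max_def field_simps)

lemma C11_real_soft:
  assumes e: "e > 0"
  shows "C11_real (soft e) (soft' e) (2 / e)"
  unfolding C11_real_def
proof (intro conjI allI)
  fix s t :: real
  show "\<bar>soft' e s\<bar> \<le> 1" using soft'_range[OF e, of s] by simp
  define a where "a = max 0 (t - e) - max 0 (s - e)"
  define b where "b = max 0 (t - 2 * e) - max 0 (s - 2 * e)"
  have ab: "\<bar>a\<bar> \<le> \<bar>t - s\<bar>" "\<bar>b\<bar> \<le> \<bar>t - s\<bar>"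
    using max0_lip[of "t - e" "s - e"] max0_lip[of "t - 2 * e" "s - 2 * e"] by (simp_all add: a_def b_def)
  have eq: "soft' e t - soft' e s = (a - b) / e"
    by (simp add: soft'_def a_def b_def diff_divide_distrib[symmetric])
  have "\<bar>a - b\<bar> \<le> 2 * \<bar>t - s\<bar>" using order_trans[OF abs_triangle_ineq4[of a b] add_mono[OF ab]] by simp
  then show "\<bar>soft' e t - soft' e s\<bar> \<le> 2 / e * \<bar>t - s\<bar>"
    unfolding eq abs_divide using e by (simp add: divide_right_mono)
  define c where "c = pos_sq (t - e) - pos_sq (s - e) - 2 * max 0 (s - e) * (t - s)"
  define d where "d = pos_sq (t - 2 * e) - pos_sq (s - 2 * e) - 2 * max 0 (s - 2 * e) * (t - s)"
  have cd: "\<bar>c\<bar> \<le> (t - s)\<^sup>2" "\<bar>d\<bar> \<le> (t - s)\<^sup>2"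
    using pos_sq_expansion[of "t - e" "s - e"] pos_sq_expansion[of "t - 2 * e" "s - 2 * e"] by (simp_all add: c_def d_def)
  have eq2: "soft e t - soft e s - soft' e s * (t - s) = (c - d) / (2 * e)"
    using e by (simp add: soft_def soft'_def c_def d_def field_simps)
  have "\<bar>c - d\<bar> \<le> 4 * (t - s)\<^sup>2" using order_trans[OF abs_triangle_ineq4[of c d] add_mono[OF cd]] zero_le_power2[of "t - s"] by linarith
  then show "\<bar>soft e t - soft e s - soft' e s * (t - s)\<bar> \<le> 2 / e * (t - s)\<^sup>2"
    unfolding eq2 abs_divide using e by (simp add: field_simps)
qed (use e in simp)

lemma soft_low: "e > 0 \<Longrightarrow> t \<le> e \<Longrightarrow> soft e t = 3 / 2 * e" "e > 0 \<Longrightarrow> t \<le> e \<Longrightarrow> soft' e t = 0"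
  by (auto simp: soft_def soft'_def pos_sq_def max_def)

text \<open>The offset \<open>3 / 2 * e\<close> is what makes the quadratic arc between
  \<open>e\<close> and \<open>2 * e\<close> end on the identity.\<close>

lemma soft_high: "e > 0 \<Longrightarrow> 2 * e \<le> t \<Longrightarrow> soft e t = t" "e > 0 \<Longrightarrow> 2 * e \<le> t \<Longrightarrow> soft' e t = 1"
  by (auto simp: soft_def soft'_def pos_sq_def max_def field_simps power2_eq_square)

lemma soft_mid: "e > 0 \<Longrightarrow> e \<le> t \<Longrightarrow> t \<le> 2 * e \<Longrightarrow> soft e t = 3 / 2 * e + (t - e)\<^sup>2 / (2 * e)"
  by (auto simp: soft_def pos_sq_def max_def)

text \<open>The second and fourth bounds compare \<open>soft e t\<close> with \<open>t\<close> from
  both sides, so that powers of either sign can be dominated by those of \<open>t\<close>.\<close>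

lemma soft_bounds:
  assumes e: "e > 0"
  shows "3 / 2 * e \<le> soft e t" "t \<le> soft e t" "soft e t \<le> max (2 * e) t" "e \<le> t \<Longrightarrow> soft e t \<le> 2 * t"
proof -
  have mid: "t \<le> soft e t \<and> 3 / 2 * e \<le> soft e t \<and> soft e t \<le> 2 * e" if "e \<le> t" "t \<le> 2 * e"
  proof -
    have "(t - e)\<^sup>2 \<le> e\<^sup>2" using that by (intro power_mono) auto
    then have "(t - e)\<^sup>2 / (2 * e) \<le> e\<^sup>2 / (2 * e)" using e by (intro divide_right_mono) auto
    also have "e\<^sup>2 / (2 * e) = e / 2" using e by (simp add: power2_eq_square)
    finally have a: "(t - e)\<^sup>2 / (2 * e) \<le> e / 2" .
    have "0 \<le> (t - 2 * e)\<^sup>2 / (2 * e)" using e by simp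
    also have "(t - 2 * e)\<^sup>2 / (2 * e) = 3 / 2 * e + (t - e)\<^sup>2 / (2 * e) - t"
      using e by (simp add: field_simps power2_eq_square)
    finally show ?thesis using a e unfolding soft_mid[OF e that] by simp
  qed
  show "3 / 2 * e \<le> soft e t" "t \<le> soft e t" "soft e t \<le> max (2 * e) t" "e \<le> t \<Longrightarrow> soft e t \<le> 2 * t"
    using mid soft_low[OF e, of t] soft_high[OF e, of t] e
    by (cases "t \<le> e"; cases "t \<le> 2 * e"; force)+
qed

text \<open>A quadratic spline with knots 1, 2 and 3 that descends from 1 to 0; this spacing keeps
  its slope at most 1 in modulus, as \<open>C11_real\<close> demands.\<close>

definition bump :: "real \<Rightarrow> real" where
  "bump r = 1 - (pos_sq (r - 1) - 2 * pos_sq (r - 2) + pos_sq (r - 3)) / 2"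
definition bump' :: "real \<Rightarrow> real" where
  "bump' r = - (max 0 (r - 1) - 2 * max 0 (r - 2) + max 0 (r - 3))"

lemma bump_low: "r \<le> 1 \<Longrightarrow> bump r = 1" "r \<le> 1 \<Longrightarrow> bump' r = 0"
  by (auto simp: bump_def bump'_def pos_sq_def max_def)

lemma bump_high: "3 \<le> r \<Longrightarrow> bump r = 0" "3 \<le> r \<Longrightarrow> bump' r = 0"
  by (auto simp: bump_def bump'_def pos_sq_def max_def field_simps power2_eq_square)

lemma bump'_abs: "\<bar>bump' r\<bar> \<le> 1"
  by (auto simp: bump'_def max_def)

lemma bump_range: "0 \<le> bump r \<and> bump r \<le> 1"
proof -
  consider "r \<le> 1" | "3 \<le> r" | "1 \<le> r" "r \<le> 2" | "2 \<le> r" "r \<le> 3" by linarith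
  then show ?thesis
  proof cases
    case 3
    have "(r - 1)\<^sup>2 \<le> 1" using 3 by (simp add: power_le_one)
    moreover have "bump r = 1 - (r - 1)\<^sup>2 / 2" using 3 by (auto simp: bump_def pos_sq_def max_def)
    ultimately show ?thesis by simp
  next
    case 4
    have "(3 - r)\<^sup>2 \<le> 1" using 4 by (simp add: power_le_one)
    moreover have "bump r = (3 - r)\<^sup>2 / 2"
      using 4 by (auto simp: bump_def pos_sq_def max_def power2_eq_square field_simps)
    ultimately show ?thesis using zero_le_power2[of "3 - r"] by linarith
  qed (simp_all add: bump_low bump_high)
qed

lemma C11_real_bump: "C11_real bump bump' 4"
  unfolding C11_real_def
proof (intro conjI allI)
  fix s t :: real
  show "\<bar>bump' s\<bar> \<le> 1" by (rule bump'_abs)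
  show "\<bar>bump' t - bump' s\<bar> \<le> 4 * \<bar>t - s\<bar>"
  proof -
    define m where "m i = max 0 (t - i) - max 0 (s - i)" for i
    define T where "T = \<bar>t - s\<bar>"
    have m: "m i \<le> T" "- m i \<le> T" for i
      using max0_lip[of "t - i" "s - i"] unfolding m_def T_def by auto
    have "bump' t - bump' s = - (m 1 - 2 * m 2 + m 3)"
      by (simp add: bump'_def m_def)
    then show ?thesis
      unfolding T_def[symmetric] using m[of 1] m[of 2] m[of 3] by (intro abs_leI) linarith+
  qed
  define a where "a i = pos_sq (t - i) - pos_sq (s - i) - 2 * max 0 (s - i) * (t - s)" for i
  define q where "q = (t - s)\<^sup>2"
  have a: "a i \<le> q" "- a i \<le> q" for i
    using pos_sq_expansion[of "t - i" "s - i"] by (simp_all add: a_def q_def abs_le_iff)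
  have "q \<ge> 0" by (simp add: q_def)
  have eq: "bump t - bump s - bump' s * (t - s) = - (a 1 - 2 * a 2 + a 3) / 2"
    by (simp add: bump_def bump'_def a_def field_simps)
  show "\<bar>bump t - bump s - bump' s * (t - s)\<bar> \<le> 4 * (t - s)\<^sup>2"
    unfolding eq q_def[symmetric] using a[of 1] a[of 2] a[of 3] \<open>q \<ge> 0\<close> by (intro abs_leI) argo+
qed simp

section \<open>Dilations of the Gaussian measure\<close>

definition scale_weight :: "real \<Rightarrow> 'a::euclidean_space \<Rightarrow> real" where
  "scale_weight s y = (1 / s) ^ DIM('a) * exp (- ((1 / s\<^sup>2 - 1) * (norm y)\<^sup>2 / 2))"

lemma scale_weight_measurable[measurable]: "scale_weight s \<in> borel_measurable borel"
  unfolding scale_weight_def[abs_def] by measurable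

lemma scale_weight_nonneg: "s > 0 \<Longrightarrow> scale_weight s y \<ge> 0"
  by (simp add: scale_weight_def)

text \<open>The dilated measure has a bounded density only for \<open>s \<le> 1\<close>, where the
  exponent is nonpositive. This is why integrability survives an inward dilation.\<close>

lemma scale_weight_le:
  assumes "0 < s" "s \<le> 1"
  shows "scale_weight s (y :: 'a::euclidean_space) \<le> (1 / s) ^ DIM('a)"
proof -
  have "s\<^sup>2 \<le> 1" using assms by (simp add: power_le_one)
  then have "1 \<le> 1 / s\<^sup>2" using assms by simp
  then have "exp (- ((1 / s\<^sup>2 - 1) * (norm y)\<^sup>2 / 2)) \<le> 1" by simp
  then have "(1 / s) ^ DIM('a) * exp (- ((1 / s\<^sup>2 - 1) * (norm y)\<^sup>2 / 2)) \<le> (1 / s) ^ DIM('a) * 1"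
    using assms by (intro mult_left_mono) auto
  then show ?thesis by (simp add: scale_weight_def)
qed

lemma distr_gaussian_scale:
  assumes s: "s > 0"
  shows "distr gaussian borel (\<lambda>x. s *\<^sub>R x) = density (gaussian :: 'a::euclidean_space measure) (\<lambda>y. ennreal (scale_weight s y))"
proof (rule measure_eqI)
  fix A :: "'a set" assume "A \<in> sets (distr gaussian borel (\<lambda>x. s *\<^sub>R x))"
  then have [measurable]: "A \<in> sets borel" by simp
  have d: "ennreal ((1 / s) ^ DIM('a)) * ennreal (gauss_density ((1 / s) *\<^sub>R y)) = ennreal (gauss_density y) * ennreal (scale_weight s y)" for y :: 'a
  proof -
    have "- (norm ((1 / s) *\<^sub>R y))\<^sup>2 / 2 = - (norm y)\<^sup>2 / 2 + (- ((1 / s\<^sup>2 - 1) * (norm y)\<^sup>2 / 2))"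
      using s by (simp add: power_mult_distrib power_divide field_simps)
    then have "exp (- (norm ((1 / s) *\<^sub>R y))\<^sup>2 / 2) = exp (- (norm y)\<^sup>2 / 2) * exp (- ((1 / s\<^sup>2 - 1) * (norm y)\<^sup>2 / 2))"
      by (simp only: exp_add)
    then have "(1 / s) ^ DIM('a) * gauss_density ((1 / s) *\<^sub>R y) = gauss_density y * scale_weight s y"
      unfolding gauss_density_def scale_weight_def by (simp only: mult_ac)
    moreover have "ennreal ((1 / s) ^ DIM('a)) * ennreal (gauss_density ((1 / s) *\<^sub>R y)) = ennreal ((1 / s) ^ DIM('a) * gauss_density ((1 / s) *\<^sub>R y))"
      by (rule ennreal_mult[symmetric]) (use s gauss_density_pos[of "(1 / s) *\<^sub>R y"] in auto)
    ultimately show ?thesis by (simp only: ennreal_gauss_mult)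
  qed
  have "emeasure (distr gaussian borel (\<lambda>x. s *\<^sub>R x)) A = (\<integral>\<^sup>+ y. indicator A y \<partial>distr gaussian borel (\<lambda>x. s *\<^sub>R x))"
    by simp
  also have "\<dots> = (\<integral>\<^sup>+ x. indicator A (s *\<^sub>R x) \<partial>gaussian)"
    by (rule nn_integral_distr) measurable
  also have "\<dots> = (\<integral>\<^sup>+ x. ennreal (gauss_density x) * indicator A (s *\<^sub>R x) \<partial>lborel)"
    by (rule nn_integral_gaussian) measurable
  also have "\<dots> = ennreal (\<bar>1 / s\<bar> ^ DIM('a)) * (\<integral>\<^sup>+ y. ennreal (gauss_density (0 + (1 / s) *\<^sub>R y)) * indicator A (s *\<^sub>R (0 + (1 / s) *\<^sub>R y)) \<partial>lborel)"
    using s by (intro nn_integral_lborel_affine) auto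
  also have "\<dots> = (\<integral>\<^sup>+ y. ennreal ((1 / s) ^ DIM('a)) * (ennreal (gauss_density ((1 / s) *\<^sub>R y)) * indicator A y) \<partial>lborel)"
    using s by (subst nn_integral_cmult) auto
  also have "\<dots> = (\<integral>\<^sup>+ y. ennreal (gauss_density y) * (ennreal (scale_weight s y) * indicator A y) \<partial>lborel)"
    by (simp only: mult.assoc[symmetric] d)
  also have "\<dots> = (\<integral>\<^sup>+ y. ennreal (scale_weight s y) * indicator A y \<partial>gaussian)"
    by (rule nn_integral_gaussian[symmetric]) measurable
  also have "\<dots> = emeasure (density gaussian (\<lambda>y. ennreal (scale_weight s y))) A"
    by (subst emeasure_density) (auto simp: mult.commute)
  finally show "emeasure (distr gaussian borel (\<lambda>x. s *\<^sub>R x)) A = emeasure (density gaussian (\<lambda>y. ennreal (scale_weight s y))) A" .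
qed simp

lemma gaussian_integral_scale:
  fixes F :: "'a::euclidean_space \<Rightarrow> real"
  assumes s: "s > 0" and [measurable]: "F \<in> borel_measurable borel"
  shows "(\<integral> x. F (s *\<^sub>R x) \<partial>gaussian) = (\<integral> y. scale_weight s y * F y \<partial>gaussian)"
    and "integrable gaussian (\<lambda>x. F (s *\<^sub>R x)) \<longleftrightarrow> integrable gaussian (\<lambda>y. scale_weight s y * F y)"
proof -
  have "(\<integral> x. F (s *\<^sub>R x) \<partial>gaussian) = (\<integral> y. F y \<partial>distr gaussian borel (\<lambda>x. s *\<^sub>R x))"
    by (rule integral_distr[symmetric]) measurable
  also have "\<dots> = (\<integral> y. scale_weight s y * F y \<partial>gaussian)"
    unfolding distr_gaussian_scale[OF s] using scale_weight_nonneg[OF s] by (subst integral_density) auto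
  finally show "(\<integral> x. F (s *\<^sub>R x) \<partial>gaussian) = (\<integral> y. scale_weight s y * F y \<partial>gaussian)" .
  have "integrable gaussian (\<lambda>x. F (s *\<^sub>R x)) \<longleftrightarrow> integrable (distr gaussian borel (\<lambda>x. s *\<^sub>R x)) F"
    by (rule integrable_distr_eq[symmetric]) measurable
  also have "\<dots> \<longleftrightarrow> integrable gaussian (\<lambda>y. scale_weight s y * F y)"
    unfolding distr_gaussian_scale[OF s] using scale_weight_nonneg[OF s] by (subst integrable_density) auto
  finally show "integrable gaussian (\<lambda>x. F (s *\<^sub>R x)) \<longleftrightarrow> integrable gaussian (\<lambda>y. scale_weight s y * F y)" .
qed

lemma integrable_gaussian_scale:
  fixes F :: "'a::euclidean_space \<Rightarrow> real"
  assumes s: "0 < s" "s \<le> 1" and I: "integrable gaussian F"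
  shows "integrable gaussian (\<lambda>x. F (s *\<^sub>R x))"
proof -
  have [measurable]: "F \<in> borel_measurable borel"
    using borel_measurable_integrable[OF I] by simp
  have "integrable gaussian (\<lambda>y. scale_weight s y * F y)"
  proof (rule Bochner_Integration.integrable_bound[OF integrable_mult_right[OF I, of "(1 / s) ^ DIM('a)"]])
    show "AE y in gaussian. norm (scale_weight s y * F y) \<le> norm ((1 / s) ^ DIM('a) * F y)"
    proof (rule AE_I2)
      fix y :: 'a
      have "\<bar>scale_weight s y\<bar> \<le> (1 / s) ^ DIM('a)"
        using scale_weight_le[OF s, of y] scale_weight_nonneg[OF s(1), of y] by simp
      then have "\<bar>scale_weight s y\<bar> * \<bar>F y\<bar> \<le> (1 / s) ^ DIM('a) * \<bar>F y\<bar>" by (rule mult_right_mono) simp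
      then show "norm (scale_weight s y * F y) \<le> norm ((1 / s) ^ DIM('a) * F y)" using s by (simp add: abs_mult)
    qed
  qed measurable
  then show ?thesis using gaussian_integral_scale(2)[OF s(1), of F] by simp
qed

lemma soft_measurable[measurable]: "soft e \<in> borel_measurable borel" "soft' e \<in> borel_measurable borel"
  unfolding soft_def[abs_def] soft'_def[abs_def] pos_sq_def[abs_def] by measurable

text \<open>This is the gradient of the cutoff at radius \<open>R\<close>. Within radius
  \<open>2 * R\<close> it is at most \<open>4 / R\<close>; beyond, the argument of
  \<open>bump'\<close> is at least 3.\<close>

lemma bump_term_bound:
  fixes x :: "'a::euclidean_space"
  assumes R: "R \<ge> 1"
  shows "\<bar>bump' (1 / R\<^sup>2 * (norm x)\<^sup>2)\<bar> * ((2 * (1 / R\<^sup>2)) * norm x) \<le> 4"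
proof (cases "norm x \<le> 2 * R")
  case True
  have "(2 * (1 / R\<^sup>2)) * norm x \<le> (2 * (1 / R\<^sup>2)) * (2 * R)" using True by (intro mult_left_mono) auto
  also have "\<dots> = 4 / R" using R by (simp add: power2_eq_square)
  also have "\<dots> \<le> 4" using R by (simp add: divide_le_eq)
  finally have "(2 * (1 / R\<^sup>2)) * norm x \<le> 4" .
  then have "\<bar>bump' (1 / R\<^sup>2 * (norm x)\<^sup>2)\<bar> * ((2 * (1 / R\<^sup>2)) * norm x) \<le> 1 * 4"
    using bump'_abs by (intro mult_mono) auto
  then show ?thesis by simp
next
  case False
  have "(2 * R)\<^sup>2 \<le> (norm x)\<^sup>2" using False R by (intro power_mono) auto
  moreover have "3 * R\<^sup>2 \<le> (2 * R)\<^sup>2" by (simp add: power_mult_distrib)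
  ultimately have "3 * R\<^sup>2 \<le> (norm x)\<^sup>2" by (rule order_trans[rotated])
  then have "3 \<le> 1 / R\<^sup>2 * (norm x)\<^sup>2" using R by (simp add: field_simps)
  then show ?thesis using bump_high(2) by simp
qed

section \<open>The inequality for flattened and dilated functions\<close>

context hermite_index
begin

lemma Theta_abs:
  assumes "0 \<le> t" "t \<le> max a b" "0 \<le> a" "0 \<le> b"
  shows "\<bar>Theta t\<bar> \<le> 1 + \<bar>Theta a\<bar> + \<bar>Theta b\<bar>"
proof -
  have "Theta (max a b) \<le> Theta t" "Theta t \<le> kap" using Theta_antimono[of t "max a b"] Theta_le_kap assms by auto
  moreover have "- \<bar>Theta a\<bar> - \<bar>Theta b\<bar> \<le> Theta (max a b)" by (auto simp: max_def)
  moreover have "kap \<le> 1" using kap_cases by auto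
  ultimately show ?thesis by (intro abs_leI) linarith+
qed

lemma M_0: "M x 0 = x powr p * kap"
  by (simp add: M_def Theta_0)

text \<open>For \<open>k < 0\<close> the function \<open>Theta\<close> tends to \<open>-\<infinity>\<close> faster than exponentially, so a cutoff may not enlarge the ratio
  \<open>norm (g x) / f x\<close>. The dilation by \<open>s < 1\<close> gains a factor \<open>s\<close> in the ratio, which absorbs the
  gradient of the cutoff function.\<close>
lemma cutoff_inequality:
  fixes f :: "'a::euclidean_space \<Rightarrow> real" and g :: "'a \<Rightarrow> 'a"
  assumes f0: "\<And>x. 0 \<le> f x" and fB: "\<And>x. f x \<le> B0"
    and cls: "\<And>r. C11_on (cball 0 r) f g"
    and [measurable]: "f \<in> borel_measurable borel" "g \<in> borel_measurable borel"
    and e: "0 < e" "e \<le> 1" and s: "0 < s" "s < 1"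
  defines "ts \<equiv> \<lambda>y. soft' e (f y) * norm (g y) / soft e (f y)"
  assumes int: "integrable gaussian (\<lambda>y. soft e (f y) powr p * Theta (ts y))"
  shows "(\<integral> x. soft e (f (s *\<^sub>R x)) powr p * Theta (ts (s *\<^sub>R x)) \<partial>gaussian) \<le> M (\<integral> x. soft e (f (s *\<^sub>R x)) \<partial>gaussian) 0"
proof -
  define c where "c = B0 + 2"
  have B0: "B0 \<ge> 0" using f0[of 0] fB[of 0] by linarith
  have fe: "e \<le> soft e (f y)" and fc: "soft e (f y) \<le> c" for y
  proof -
    have "e \<le> 3 / 2 * e" using e by simp
    then show "e \<le> soft e (f y)" using soft_bounds(1)[OF e(1), of "f y"] by (rule order_trans)
    have "max (2 * e) (f y) \<le> c" using e B0 fB[of y] by (simp add: c_def)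
    then show "soft e (f y) \<le> c" using soft_bounds(3)[OF e(1), of "f y"] by linarith
  qed
  have ec: "e \<le> c" using fe[of 0] fc[of 0] by linarith
  define u where "u x = soft e (f (s *\<^sub>R x))" for x
  define v where "v x = soft' e (f (s *\<^sub>R x)) *\<^sub>R (s *\<^sub>R g (s *\<^sub>R x))" for x
  have [measurable]: "u \<in> borel_measurable borel" "v \<in> borel_measurable borel"
    unfolding u_def[abs_def] v_def[abs_def] by measurable
  have u: "e \<le> u x" "u x \<le> c" for x using fe fc by (auto simp: u_def)
  have up: "u x > 0" for x using u(1)[of x] e by linarith
  have ts0: "0 \<le> ts y" for y
    using soft'_range[OF e(1), of "f y"] fe[of y] e unfolding ts_def by (intro divide_nonneg_nonneg mult_nonneg_nonneg) auto
  have vu: "norm (v x) / u x = s * ts (s *\<^sub>R x)" for x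
    using soft'_range[OF e(1), of "f (s *\<^sub>R x)"] s by (simp add: v_def u_def ts_def abs_mult)
  define chi where "chi n x = bump (1 / (real (Suc n))\<^sup>2 * (norm (x::'a))\<^sup>2)" for n x
  define dchi where "dchi n x = bump' (1 / (real (Suc n))\<^sup>2 * (norm x)\<^sup>2) *\<^sub>R ((2 * (1 / (real (Suc n))\<^sup>2)) *\<^sub>R x)" for n and x :: 'a
  \<comment> \<open>The cutoff leads from \<open>u\<close> to its upper bound \<open>c\<close>, not
    to 0: thus \<open>N\<close> stays above \<open>u\<close>, and the larger denominator only lowers
    the ratio.\<close>
  define N where "N n x = chi n x * (u x + - c) + c" for n x
  define GN where "GN n x = (chi n x *\<^sub>R (v x + 0) + (u x + - c) *\<^sub>R dchi n x) + 0" for n x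
  have chi: "0 \<le> chi n x" "chi n x \<le> 1" for n x unfolding chi_def using bump_range by auto
  have chi0: "chi n x = 0" "dchi n x = 0" if "norm x > 2 * real (Suc n)" for n x
  proof -
    have "(2 * real (Suc n))\<^sup>2 \<le> (norm x)\<^sup>2" using that by (intro power_mono) auto
    moreover have "3 * (real (Suc n))\<^sup>2 \<le> (2 * real (Suc n))\<^sup>2" by (simp add: power_mult_distrib del: of_nat_Suc)
    ultimately have "3 * (real (Suc n))\<^sup>2 \<le> (norm x)\<^sup>2" by (rule order_trans[rotated])
    then have "3 \<le> 1 / (real (Suc n))\<^sup>2 * (norm x)\<^sup>2" by (simp add: field_simps del: of_nat_Suc)
    then show "chi n x = 0" "dchi n x = 0" unfolding chi_def dchi_def using bump_high by auto
  qed
  have chi1: "chi n x = 1" "dchi n x = 0" if "norm x \<le> real (Suc n)" for n x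
  proof -
    have "(norm x)\<^sup>2 \<le> (real (Suc n))\<^sup>2" using that by (intro power_mono) auto
    then have "1 / (real (Suc n))\<^sup>2 * (norm x)\<^sup>2 \<le> 1" by (simp add: field_simps del: of_nat_Suc)
    then show "chi n x = 1" "dchi n x = 0" unfolding chi_def dchi_def using bump_low by auto
  qed
  have dchi: "norm (dchi n x) \<le> 4" for n x
    using bump_term_bound[of "real (Suc n)" x] unfolding dchi_def by (simp add: abs_mult del: of_nat_Suc)
  have [measurable]: "chi n \<in> borel_measurable borel" "dchi n \<in> borel_measurable borel" for n
    unfolding chi_def[abs_def] dchi_def[abs_def] bump_def bump'_def pos_sq_def by measurable
  have [measurable]: "N n \<in> borel_measurable borel" "GN n \<in> borel_measurable borel" for n
    unfolding N_def[abs_def] GN_def[abs_def] by measurable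
  have cu: "C11_on (cball 0 r) u v" for r
    unfolding u_def[abs_def] v_def[abs_def]
    by (rule C11_on_compose[OF C11_on_scale[OF cls] C11_real_soft[OF e(1)]]) (use s in auto)
  have cchi: "C11_on (cball 0 r) (chi n) (dchi n)" for r n
    unfolding chi_def[abs_def] dchi_def[abs_def]
    by (rule C11_on_compose[OF C11_on_norm_sq C11_real_bump])
  have "C11_on UNIV (\<lambda>x. chi n x * (u x + - c)) (\<lambda>x. chi n x *\<^sub>R (v x + 0) + (u x + - c) *\<^sub>R dchi n x)" for n
    by (rule C11_on_UNIV[of "2 * real (Suc n)"], rule C11_on_mult[OF cchi C11_on_add[OF cu C11_on_const]])
       (use chi0 in auto)
  then have cN: "C11_on UNIV (N n) (GN n)" for n
    unfolding N_def[abs_def] GN_def[abs_def] by (rule C11_on_add[OF _ C11_on_const])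
  have Nu: "u x \<le> N n x" "N n x \<le> c" "chi n x * u x \<le> N n x" for n x
  proof -
    have e1: "N n x = u x + (1 - chi n x) * (c - u x)" "N n x = c - chi n x * (c - u x)" "N n x = chi n x * u x + (1 - chi n x) * c"
      by (simp_all add: N_def algebra_simps)
    show "u x \<le> N n x" unfolding e1(1) using chi[of n x] u[of x] by simp
    show "N n x \<le> c" unfolding e1(2) using chi[of n x] u[of x] by simp
    show "chi n x * u x \<le> N n x" unfolding e1(3) using chi[of n x] ec e by simp
  qed
  have Np: "N n x > 0" for n x using Nu(1)[of x n] up[of x] by linarith
  have flow: "(\<integral> x. M (N n x) (norm (GN n x)) \<partial>gaussian) \<le> M (\<integral> x. N n x \<partial>gaussian) 0" for n
  proof -
    obtain K where K: "\<And>x. norm (GN n x) \<le> K"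
      "\<And>x y. norm (GN n y - GN n x) \<le> K * norm (y - x)"
      "\<And>x y. \<bar>N n y - N n x - GN n x \<bullet> (y - x)\<bar> \<le> K * (norm (y - x))\<^sup>2"
      using C11_onE[OF cN[of n]] by (metis UNIV_I)
    have "C11_pair e c K K (N n) (GN n)"
      unfolding C11_pair_def using K Nu(1)[of _ n] Nu(2)[of n] u(1) order_trans by blast
    then show ?thesis by (rule flow_inequality) (rule e)
  qed
  obtain Cp where Cp: "Cp > 0" "\<forall>x\<in>{e..c}. x powr p \<le> Cp" using powr_bounded[OF e(1)] by blast
  \<comment> \<open>The cutoff adds at most \<open>4 * c / e\<close> to the ratio. Writing this as
    \<open>(1 - s) * eta\<close> bounds the new ratio by a convex combination of \<open>ts\<close>
    and \<open>eta\<close>, hence by their maximum.\<close>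
  define eta where "eta = (4 * c / e) / (1 - s)"
  have c0: "c \<ge> 0" using B0 by (simp add: c_def)
  have eta0: "0 \<le> eta" unfolding eta_def using c0 e s by (intro divide_nonneg_nonneg mult_nonneg_nonneg) auto
  define bd where "bd x = Cp * (1 + \<bar>Theta (ts (s *\<^sub>R x))\<bar> + \<bar>Theta eta\<bar>)" for x
  have ratio: "norm (GN n x) / N n x \<le> max (ts (s *\<^sub>R x)) eta" "0 \<le> norm (GN n x) / N n x" for n x
  proof -
    note Np = Np[of n x]
    show "0 \<le> norm (GN n x) / N n x" using Np by simp
    have "norm (GN n x) \<le> norm (chi n x *\<^sub>R v x) + norm ((u x + - c) *\<^sub>R dchi n x)"
      unfolding GN_def add_0_right by (rule norm_triangle_ineq)
    also have "norm (chi n x *\<^sub>R v x) = chi n x * norm (v x)" using chi by simp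
    also have "norm ((u x + - c) *\<^sub>R dchi n x) \<le> c * 4"
      unfolding norm_scaleR using u[of x] up[of x] dchi[of n x] c0 by (intro mult_mono) auto
    finally have "norm (GN n x) / N n x \<le> (chi n x * norm (v x) + c * 4) / N n x"
      using Np by (intro divide_right_mono) auto
    also have "\<dots> = chi n x * norm (v x) / N n x + c * 4 / N n x" by (rule add_divide_distrib)
    also have "\<dots> \<le> norm (v x) / u x + c * 4 / e"
    proof (rule add_mono)
      have "chi n x * u x * norm (v x) \<le> N n x * norm (v x)" by (intro mult_right_mono Nu) auto
      then show "chi n x * norm (v x) / N n x \<le> norm (v x) / u x"
        using Np up[of x] by (simp add: field_simps)
      show "c * 4 / N n x \<le> c * 4 / e"
        using Nu(1)[of x n] u(1)[of x] e c0 by (intro divide_left_mono) auto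
    qed
    finally have le: "norm (GN n x) / N n x \<le> s * ts (s *\<^sub>R x) + c * 4 / e" unfolding vu .
    have "c * 4 / e = (1 - s) * eta" using s by (simp add: eta_def)
    then have "norm (GN n x) / N n x \<le> s * ts (s *\<^sub>R x) + (1 - s) * eta" using le by simp
    also have "\<dots> \<le> s * max (ts (s *\<^sub>R x)) eta + (1 - s) * max (ts (s *\<^sub>R x)) eta"
      using s by (intro add_mono mult_left_mono) auto
    also have "\<dots> = max (ts (s *\<^sub>R x)) eta" by (simp add: algebra_simps)
    finally show "norm (GN n x) / N n x \<le> max (ts (s *\<^sub>R x)) eta" .
  qed
  have dom: "\<bar>M (N n x) (norm (GN n x))\<bar> \<le> bd x" for n x
  proof -
    have "\<bar>Theta (norm (GN n x) / N n x)\<bar> \<le> 1 + \<bar>Theta (ts (s *\<^sub>R x))\<bar> + \<bar>Theta eta\<bar>"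
      using ratio ts0 eta0 by (intro Theta_abs) auto
    moreover have "N n x powr p \<le> Cp" using Cp(2) Nu(1)[of x n] Nu(2)[of n x] u(1)[of x] by force
    ultimately show ?thesis
      unfolding M_def bd_def abs_mult using Cp(1) by (intro mult_mono) auto
  qed
  have lim_pt: "(\<lambda>n. h (chi n x) (dchi n x)) \<longlonglongrightarrow> h 1 0" for h :: "real \<Rightarrow> 'a \<Rightarrow> real" and x
  proof (rule tendsto_eventually)
    obtain n0 where "norm x \<le> real n0" using real_arch_simple by blast
    then show "\<forall>\<^sub>F n in sequentially. h (chi n x) (dchi n x) = h 1 0"
      by (intro eventually_sequentiallyI[of n0]) (simp add: chi1)
  qed
  have Nlim: "(\<lambda>n. N n x) \<longlonglongrightarrow> u x" for x
    using lim_pt[of "\<lambda>a b. a * (u x + - c) + c" x] by (simp add: N_def)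
  have Mlim: "(\<lambda>n. M (N n x) (norm (GN n x))) \<longlonglongrightarrow> M (u x) (norm (v x))" for x
    using lim_pt[of "\<lambda>a b. M (a * (u x + - c) + c) (norm (a *\<^sub>R v x + (u x + - c) *\<^sub>R b))" x] by (simp add: N_def GN_def)
  have Mm: "(\<lambda>x. M (N n x) (norm (GN n x))) \<in> borel_measurable borel" for n
    by (intro M_measurable) (auto simp: less_imp_le[OF Np])
  have Mm': "(\<lambda>x. M (u x) (norm (v x))) \<in> borel_measurable borel"
    using up by (intro M_measurable) (auto intro: less_imp_le)
  \<comment> \<open>On the range \<open>{e..c}\<close> of \<open>soft\<close> powers of either sign
    are bounded, so the factor \<open>powr p\<close> can be stripped off before the dilation is
    applied.\<close>
  have Thi: "integrable gaussian (\<lambda>y. Theta (ts y))"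
  proof -
    obtain Cm where Cm: "Cm > 0" "\<forall>x\<in>{e..c}. x powr (- p) \<le> Cm" using powr_bounded[OF e(1)] by blast
    show ?thesis
    proof (rule Bochner_Integration.integrable_bound[OF integrable_mult_right[OF int, of "\<bar>Cm\<bar>"]])
    show "AE y in gaussian. norm (Theta (ts y)) \<le> norm (\<bar>Cm\<bar> * (soft e (f y) powr p * Theta (ts y)))"
    proof (rule AE_I2)
      fix y
      have sp: "soft e (f y) > 0" using fe[of y] e by linarith
      have "1 = soft e (f y) powr (- p) * soft e (f y) powr p" using sp by (simp flip: powr_add)
      also have "\<dots> \<le> Cm * soft e (f y) powr p" using Cm fe fc by (intro mult_right_mono) auto
      finally have "1 * \<bar>Theta (ts y)\<bar> \<le> (Cm * soft e (f y) powr p) * \<bar>Theta (ts y)\<bar>" by (intro mult_right_mono) auto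
      then show "norm (Theta (ts y)) \<le> norm (\<bar>Cm\<bar> * (soft e (f y) powr p * Theta (ts y)))"
        using Cm(1) by (simp add: abs_mult)
    qed
    have "(\<lambda>y. M 1 (ts y)) \<in> borel_measurable borel"
      unfolding ts_def using ts0[unfolded ts_def] by (intro M_measurable) auto
    then show "(\<lambda>y. Theta (ts y)) \<in> borel_measurable gaussian"
      by (simp add: M_def)
    qed
  qed
  have bdi: "integrable gaussian bd"
    unfolding bd_def[abs_def]
    by (intro integrable_mult_right Bochner_Integration.integrable_add integrable_abs
          integrable_gaussian_scale[OF _ _ Thi]) (use s in auto)
  have mM: "(\<lambda>x. M (u x) (norm (v x))) \<in> borel_measurable gaussian" "(\<lambda>x. M (N n x) (norm (GN n x))) \<in> borel_measurable gaussian" for n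
    using Mm Mm' by simp_all
  have aM: "AE x in gaussian. (\<lambda>n. M (N n x) (norm (GN n x))) \<longlonglongrightarrow> M (u x) (norm (v x))"
    "AE x in gaussian. norm (M (N n x) (norm (GN n x))) \<le> bd x" for n
    using Mlim dom by (auto intro!: AE_I2)
  have L1: "(\<lambda>n. \<integral> x. M (N n x) (norm (GN n x)) \<partial>gaussian) \<longlonglongrightarrow> (\<integral> x. M (u x) (norm (v x)) \<partial>gaussian)"
    by (rule integral_dominated_convergence[OF mM bdi aM])
  have I1: "integrable gaussian (\<lambda>x. M (u x) (norm (v x)))"
    by (rule integrable_dominated_convergence[OF mM bdi aM])
  have L2: "(\<lambda>n. \<integral> x. N n x \<partial>gaussian) \<longlonglongrightarrow> (\<integral> x. u x \<partial>gaussian)"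
  proof (rule integral_dominated_convergence[where w = "\<lambda>_. c"])
    show "AE x in gaussian. norm (N n x) \<le> c" for n
      by (intro AE_I2) (simp add: abs_of_pos[OF Np] Nu(2))
  qed (use Nlim in auto)
  have ui: "integrable gaussian u"
    using u up by (intro integrable_gaussian_bounded[of _ c]) (auto simp: less_imp_le)
  have "e \<le> (\<integral> x. u x \<partial>gaussian)"
    by (rule gaussian.integral_ge_const[OF ui]) (use u in auto)
  then have "(\<lambda>n. M (\<integral> x. N n x \<partial>gaussian) 0) \<longlonglongrightarrow> M (\<integral> x. u x \<partial>gaussian) 0"
    unfolding M_0 using e by (intro tendsto_intros L2) auto
  then have le: "(\<integral> x. M (u x) (norm (v x)) \<partial>gaussian) \<le> M (\<integral> x. u x \<partial>gaussian) 0"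
    by (rule LIMSEQ_le[OF L1]) (use flow in blast)
  \<comment> \<open>The dilated function has the ratio \<open>s * ts\<close>. Replacing it by the
    larger \<open>ts\<close> only lowers the left-hand side, since \<open>Theta\<close> is
    nonincreasing.\<close>
  have "(\<integral> x. soft e (f (s *\<^sub>R x)) powr p * Theta (ts (s *\<^sub>R x)) \<partial>gaussian) \<le> (\<integral> x. M (u x) (norm (v x)) \<partial>gaussian)"
  proof (rule integral_mono[OF integrable_gaussian_scale[OF _ _ int] I1])
    fix x
    have "Theta (ts (s *\<^sub>R x)) \<le> Theta (s * ts (s *\<^sub>R x))"
      using ts0[of "s *\<^sub>R x"] s by (intro Theta_antimono mult_left_le_one_le mult_nonneg_nonneg) auto
    then show "soft e (f (s *\<^sub>R x)) powr p * Theta (ts (s *\<^sub>R x)) \<le> M (u x) (norm (v x))"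
      unfolding M_def vu unfolding u_def by (rule mult_left_mono) simp
  qed (use s in auto)
  then show ?thesis using le unfolding u_def by linarith
qed

end

section \<open>Smooth functions have locally Lipschitz gradients\<close>

lemma grad_has_derivative:
  fixes f :: "'a::euclidean_space \<Rightarrow> real"
  assumes "f differentiable (at x)"
  shows "(f has_derivative (\<lambda>h. grad f x \<bullet> h)) (at x)"
proof -
  let ?d = "frechet_derivative f (at x)"
  have "linear ?d" using assms by (rule linear_frechet_derivative)
  have "?d h = grad f x \<bullet> h" for h
  proof -
    have "?d h = ?d (\<Sum>b\<in>Basis. (h \<bullet> b) *\<^sub>R b)" by (simp add: euclidean_representation)
    also have "\<dots> = (\<Sum>b\<in>Basis. (h \<bullet> b) *\<^sub>R ?d b)"
      using \<open>linear ?d\<close> by (simp add: linear_sum linear_cmul)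
    also have "\<dots> = grad f x \<bullet> h"
      by (simp add: grad_def inner_sum_left inner_commute[of h] mult.commute)
    finally show ?thesis .
  qed
  then show ?thesis using assms unfolding frechet_derivative_works by presburger
qed

lemma gradient_lipschitz:
  fixes F :: "'a::euclidean_space \<Rightarrow> real"
  assumes "convex S" and d: "\<And>x. x \<in> S \<Longrightarrow> (F has_derivative (\<lambda>h. G x \<bullet> h)) (at x)"
    and b: "\<And>x. x \<in> S \<Longrightarrow> norm (G x) \<le> B" and xy: "x \<in> S" "y \<in> S"
  shows "\<bar>F y - F x\<bar> \<le> B * norm (y - x)"
proof -
  have "norm (F y - F x) \<le> B * norm (y - x)"
  proof (rule differentiable_bound[OF assms(1), where f' = "\<lambda>x h. G x \<bullet> h"])
    fix z assume z: "z \<in> S"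
    show "(F has_derivative (\<lambda>h. G z \<bullet> h)) (at z within S)" using d[OF z] by (rule has_derivative_at_withinI)
    show "onorm (\<lambda>h. G z \<bullet> h) \<le> B"
    proof (rule onorm_bound)
      show "0 \<le> B" using b[OF z] norm_ge_zero order_trans by blast
      show "norm (G z \<bullet> h) \<le> B * norm h" for h
        using Cauchy_Schwarz_ineq2[of "G z" h] mult_right_mono[OF b[OF z], of "norm h"] by simp
    qed
  qed (use xy in auto)
  then show ?thesis by simp
qed

lemma grad_continuous:
  fixes f :: "'a::euclidean_space \<Rightarrow> real"
  assumes "\<And>b. b \<in> Basis \<Longrightarrow> continuous_on UNIV (\<lambda>x. frechet_derivative f (at x) b)"
  shows "continuous_on UNIV (grad f)"
  unfolding grad_def[abs_def] using assms by (intro continuous_intros) auto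

lemma smooth_differentiable: "smooth f \<Longrightarrow> f differentiable (at x)"
proof -
  assume "smooth f"
  then have "Cm (Suc 0) f" unfolding smooth_def by blast
  then show ?thesis by simp
qed

lemma smooth_partial_continuous: "smooth f \<Longrightarrow> b \<in> Basis \<Longrightarrow> continuous_on UNIV (\<lambda>x. frechet_derivative f (at x) b)"
proof -
  assume "smooth f" and b: "b \<in> Basis"
  then have "Cm (Suc 0) f" unfolding smooth_def by blast
  then show ?thesis using b by simp
qed

lemma smooth_partial: "smooth f \<Longrightarrow> b \<in> Basis \<Longrightarrow> smooth (\<lambda>x. frechet_derivative f (at x) b)"
proof -
  assume s: "smooth f" and b: "b \<in> Basis"
  have "Cm m (\<lambda>x. frechet_derivative f (at x) b)" for m
  proof -
    have "Cm (Suc m) f" using s unfolding smooth_def by blast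
    then show ?thesis using b by simp
  qed
  then show ?thesis unfolding smooth_def by blast
qed

lemma smooth_continuous: "smooth f \<Longrightarrow> continuous_on UNIV f"
  unfolding smooth_def using Cm.simps(1) by blast

lemma smooth_grad_continuous: "smooth f \<Longrightarrow> continuous_on UNIV (grad f)"
  by (rule grad_continuous) (rule smooth_partial_continuous)

lemma continuous_bounded_cball:
  fixes G :: "'a::euclidean_space \<Rightarrow> 'b::real_normed_vector"
  assumes "continuous_on UNIV G"
  shows "\<exists>K\<ge>0. \<forall>x\<in>cball 0 r. norm (G x) \<le> K"
proof -
  have "bounded (G ` cball 0 r)"
    by (intro compact_imp_bounded compact_continuous_image continuous_on_subset[OF assms]) auto
  then obtain K where "\<forall>x\<in>cball 0 r. norm (G x) \<le> K" unfolding bounded_iff by auto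
  then have "\<forall>x\<in>cball 0 r. norm (G x) \<le> \<bar>K\<bar>" by fastforce
  then show ?thesis by (intro exI[of _ "\<bar>K\<bar>"]) auto
qed

text \<open>The gradient is Lipschitz on the ball because each partial derivative has a bounded
  gradient there. The second-order bound is the mean value inequality, on the segment from
  \<open>x\<close> to \<open>y\<close>, for \<open>f\<close> minus its linear part at
  \<open>x\<close>; the gradient of this difference is at most
  \<open>\<bar>K\<bar> * norm (y - x)\<close>.\<close>

lemma smooth_C11_on:
  fixes f :: "'a::euclidean_space \<Rightarrow> real"
  assumes f: "smooth f"
  shows "C11_on (cball 0 r) f (grad f)"
proof -
  let ?S = "cball (0::'a) r"
  let ?p = "\<lambda>b x. frechet_derivative f (at x) b"
  obtain K1 where K1: "K1 \<ge> 0" "\<And>x. x \<in> ?S \<Longrightarrow> norm (f x) \<le> K1"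
    using continuous_bounded_cball[OF smooth_continuous[OF f], of r] by blast
  obtain K2 where K2: "K2 \<ge> 0" "\<And>x. x \<in> ?S \<Longrightarrow> norm (grad f x) \<le> K2"
    using continuous_bounded_cball[OF smooth_grad_continuous[OF f], of r] by blast
  have "\<exists>K\<ge>0. \<forall>x\<in>?S. norm (grad (?p b) x) \<le> K" if "b \<in> Basis" for b
    by (rule continuous_bounded_cball[OF smooth_grad_continuous[OF smooth_partial[OF f that]]])
  then obtain k where k: "\<And>b x. b \<in> Basis \<Longrightarrow> x \<in> ?S \<Longrightarrow> norm (grad (?p b) x) \<le> k b"
    by metis
  define K where "K = (\<Sum>b\<in>Basis. k b)"
  have G: "norm (grad f y - grad f x) \<le> K * norm (y - x)" if x: "x \<in> ?S" and y: "y \<in> ?S" for x y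
  proof -
    have "grad f y - grad f x = (\<Sum>b\<in>Basis. (?p b y - ?p b x) *\<^sub>R b)"
      by (simp add: grad_def sum_subtractf scaleR_diff_left)
    also have "norm \<dots> \<le> (\<Sum>b\<in>(Basis::'a set). k b * norm (y - x))"
    proof (rule sum_norm_le)
      fix b :: 'a assume b: "b \<in> Basis"
      have "\<bar>?p b y - ?p b x\<bar> \<le> k b * norm (y - x)"
        by (rule gradient_lipschitz[of ?S "?p b" "grad (?p b)"])
           (use b k x y grad_has_derivative[OF smooth_differentiable[OF smooth_partial[OF f b]]] in auto)
      then show "norm ((?p b y - ?p b x) *\<^sub>R b) \<le> k b * norm (y - x)" using b by simp
    qed
    also have "\<dots> = K * norm (y - x)" by (simp add: K_def sum_distrib_right)
    finally show ?thesis .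
  qed
  have d: "(f has_derivative (\<lambda>h. grad f x \<bullet> h)) (at x)" for x
    by (rule grad_has_derivative[OF smooth_differentiable[OF f]])
  show ?thesis
  proof (rule C11_onI)
    fix x y assume x: "x \<in> ?S" and y: "y \<in> ?S"
    show "\<bar>f x\<bar> \<le> K1" using K1(2)[OF x] by simp
    show "norm (grad f x) \<le> K2" using K2(2)[OF x] .
    show "\<bar>f y - f x\<bar> \<le> K2 * norm (y - x)"
      by (rule gradient_lipschitz[of ?S f "grad f"]) (use d K2 x y in auto)
    show "norm (grad f y - grad f x) \<le> K * norm (y - x)" by (rule G[OF x y])
    have seg: "closed_segment x y \<subseteq> ?S" using x y by (simp add: closed_segment_subset)
    have "\<bar>(f y - grad f x \<bullet> y) - (f x - grad f x \<bullet> x)\<bar> \<le> \<bar>K\<bar> * norm (y - x) * norm (y - x)"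
    proof (rule gradient_lipschitz[of "closed_segment x y" "\<lambda>z. f z - grad f x \<bullet> z" "\<lambda>z. grad f z - grad f x"])
      fix z assume z: "z \<in> closed_segment x y"
      show "((\<lambda>z. f z - grad f x \<bullet> z) has_derivative (\<lambda>h. (grad f z - grad f x) \<bullet> h)) (at z)"
        unfolding inner_diff_left by (intro has_derivative_diff d has_derivative_inner_right has_derivative_ident)
      have "norm (grad f z - grad f x) \<le> K * norm (z - x)" using G[OF x] z seg by blast
      also have "\<dots> \<le> \<bar>K\<bar> * norm (y - x)"
        using segment_bound1[OF z] by (intro mult_mono) (auto simp: norm_minus_commute)
      finally show "norm (grad f z - grad f x) \<le> \<bar>K\<bar> * norm (y - x)" .
    qed auto
    moreover have "(f y - grad f x \<bullet> y) - (f x - grad f x \<bullet> x) = f y - f x - grad f x \<bullet> (y - x)"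
      by (simp add: inner_diff_right)
    ultimately show "\<bar>f y - f x - grad f x \<bullet> (y - x)\<bar> \<le> \<bar>K\<bar> * (norm (y - x))\<^sup>2"
      by (simp add: power2_eq_square mult.assoc)
  qed
qed

section \<open>Passage to the limit\<close>

context hermite_index
begin

text \<open>Flattening level and dilation go to their limits together. After the change of variables
  the dilation sits in the bounded weight \<open>scale_weight\<close>, while \<open>f\<close> and
  \<open>g\<close> are evaluated at the same point for all \<open>n\<close>, so the limit asks for
  no continuity of \<open>Theta\<close>.\<close>

lemma gradient_inequality:
  fixes f :: "'a::euclidean_space \<Rightarrow> real" and g :: "'a \<Rightarrow> 'a"
  assumes f0: "\<And>x. 0 \<le> f x" and fB: "\<And>x. f x \<le> B0"
    and cls: "\<And>r. C11_on (cball 0 r) f g"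
    and [measurable]: "f \<in> borel_measurable borel" "g \<in> borel_measurable borel"
    and fp: "integrable gaussian (\<lambda>x. f x powr p)"
    and gi: "integrable gaussian (\<lambda>x. f x powr p * Theta (norm (g x) / f x))"
    and neg: "p < 0 \<Longrightarrow> AE x in gaussian. f x \<noteq> 0" "p < 0 \<Longrightarrow> (\<integral> x. f x \<partial>gaussian) > 0"
  shows "(\<integral> x. f x powr p * Theta (norm (g x) / f x) \<partial>gaussian) \<le> M (\<integral> x. f x \<partial>gaussian) 0"
proof -
  define e where "e n = 1 / (real n + 2)" for n
  define s where "s n = 1 - 1 / (real n + 2)" for n
  have e: "0 < e n" "e n \<le> 1" "e n \<le> 1 / 2" for n by (auto simp: e_def)
  have s: "0 < s n" "s n < 1" "1 / 2 \<le> s n" for n by (auto simp: s_def field_simps)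
  define m where "m n y = soft (e n) (f y) powr p * Theta (soft' (e n) (f y) * norm (g y) / soft (e n) (f y))" for n y
  \<comment> \<open>The factor \<open>2 powr \<bar>p\<bar>\<close> comes from
    \<open>soft e t \<le> 2 * t\<close> for \<open>t \<ge> e\<close>. The summand 1 covers points
    with \<open>f y \<le> e n\<close> when \<open>p > 0\<close>. The summand
    \<open>f y powr p\<close> covers such points when \<open>p < 0\<close>, and elsewhere pays for
    the upper bound of \<open>Theta\<close>.\<close>
  define D where "D y = 2 powr \<bar>p\<bar> * (1 + f y powr p + \<bar>f y powr p * Theta (norm (g y) / f y)\<bar>)" for y
  have sp: "soft (e n) t > 0" for n t
    using soft_bounds(1)[OF e(1), of n t] e(1)[of n] by linarith
  have s'0: "0 \<le> soft' (e n) t" "soft' (e n) t \<le> 1" for n t using soft'_range[OF e(1)] by auto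
  have Di: "integrable gaussian D"
    unfolding D_def[abs_def]
    by (intro integrable_mult_right Bochner_Integration.integrable_add integrable_abs fp gi) simp
  have mm: "m n \<in> borel_measurable borel" for n
  proof -
    have "(\<lambda>y. M (soft (e n) (f y)) (soft' (e n) (f y) * norm (g y))) \<in> borel_measurable borel"
      using sp s'0 by (intro M_measurable) (auto simp: less_imp_le)
    then show ?thesis unfolding M_def m_def[abs_def] .
  qed
  have two: "1 \<le> 2 powr \<bar>p\<bar>" by (simp add: ge_one_powr_ge_zero)
  have dom: "\<bar>m n y\<bar> \<le> D y" if fy: "p > 0 \<or> f y \<noteq> 0" for n y
  proof (cases "f y \<le> e n")
    case True
    have kap1: "\<bar>kap\<bar> = 1" using kap_cases by auto
    have m_eq: "\<bar>m n y\<bar> = (3 / 2 * e n) powr p"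
      unfolding m_def soft_low[OF e(1) True] by (simp add: Theta_0 abs_mult kap1)
    have D1: "D y \<ge> 2 powr \<bar>p\<bar> * (1 + f y powr p)" unfolding D_def by (intro mult_left_mono) auto
    show ?thesis
    proof (cases "p > 0")
      case p: True
      have "3 / 2 * e n \<le> 2" using e(2)[of n] by simp
      then have "(3 / 2 * e n) powr p \<le> 2 powr p" using p e(1)[of n] by (intro powr_mono2) auto
      also have "\<dots> \<le> 2 powr \<bar>p\<bar> * (1 + f y powr p)"
        using p by (simp add: distrib_left)
      finally show ?thesis using D1 m_eq by linarith
    next
      case p: False
      have fpos: "f y > 0" using fy p f0[of y] by (auto simp: less_le)
      have "f y \<le> 3 / 2 * e n" using True e(1)[of n] by simp
      then have "(3 / 2 * e n) powr p \<le> f y powr p" using p fpos by (intro powr_mono2') auto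
      also have "\<dots> \<le> 2 powr \<bar>p\<bar> * f y powr p" using mult_right_mono[OF two, of "f y powr p"] by simp
      also have "\<dots> \<le> 2 powr \<bar>p\<bar> * (1 + f y powr p)" by (intro mult_left_mono) auto
      finally show ?thesis using D1 m_eq by linarith
    qed
  next
    case False
    then have fe: "e n \<le> f y" and fpos: "f y > 0" using e(1)[of n] by auto
    let ?so = "soft (e n) (f y)" and ?t = "norm (g y) / f y"
    let ?ts = "soft' (e n) (f y) * norm (g y) / ?so"
    have so: "f y \<le> ?so" "?so \<le> 2 * f y"
      using soft_bounds(2)[OF e(1), of "f y"] soft_bounds(4)[OF e(1) fe] by auto
    have ts0: "0 \<le> ?ts" using sp s'0 by (intro divide_nonneg_nonneg mult_nonneg_nonneg) (auto simp: less_imp_le)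
    have "soft' (e n) (f y) * norm (g y) \<le> 1 * norm (g y)" using s'0 by (intro mult_right_mono) auto
    then have "?ts \<le> ?t" using so fpos by (intro frac_le) auto
    then have "\<bar>Theta ?ts\<bar> \<le> 1 + \<bar>Theta ?t\<bar>"
      using Theta_antimono[OF ts0] Theta_le_kap[OF ts0] kap_cases by (intro abs_leI) fastforce+
    moreover have "?so powr p \<le> 2 powr \<bar>p\<bar> * f y powr p"
    proof (cases "p > 0")
      case True
      have "?so powr p \<le> (2 * f y) powr p" using so fpos True by (intro powr_mono2) auto
      then show ?thesis using True fpos by (simp add: powr_mult)
    next
      case False
      have "?so powr p \<le> f y powr p" using so fpos False by (intro powr_mono2') auto
      also have "\<dots> \<le> 2 powr \<bar>p\<bar> * f y powr p" using mult_right_mono[OF two, of "f y powr p"] by simp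
      finally show ?thesis .
    qed
    ultimately have "\<bar>m n y\<bar> \<le> (2 powr \<bar>p\<bar> * f y powr p) * (1 + \<bar>Theta ?t\<bar>)"
      unfolding m_def abs_mult by (intro mult_mono) auto
    also have "\<dots> = 2 powr \<bar>p\<bar> * (f y powr p + \<bar>f y powr p * Theta ?t\<bar>)"
      by (simp add: abs_mult algebra_simps)
    also have "\<dots> \<le> D y" unfolding D_def by (intro mult_left_mono) auto
    finally show ?thesis .
  qed
  have good: "AE y in gaussian. p > 0 \<or> f y \<noteq> 0"
    using neg(1) p0 by (cases "p > 0") auto
  have mi: "integrable gaussian (m n)" for n
  proof (rule Bochner_Integration.integrable_bound[OF Di])
    show "m n \<in> borel_measurable gaussian" using mm by simp
    show "AE y in gaussian. norm (m n y) \<le> norm (D y)"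
      using good by eventually_elim (use dom in \<open>simp add: order_trans[OF _ abs_ge_self]\<close>)
  qed
  have mlim: "(\<lambda>n. m n y) \<longlonglongrightarrow> f y powr p * Theta (norm (g y) / f y)" if fy: "p > 0 \<or> f y \<noteq> 0" for y
  proof (cases "f y = 0")
    case True
    \<comment> \<open>At a zero of \<open>f\<close> the flattened integrand is \<open>kap\<close>
      times a power of \<open>3 / 2 * e n\<close> that tends to 0, which agrees with
      \<open>0 powr p = 0\<close> in the limit.\<close>
    then have p: "p > 0" using fy by simp
    have "m n y = (3 / 2 * e n) powr p * kap" for n
    proof -
      have "f y \<le> e n" using True e(1)[of n] by simp
      then show ?thesis unfolding m_def soft_low[OF e(1) \<open>f y \<le> e n\<close>] by (simp add: Theta_0)
    qed
    moreover have "(\<lambda>n. (3 / 2 * e n) powr p * kap) \<longlonglongrightarrow> 0"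
      unfolding e_def using p by real_asymp
    ultimately show ?thesis using True by simp
  next
    case False
    then have fpos: "f y > 0" using f0[of y] by (simp add: less_le)
    have "e \<longlonglongrightarrow> 0" unfolding e_def[abs_def] by real_asymp
    \<comment> \<open>Once \<open>2 * e n \<le> f y\<close>, the flattening is the identity at
      \<open>f y\<close>, and the sequence is constant.\<close>
    then have "\<forall>\<^sub>F n in sequentially. e n < f y / 2" using fpos by (intro order_tendstoD(2)) auto
    then show ?thesis
    proof (intro tendsto_eventually, eventually_elim)
      case (elim n)
      then have "2 * e n \<le> f y" by simp
      then show "m n y = f y powr p * Theta (norm (g y) / f y)"
        unfolding m_def using soft_high[OF e(1)] by simp
    qed
  qed
  have solim: "(\<lambda>n. soft (e n) (f y)) \<longlonglongrightarrow> f y" for y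
  proof (rule tendsto_sandwich[where f = "\<lambda>_. f y" and h = "\<lambda>n. f y + 2 * e n"])
    show "\<forall>\<^sub>F n in sequentially. f y \<le> soft (e n) (f y)" using soft_bounds(2)[OF e(1)] by simp
    have "max (2 * e n) (f y) \<le> f y + 2 * e n" for n using f0[of y] e(1)[of n] by simp
    then show "\<forall>\<^sub>F n in sequentially. soft (e n) (f y) \<le> f y + 2 * e n"
      using soft_bounds(3)[OF e(1)] by (meson eventually_sequentiallyI order_trans)
    show "(\<lambda>n. f y + 2 * e n) \<longlonglongrightarrow> f y" unfolding e_def by real_asymp
  qed simp
  have wlim: "(\<lambda>n. scale_weight (s n) y) \<longlonglongrightarrow> 1" for y :: 'a
  proof -
    have sl: "s \<longlonglongrightarrow> 1" unfolding s_def[abs_def] by real_asymp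
    have "(\<lambda>n. (1 / s n) ^ DIM('a) * exp (- ((1 / (s n)\<^sup>2 - 1) * (norm y)\<^sup>2 / 2))) \<longlonglongrightarrow>
        (1 / 1) ^ DIM('a) * exp (- ((1 / 1\<^sup>2 - 1) * (norm y)\<^sup>2 / 2))"
      by (intro tendsto_intros sl) auto
    then show ?thesis by (simp add: scale_weight_def)
  qed
  have wle: "\<bar>scale_weight (s n) y\<bar> \<le> 2 ^ DIM('a)" for n and y :: 'a
  proof -
    have "(1 / s n) ^ DIM('a) \<le> 2 ^ DIM('a)" using s[of n] by (intro power_mono) (auto simp: field_simps)
    moreover have "scale_weight (s n) y \<le> (1 / s n) ^ DIM('a)"
      using s[of n] by (intro scale_weight_le) auto
    ultimately have "scale_weight (s n) y \<le> 2 ^ DIM('a)" by (rule order_trans[rotated])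
    then show ?thesis using scale_weight_nonneg[OF s(1)[of n], of y] by simp
  qed
  have B0: "B0 \<ge> 0" using f0[of 0] fB[of 0] by linarith
  have L1: "(\<lambda>n. \<integral> x. m n (s n *\<^sub>R x) \<partial>gaussian) \<longlonglongrightarrow> (\<integral> x. f x powr p * Theta (norm (g x) / f x) \<partial>gaussian)"
    unfolding gaussian_integral_scale(1)[OF s(1) mm]
  proof (rule integral_dominated_convergence[where w = "\<lambda>y. 2 ^ DIM('a) * D y"])
    show "(\<lambda>x. f x powr p * Theta (norm (g x) / f x)) \<in> borel_measurable gaussian" using gi by (rule borel_measurable_integrable)
    show "(\<lambda>y. scale_weight (s n) y * m n y) \<in> borel_measurable gaussian" for n using mm by simp
    show "integrable gaussian (\<lambda>y. 2 ^ DIM('a) * D y)" using Di by (rule integrable_mult_right)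
    show "AE y in gaussian. (\<lambda>n. scale_weight (s n) y * m n y) \<longlonglongrightarrow> f y powr p * Theta (norm (g y) / f y)"
      using good
    proof eventually_elim
      case (elim y)
      show ?case using tendsto_mult[OF wlim mlim[OF elim]] by simp
    qed
    show "AE y in gaussian. norm (scale_weight (s n) y * m n y) \<le> 2 ^ DIM('a) * D y" for n
      using good
    proof eventually_elim
      case (elim y)
      show ?case
        unfolding real_norm_def abs_mult using wle dom[OF elim] by (intro mult_mono) auto
    qed
  qed
  have som: "(\<lambda>y. soft (e n) (f y)) \<in> borel_measurable borel" for n by measurable
  have L2: "(\<lambda>n. \<integral> x. soft (e n) (f (s n *\<^sub>R x)) \<partial>gaussian) \<longlonglongrightarrow> (\<integral> x. f x \<partial>gaussian)"
    unfolding gaussian_integral_scale(1)[OF s(1) som]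
  proof (rule integral_dominated_convergence[where w = "\<lambda>y. 2 ^ DIM('a) * (B0 + 2)"])
    show "AE y in gaussian. (\<lambda>n. scale_weight (s n) y * soft (e n) (f y)) \<longlonglongrightarrow> f y"
    proof (rule AE_I2)
      fix y :: 'a show "(\<lambda>n. scale_weight (s n) y * soft (e n) (f y)) \<longlonglongrightarrow> f y"
        using tendsto_mult[OF wlim solim] by simp
    qed
    show "AE y in gaussian. norm (scale_weight (s n) y * soft (e n) (f y)) \<le> 2 ^ DIM('a) * (B0 + 2)" for n
    proof (rule AE_I2)
      fix y :: 'a
      have "max (2 * e n) (f y) \<le> B0 + 2" using fB[of y] e(2)[of n] B0 by simp
      then have "soft (e n) (f y) \<le> B0 + 2"
        by (rule order_trans[OF soft_bounds(3)[OF e(1)]])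
      then have "\<bar>soft (e n) (f y)\<bar> \<le> B0 + 2"
        using sp[of n "f y"] by simp
      then show "norm (scale_weight (s n) y * soft (e n) (f y)) \<le> 2 ^ DIM('a) * (B0 + 2)"
        unfolding real_norm_def abs_mult using wle B0 by (intro mult_mono) auto
    qed
  qed auto
  have L3: "(\<lambda>n. M (\<integral> x. soft (e n) (f (s n *\<^sub>R x)) \<partial>gaussian) 0) \<longlonglongrightarrow> M (\<integral> x. f x \<partial>gaussian) 0"
    unfolding M_0
  proof (rule tendsto_mult[OF _ tendsto_const])
    have nn: "(\<integral> x. soft (e n) (f (s n *\<^sub>R x)) \<partial>gaussian) \<ge> 0" for n
      using sp by (intro integral_nonneg_AE AE_I2) (simp add: less_imp_le)
    show "(\<lambda>n. (\<integral> x. soft (e n) (f (s n *\<^sub>R x)) \<partial>gaussian) powr p) \<longlonglongrightarrow> (\<integral> x. f x \<partial>gaussian) powr p"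
    proof (cases "p > 0")
      case True
      then show ?thesis using nn by (intro tendsto_powr'[OF L2 tendsto_const]) auto
    next
      case False
      then show ?thesis using neg(2) p0 by (intro tendsto_powr[OF L2 tendsto_const]) auto
    qed
  qed
  have "(\<integral> x. m n (s n *\<^sub>R x) \<partial>gaussian) \<le> M (\<integral> x. soft (e n) (f (s n *\<^sub>R x)) \<partial>gaussian) 0" for n
    using cutoff_inequality[OF f0 fB cls assms(4,5) e(1,2) s(1,2), of n n] mi[of n] unfolding m_def[abs_def] by blast
  then show ?thesis by (intro LIMSEQ_le[OF L1 L3]) blast
qed

end

theorem theorem1:
  fixes f :: "'a::euclidean_space \<Rightarrow> real" and p :: real
  assumes nonneg: "\<And>x. f x \<ge> 0"
    and smooth: "smooth f"
    and bdd: "bounded (range f)"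
    and fin: "(\<integral>\<^sup>+ x. epow (f x) p \<partial>gaussian) < \<infinity>"
  defines "g \<equiv> (\<lambda>x. f x powr p * hermite_F (1 / (p - 1)) (norm (grad f x) / f x))"
  shows "(p \<notin> {0..1} \<longrightarrow>
           (\<integral>\<^sup>+ x. ennreal (g x) \<partial>gaussian)
             \<le> ennreal ((\<integral> x. f x \<partial>gaussian) powr p) + (\<integral>\<^sup>+ x. ennreal (- g x) \<partial>gaussian)) \<and>
         (p \<in> {0<..<1} \<longrightarrow>
           ennreal ((\<integral> x. f x \<partial>gaussian) powr p) + (\<integral>\<^sup>+ x. ennreal (- g x) \<partial>gaussian)
             \<le> (\<integral>\<^sup>+ x. ennreal (g x) \<partial>gaussian))"
proof (cases "p = 0 \<or> p = 1")
  \<comment> \<open>For these values neither range applies; \<open>p = 0\<close> would give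
    \<open>k = - 1\<close>, and \<open>p = 1\<close> gives \<open>k = 0\<close> by division by
    zero.\<close>
  case True
  then show ?thesis by auto
next
  case p01: False
  define k where "k = 1 / (p - 1)"
  interpret hermite_index k
    by unfold_locales (use p01 in \<open>auto simp: k_def field_simps\<close>)
  have pk: "hermite_index.p k = p" unfolding p_def using p01 by (simp add: k_def)
  let ?T = "\<lambda>x. norm (grad f x) / f x"
  let ?X = "\<integral> x. f x \<partial>gaussian"
  have kap2: "kap * kap = 1" using kap_cases by auto
  have g_eq: "g x = kap * (f x powr p * Theta (?T x))" for x
    unfolding g_def Theta_def k_def[symmetric] by (simp add: kap2 mult.left_commute mult.assoc[symmetric])
  obtain B0 where B0: "\<And>x. \<bar>f x\<bar> \<le> B0" using bdd unfolding bounded_iff by auto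
  have fB: "f x \<le> B0" for x using B0[of x] by simp
  have fc: "continuous_on UNIV f" by (rule smooth_continuous[OF smooth])
  have [measurable]: "f \<in> borel_measurable borel" "grad f \<in> borel_measurable borel"
    using fc smooth_grad_continuous[OF smooth] by (auto intro: borel_measurable_continuous_onI)
  have fi: "integrable gaussian f" by (rule integrable_gaussian_bounded[of _ B0]) (use B0 in auto)
  have T0: "0 \<le> ?T x" for x using nonneg by simp
  \<comment> \<open>For \<open>p < 0\<close> the real power is 0 at a zero of \<open>f\<close>. It
    is \<open>epow\<close>, infinite there, that turns finiteness of the integral into nonvanishing
    almost everywhere.\<close>
  have nz: "AE x in gaussian. f x \<noteq> 0" if "p < 0"
  proof -
    have [measurable]: "(\<lambda>x. epow (f x) p) \<in> borel_measurable borel" unfolding epow_def[abs_def] by measurable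
    have "AE x in gaussian. epow (f x) p \<noteq> \<infinity>"
      using fin by (intro nn_integral_PInf_AE) auto
    then show ?thesis by eventually_elim (use that in \<open>auto simp: epow_def\<close>)
  qed
  have X0: "?X \<ge> 0" using nonneg by (intro integral_nonneg_AE) auto
  have Xpos: "?X > 0" if "p < 0"
  proof (rule ccontr)
    assume "\<not> ?X > 0"
    then have "?X = 0" using X0 by simp
    then have "AE x in gaussian. f x = 0"
      using integral_nonneg_eq_0_iff_AE[OF fi] nonneg by auto
    with nz[OF that] have "AE x in (gaussian :: 'a measure). False" by eventually_elim simp
    then show False by (simp add: gaussian.AE_False)
  qed
  have fpi: "integrable gaussian (\<lambda>x. f x powr p)"
  proof (rule integrableI_nonneg)
    have "(\<integral>\<^sup>+ x. ennreal (f x powr p) \<partial>gaussian) \<le> (\<integral>\<^sup>+ x. epow (f x) p \<partial>gaussian)"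
      by (intro nn_integral_mono) (auto simp: epow_def)
    also note fin
    finally show "(\<integral>\<^sup>+ x. ennreal (f x powr p) \<partial>gaussian) < \<infinity>" .
  qed auto
  have hm: "(\<lambda>x. f x powr p * Theta (?T x)) \<in> borel_measurable borel"
  proof -
    have "(\<lambda>x. M (f x) (norm (grad f x))) \<in> borel_measurable borel"
      using nonneg by (intro M_measurable) auto
    then show ?thesis unfolding M_def pk .
  qed
  have gm[measurable]: "g \<in> borel_measurable borel"
    unfolding g_eq[abs_def] using hm by (rule borel_measurable_times[OF borel_measurable_const])
  have main: "kap * (\<integral> x. g x \<partial>gaussian) \<le> kap * ?X powr p" if gi: "integrable gaussian g"
  proof -
    have h: "f x powr p * Theta (?T x) = kap * g x" for x
      unfolding g_eq using kap2 by (simp add: mult.assoc[symmetric])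
    have hi: "integrable gaussian (\<lambda>x. f x powr p * Theta (?T x))"
      unfolding h using gi by (rule integrable_mult_right)
    have "(\<integral> x. f x powr p * Theta (?T x) \<partial>gaussian) \<le> M ?X 0"
      by (rule gradient_inequality[where ?B0.0 = B0, unfolded pk])
         (use nonneg fB smooth_C11_on[OF smooth] fpi hi nz Xpos in auto)
    then show ?thesis unfolding h M_0 pk using gi by (simp add: mult.commute)
  qed
  show ?thesis
  proof (intro conjI impI)
    assume p: "p \<notin> {0..1}"
    have "kap = 1"
      using p unfolding kap_def pk by (auto simp: k_def sgn_if zero_less_divide_iff)
    then have gle: "g x \<le> f x powr p" for x
      unfolding g_eq using Theta_le_kap[OF T0[of x]] by (simp add: mult_left_le)
    show "(\<integral>\<^sup>+ x. ennreal (g x) \<partial>gaussian) \<le> ennreal (?X powr p) + (\<integral>\<^sup>+ x. ennreal (- g x) \<partial>gaussian)"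
    \<comment> \<open>An infinite negative part makes the claim trivial; otherwise \<open>g\<close>
      is integrable, since its positive part is dominated by \<open>f x powr p\<close>.\<close>
    proof (cases "(\<integral>\<^sup>+ x. ennreal (- g x) \<partial>gaussian) = \<infinity>")
      case False
      have "(\<integral>\<^sup>+ x. ennreal (g x) \<partial>gaussian) \<le> (\<integral>\<^sup>+ x. ennreal (f x powr p) \<partial>gaussian)"
        using gle by (intro nn_integral_mono ennreal_leI)
      also have "\<dots> < \<infinity>" using fpi by (simp add: nn_integral_eq_integral)
      finally have gf: "(\<integral>\<^sup>+ x. ennreal (g x) \<partial>gaussian) < \<infinity>" .
      have gi: "integrable gaussian g"
        using gf False unfolding real_integrable_def by (auto simp: less_top)
      have "(\<integral> x. g x \<partial>gaussian) \<le> ?X powr p" using main[OF gi] \<open>kap = 1\<close> by simp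
      moreover have "(\<integral> x. g x \<partial>gaussian) = enn2real (\<integral>\<^sup>+ x. ennreal (g x) \<partial>gaussian) - enn2real (\<integral>\<^sup>+ x. ennreal (- g x) \<partial>gaussian)"
        by (rule real_lebesgue_integral_def[OF gi])
      ultimately have "enn2real (\<integral>\<^sup>+ x. ennreal (g x) \<partial>gaussian) \<le> ?X powr p + enn2real (\<integral>\<^sup>+ x. ennreal (- g x) \<partial>gaussian)"
        by simp
      then have "ennreal (enn2real (\<integral>\<^sup>+ x. ennreal (g x) \<partial>gaussian)) \<le> ennreal (?X powr p) + ennreal (enn2real (\<integral>\<^sup>+ x. ennreal (- g x) \<partial>gaussian))"
        using ennreal_leI by fastforce
      then show ?thesis using gf False by (simp add: less_top)
    qed simp
  next
    assume p: "p \<in> {0<..<1}"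
    have kap: "kap = - 1"
      using p unfolding kap_def pk by (auto simp: k_def sgn_if zero_less_divide_iff)
    have g0: "g x \<ge> 0" for x
    proof -
      have "Theta (?T x) \<le> - 1" using Theta_le_kap[OF T0[of x]] kap by simp
      then show ?thesis unfolding g_eq kap by (simp add: mult_nonneg_nonpos)
    qed
    have neg0: "(\<integral>\<^sup>+ x. ennreal (- g x) \<partial>gaussian) = 0" using g0 by (simp add: ennreal_neg)
    show "ennreal (?X powr p) + (\<integral>\<^sup>+ x. ennreal (- g x) \<partial>gaussian) \<le> (\<integral>\<^sup>+ x. ennreal (g x) \<partial>gaussian)"
    \<comment> \<open>Here \<open>g\<close> is nonnegative, so an infinite integral satisfies the
      reverse inequality at once, and a finite one means integrability.\<close>
    proof (cases "(\<integral>\<^sup>+ x. ennreal (g x) \<partial>gaussian) = \<infinity>")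
      case False
      have gi: "integrable gaussian g"
        using g0 False by (intro integrableI_nonneg) (auto simp: less_top)
      have "?X powr p \<le> (\<integral> x. g x \<partial>gaussian)" using main[OF gi] kap by simp
      then show ?thesis
        unfolding neg0 nn_integral_eq_integral[OF gi AE_I2[OF g0]] by (simp add: ennreal_leI)
    qed simp
  qed
qed

end
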